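(* Let $p>1$, let $\alpha\in[0,\pi_p)$, $\beta\in(0,\pi_p]$, and let $q,w,f$ satisfy conditions (C1)–(C3) listed in the context, with $f_0,f_\infty\in[0,\infty]$ the limits in (C3). Let $\lambda_0<\lambda_1<\lambda_2<\cdots$ be the eigenvalues of the associated $p$-Laplacian eigenvalue problem defined in the context. Assume there exists $n$ such that either $\lambda_n\in(f_0,f_\infty)$ or $\lambda_n\in(f_\infty,f_0)$. Then the boundary value problem $$-(y'^{(p-1)})'+(p-1)q(x)y^{(p-1)}=(p-1)w(x)f(y)\quad\text{on }(0,1),$$ $$S_p'(\alpha)y(0)-S_p(\alpha)y'(0)=0,\qquad S_p'(\beta)y(1)-S_p(\beta)y'(1)=0$$ has a solution with exactly $n$ zeros in $(0,1)$.
   Context: Notation: for real $y$, $y^{(p-1)}=|y|^{p-1}\operatorname{sgn}y=|y|^{p-2}y$, and $y'^{(p-1)}=|y'|^{p-2}y'$. Put $\pi_p=\int_0^1\frac{2\,dt}{(1-t^p)^{1/p}}=\frac{2\pi/p}{\sin(\pi/p)}$. The generalized sine function $S_p$ is defined on $[0,\pi_p/2]$ as the inverse of $w\mapsto\int_0^w\frac{dt}{(1-t^p)^{1/p}}$, $0\le w\le1$, and extended by $S_p(x)=S_p(\pi_p-x)$ for $\pi_p/2\le x\le\pi_p$, $S_p(x)=-S_p(x-\pi_p)$ for $\pi_p\le x\le2\pi_p$, and $2\pi_p$-periodically to $\mathbb{R}$. It solves $(y'^{(p-1)})'=-(p-1)y^{(p-1)}$, $y(0)=0$, $y'(0)=1$.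 $S_p'$ is its derivative. Conditions: (C1) $q,w\in C^1[0,1]$ and $w>0$ on $[0,1]$. (C2) $f\in C(\mathbb{R})$, $f(s)>0$ for $s>0$, $f(-s)=-f(s)$ for $s>0$, and $f$ is locally Lipschitz continuous on $(0,\infty)$. (C3) There exist $0\le f_0,f_\infty\le\infty$ with $\lim_{s\to0^+}\frac{f(s)}{s^{p-1}}=f_0$ and $\lim_{s\to\infty}\frac{f(s)}{s^{p-1}}=f_\infty$. Eigenvalue problem: $-(y'^{(p-1)})'=(p-1)(\lambda w(x)-q(x))y^{(p-1)}$ on $(0,1)$, with the same boundary conditions $S_p'(\alpha)y(0)-S_p(\alpha)y'(0)=0$, $S_p'(\beta)y(1)-S_p(\beta)y'(1)=0$. It is known that its eigenvalues form a sequence $-\infty<\lambda_0<\lambda_1<\cdots<\lambda_n<\cdots\to\infty$ and that an eigenfunction corresponding to $\lambda_n$ has exactly $n$ zeros in $(0,1)$. The index $n$ ranges over nonnegative integers. *)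

theory Defs
  imports "HOL-Analysis.Analysis"
begin

text \<open>The signed power \<open>y\<^sup>(\<^sup>p\<^sup>-\<^sup>1\<^sup>) = |y|\<^sup>p\<^sup>-\<^sup>1 sgn y\<close>.\<close>

definition spow :: "real \<Rightarrow> real \<Rightarrow> real" where
  "spow p y = \<bar>y\<bar> powr (p - 1) * sgn y"

text \<open>The integrals below are improper at \<open>t = 1\<close>. The gauge integral takes care of this; the
  junk value of the integrand at \<open>t = 1\<close> (division by zero) is irrelevant.\<close>

definition pi_p :: "real \<Rightarrow> real" where
  "pi_p p = integral {0..1} (\<lambda>t. 2 / (1 - t powr p) powr (1 / p))"

definition arcS_p :: "real \<Rightarrow> real \<Rightarrow> real" where
  "arcS_p p w = integral {0..w} (\<lambda>t. 1 / (1 - t powr p) powr (1 / p))"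

text \<open>The generalized sine, first on \<open>[0, \<pi>\<^sub>p]\<close> (inverse function on the first half, reflection on the
  second half), then on the whole line: \<open>r\<close> is the representative of \<open>x\<close> in \<open>[0, 2\<pi>\<^sub>p)\<close> modulo the
  period.\<close>

definition S_p_half :: "real \<Rightarrow> real \<Rightarrow> real" where
  "S_p_half p x =
     (if x \<le> pi_p p / 2 then the_inv_into {0..1} (arcS_p p) x
      else the_inv_into {0..1} (arcS_p p) (pi_p p - x))"

definition S_p :: "real \<Rightarrow> real \<Rightarrow> real" where
  "S_p p x =
     (let r = x - 2 * pi_p p * of_int \<lfloor>x / (2 * pi_p p)\<rfloor>
      in if r \<le> pi_p p then S_p_half p r else - S_p_half p (r - pi_p p))"

text \<open>\<open>C\<^sup>1[0,1]\<close>, with one-sided derivatives at the endpoints (the library's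
  \<open>C1_differentiable_on\<close> would demand two-sided ones).\<close>

definition C1_01 :: "(real \<Rightarrow> real) \<Rightarrow> bool" where
  "C1_01 g \<longleftrightarrow> (\<exists>g'. continuous_on {0..1} g' \<and>
     (\<forall>x\<in>{0..1}. (g has_real_derivative g' x) (at x within {0..1})))"

definition locally_lipschitz_pos :: "(real \<Rightarrow> real) \<Rightarrow> bool" where
  "locally_lipschitz_pos f \<longleftrightarrow>
     (\<forall>s>0. \<exists>u>0. \<exists>L. L-lipschitz_on (cball s u \<inter> {0<..}) f)"

text \<open>Classical solutions of a separated boundary value problem: \<open>y\<close> is \<open>C\<^sup>1\<close> on \<open>[0,1]\<close>,
  \<open>D = (y'\<^sup>(\<^sup>p\<^sup>-\<^sup>1\<^sup>))'\<close> exists on \<open>(0,1)\<close>, and the relation \<open>E x (y x) (D x)\<close>, which stands for the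
  differential equation, holds there.\<close>

definition bvp_solution ::
    "real \<Rightarrow> real \<Rightarrow> real \<Rightarrow> (real \<Rightarrow> real \<Rightarrow> real \<Rightarrow> bool) \<Rightarrow> (real \<Rightarrow> real) \<Rightarrow> bool" where
  "bvp_solution p \<alpha> \<beta> E y \<longleftrightarrow>
     (\<exists>y' D. continuous_on {0..1} y' \<and>
        (\<forall>x\<in>{0..1}. (y has_real_derivative y' x) (at x within {0..1})) \<and>
        (\<forall>x\<in>{0<..<1}. ((\<lambda>t. spow p (y' t)) has_real_derivative D x) (at x) \<and> E x (y x) (D x)) \<and>
        deriv (S_p p) \<alpha> * y 0 - S_p p \<alpha> * y' 0 = 0 \<and>
        deriv (S_p p) \<beta> * y 1 - S_p p \<beta> * y' 1 = 0)"

definition p_eigenvalue ::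
    "real \<Rightarrow> (real \<Rightarrow> real) \<Rightarrow> (real \<Rightarrow> real) \<Rightarrow> real \<Rightarrow> real \<Rightarrow> real \<Rightarrow> bool" where
  "p_eigenvalue p q w \<alpha> \<beta> \<mu> \<longleftrightarrow>
     (\<exists>y. bvp_solution p \<alpha> \<beta> (\<lambda>x s d. - d = (p - 1) * (\<mu> * w x - q x) * spow p s) y \<and>
          (\<exists>x\<in>{0..1}. y x \<noteq> 0))"

definition nonlinear_solution ::
    "real \<Rightarrow> (real \<Rightarrow> real) \<Rightarrow> (real \<Rightarrow> real) \<Rightarrow> (real \<Rightarrow> real) \<Rightarrow> real \<Rightarrow> real \<Rightarrow> (real \<Rightarrow> real) \<Rightarrow> bool" where
  "nonlinear_solution p q w f \<alpha> \<beta> y \<longleftrightarrow>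
     bvp_solution p \<alpha> \<beta> (\<lambda>x s d. - d + (p - 1) * q x * spow p s = (p - 1) * w x * f s) y"

text \<open>Finiteness is required explicitly because \<open>card\<close> of an infinite set is \<open>0\<close>.\<close>

definition exactly_n_zeros :: "nat \<Rightarrow> (real \<Rightarrow> real) \<Rightarrow> bool" where
  "exactly_n_zeros n y \<longleftrightarrow>
     finite {x\<in>{0<..<1}. y x = 0} \<and> card {x\<in>{0<..<1}. y x = 0} = n"

end

theory Submission
  imports Defs "HOL-Complex_Analysis.Great_Picard"
begin

text \<open>Write \<open>\<phi>(s) = |s|\<^sup>p\<^sup>-\<^sup>1 sgn s\<close>, \<open>S\<close> for the generalized sine and \<open>C = S'\<close>, so that
\<open>|S|\<^sup>p + |C|\<^sup>p = 1\<close> and \<open>\<phi>(C)' = -(p - 1) \<phi>(S)\<close>. The proof works in the Pruefer coordinates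
\<open>y = e\<^sup>L S(\<theta>)\<close>, \<open>y' = e\<^sup>L C(\<theta>)\<close>, in which the equation becomes the system

\<open>\<theta>' = |C(\<theta>)|\<^sup>p + S(\<theta>) h\<close>, \<open>L' = C(\<theta>) (\<phi>(S(\<theta>)) - h)\<close>, where
\<open>h = w(x) f(e\<^sup>L S(\<theta>)) / e\<^sup>(\<^sup>p\<^sup>-\<^sup>1\<^sup>)\<^sup>L - q(x) \<phi>(S(\<theta>))\<close>.

The boundary conditions say that \<open>\<theta>(0) = \<alpha>\<close> and that \<open>\<theta>(1)\<close> is \<open>\<beta>\<close> modulo \<open>\<pi>\<^sub>p\<close>. At a zero
of \<open>y\<close> the angle \<open>\<theta>\<close> is a multiple of \<open>\<pi>\<^sub>p\<close> and \<open>\<theta>' = 1\<close>, so every multiple is crossed once and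
upwards; hence a solution with \<open>\<theta>(0) = \<alpha>\<close> and \<open>\<theta>(1) = \<beta> + n \<pi>\<^sub>p\<close> has exactly \<open>n\<close> zeros
(\<open>zeros_of_angle\<close>). It remains to find an initial amplitude \<open>L(0) = l\<close> for which \<open>\<theta>(1)\<close> has this
value.

The eigenvalue problem. For \<open>f(s) = \<mu> \<phi>(s)\<close> the equation for \<open>\<theta>\<close> does not involve \<open>L\<close> and is
Lipschitz in \<open>\<theta>\<close>, so \<open>\<theta>(1)\<close> is a function of \<open>\<mu>\<close> (\<open>endpoint\<close>). It is continuous, strictly
increasing, positive, and below any given positive number for very negative \<open>\<mu>\<close>. A number
\<open>\<mu>\<close> is an eigenvalue exactly if \<open>endpoint \<mu>\<close> is \<open>\<beta>\<close> modulo \<open>\<pi>\<^sub>p\<close>; one direction uses that two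
solutions that are parallel at \<open>0\<close> are parallel at \<open>1\<close>, because \<open>\<phi>(y'/y)\<close> and \<open>y/y'\<close> satisfy
Riccati equations with a locally Lipschitz right-hand side. By the intermediate value theorem the
eigenvalue number \<open>n\<close> therefore has \<open>endpoint (lam n) = \<beta> + n \<pi>\<^sub>p\<close>
(\<open>endpoint_of_nth_eigenvalue\<close>).

The two ends of the shooting interval. The energy
\<open>(|y|\<^sup>p + |y'|\<^sup>p)/p + w F(y)\<close> with \<open>F' = f\<close> changes at most by a constant factor on \<open>[0,1]\<close>, as
\<open>w\<close> is \<open>C\<^sup>1\<close> and positive. So if \<open>l\<close> is very negative, \<open>y\<close> stays so small that \<open>f(y)/\<phi>(y)\<close> is
close to \<open>f\<^sub>0\<close> everywhere, and comparison with the linear angle for a \<open>\<mu>\<close> between \<open>f\<^sub>0\<close> and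
\<open>lam n\<close> puts \<open>\<theta>(1)\<close> strictly on one side of \<open>\<beta> + n \<pi>\<^sub>p\<close>. If \<open>l\<close> is very large, so is \<open>L\<close> on all of
\<open>[0,1]\<close>; then the values of \<open>f\<close> on a bounded set contribute to \<open>h\<close> only a small error, the limit
of the quotient at infinity decides, and \<open>\<theta>(1)\<close> lies strictly on the other side.

In between, \<open>\<theta>(1)\<close> should depend continuously on \<open>l\<close>, but \<open>C\<close> and \<open>f\<close> enter the
right-hand side, and a solution of the initial value problem need not obviously be unique near a
zero of \<open>y\<close> or \<open>y'\<close>. The lemma \<open>shooting\<close> replaces uniqueness by compactness: if the right-hand side
is evaluated with a time delay, the solution is unique and continuous in \<open>l\<close>, so for every small
delay the intermediate value theorem gives a good \<open>l\<close>, and by the Arzela-Ascoli theorem the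
delayed solutions converge along a subsequence to a true solution. All that is needed is that at
the two ends every true solution has its angle on the right side, which the comparison gives.\<close>

section \<open>Differential inequalities and derivatives\<close>

text \<open>The bound holds in both directions of time because \<open>|g'| \<le> K g\<close> makes \<open>g e\<^sup>-\<^sup>K\<^sup>x\<close> decreasing and
\<open>g e\<^sup>K\<^sup>x\<close> increasing. It serves for uniqueness (\<open>g\<close> the square of a difference), for nonvanishing
of solutions, and for the energy.\<close>

lemma gronwall_two_sided:
  fixes g g' :: "real \<Rightarrow> real"
  assumes cont: "continuous_on {a..b} g"
    and der: "\<And>x. x \<in> {a<..<b} \<Longrightarrow> (g has_real_derivative g' x) (at x)"
    and bd: "\<And>x. x \<in> {a<..<b} \<Longrightarrow> \<bar>g' x\<bar> \<le> K * g x"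
    and st: "s \<in> {a..b}" "t \<in> {a..b}"
  shows "g t \<le> exp (K * \<bar>t - s\<bar>) * g s"
proof (cases "s \<le> t")
  case True
  have "g t * exp (- (K * t)) \<le> g s * exp (- (K * s))"
  proof (rule DERIV_nonpos_imp_decreasing_open[OF True])
    fix x assume x: "s < x" "x < t"
    with st have xab: "x \<in> {a<..<b}" by auto
    have "((\<lambda>x. g x * exp (- (K * x))) has_real_derivative
        (g' x - K * g x) * exp (- (K * x))) (at x)"
      by (rule derivative_eq_intros der[OF xab] refl | simp add: algebra_simps)+
    moreover have "(g' x - K * g x) * exp (- (K * x)) \<le> 0"
      using bd[OF xab] by (simp add: mult_le_0_iff)
    ultimately show "\<exists>y. DERIV (\<lambda>x. g x * exp (- (K * x))) x :> y \<and> y \<le> 0" by blast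
  qed (use st in \<open>auto intro!: continuous_intros continuous_on_subset[OF cont]\<close>)
  then have "g t * exp (- (K * t)) * exp (K * t) \<le> g s * exp (- (K * s)) * exp (K * t)"
    by (intro mult_right_mono) auto
  then show ?thesis
    using True by (simp add: mult.assoc exp_add[symmetric] algebra_simps)
next
  case False
  then have le: "t \<le> s" by simp
  have "g t * exp (K * t) \<le> g s * exp (K * s)"
  proof (rule DERIV_nonneg_imp_increasing_open[OF le])
    fix x assume x: "t < x" "x < s"
    with st have xab: "x \<in> {a<..<b}" by auto
    have "((\<lambda>x. g x * exp (K * x)) has_real_derivative
        (g' x + K * g x) * exp (K * x)) (at x)"
      by (rule derivative_eq_intros der[OF xab] refl | simp add: algebra_simps)+
    moreover have "(g' x + K * g x) * exp (K * x) \<ge> 0"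
      using bd[OF xab] by (simp add: zero_le_mult_iff)
    ultimately show "\<exists>y. DERIV (\<lambda>x. g x * exp (K * x)) x :> y \<and> 0 \<le> y" by blast
  qed (use st in \<open>auto intro!: continuous_intros continuous_on_subset[OF cont]\<close>)
  then have "g t * exp (K * t) * exp (- (K * t)) \<le> g s * exp (K * s) * exp (- (K * t))"
    by (intro mult_right_mono) auto
  then show ?thesis
    using False by (simp add: mult.assoc exp_add[symmetric] algebra_simps)
qed

text \<open>The comparison principle for scalar equations. The derivative is only controlled where \<open>d > 0\<close>;
this suffices because the estimate can be started at the last point before \<open>x\<close> with \<open>d \<le> 0\<close>.\<close>

lemma one_sided_gronwall:
  fixes d d' :: "real \<Rightarrow> real"
  assumes cont: "continuous_on {a..b} d"
    and der: "\<And>x. x \<in> {a<..<b} \<Longrightarrow> (d has_real_derivative d' x) (at x)"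
    and bd: "\<And>x. x \<in> {a<..<b} \<Longrightarrow> d x > 0 \<Longrightarrow> d' x \<le> K * d x + \<delta>"
    and nn: "\<delta> \<ge> 0" "K \<ge> 0" and init: "d a \<le> 0" and x: "x \<in> {a..b}"
  shows "d x \<le> \<delta> * (b - a) * exp (K * (b - a))"
proof (cases "d x \<le> 0")
  case True
  with x nn show ?thesis by (smt (verit, best) atLeastAtMost_iff exp_gt_zero mult_nonneg_nonneg)
next
  case False
  \<comment> \<open>the last point before \<open>x\<close> with \<open>d \<le> 0\<close> is the maximum of this compact set\<close>
  define Z where "Z = {t \<in> {a..x}. d t \<le> 0}"
  have "continuous_on {a..x} d" using x by (auto intro: continuous_on_subset[OF cont])
  then have "closed Z" unfolding Z_def
    by (intro continuous_on_closed_Collect_le) auto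
  then have "compact Z"
    by (auto simp: compact_eq_bounded_closed Z_def intro: bounded_subset[of "{a..x}"])
  moreover have "Z \<noteq> {}" using init x by (auto simp: Z_def)
  ultimately obtain s where s: "s \<in> Z" "\<And>t. t \<in> Z \<Longrightarrow> t \<le> s"
    using compact_attains_sup[of Z] by blast
  have sx: "a \<le> s" "s \<le> x" "d s \<le> 0" using s(1) unfolding Z_def by auto
  with False have "s < x" by (cases "s = x") auto
  have pos: "d t > 0" if "s < t" "t \<le> x" for t
    using s(2)[of t] that sx by (force simp: Z_def)
  note sx = \<open>s < x\<close> sx
  have "d x * exp (- (K * (x - a))) - \<delta> * x \<le> d s * exp (- (K * (s - a))) - \<delta> * s"
  proof (rule DERIV_nonpos_imp_decreasing_open[OF less_imp_le[OF \<open>s < x\<close>]])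
    fix t assume t: "s < t" "t < x"
    with x sx have tab: "t \<in> {a<..<b}" by auto
    have dd: "((\<lambda>x. d x * exp (- (K * (x - a))) - \<delta> * x) has_real_derivative
        (d' t - K * d t) * exp (- (K * (t - a))) - \<delta>) (at t)"
      by (rule derivative_eq_intros der[OF tab] refl | simp add: algebra_simps)+
    have "(d' t - K * d t) * exp (- (K * (t - a))) \<le> \<delta> * exp (- (K * (t - a)))"
      using bd[OF tab pos] t by (intro mult_right_mono) auto
    moreover have "\<delta> * exp (- (K * (t - a))) \<le> \<delta> * 1"
      using nn tab by (intro mult_left_mono) auto
    ultimately have "(d' t - K * d t) * exp (- (K * (t - a))) - \<delta> \<le> 0" by linarith
    with dd show "\<exists>y. DERIV (\<lambda>x. d x * exp (- (K * (x - a))) - \<delta> * x) t :> y \<and> y \<le> 0"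
      by blast
  qed (use x sx in \<open>auto intro!: continuous_intros continuous_on_subset[OF cont]\<close>)
  moreover have "d s * exp (- (K * (s - a))) \<le> 0" using sx by (simp add: mult_le_0_iff)
  ultimately have "d x * exp (- (K * (x - a))) \<le> \<delta> * (x - s)" by (simp add: algebra_simps)
  also have "\<dots> \<le> \<delta> * (b - a)" using nn x sx by (intro mult_left_mono) auto
  finally have "d x * exp (- (K * (x - a))) * exp (K * (x - a)) \<le> \<delta> * (b - a) * exp (K * (x - a))"
    by (intro mult_right_mono) auto
  also have "\<dots> \<le> \<delta> * (b - a) * exp (K * (b - a))"
    using nn x by (intro mult_left_mono) (auto intro!: mult_left_mono mult_nonneg_nonneg)
  finally show ?thesis by (simp add: mult.assoc exp_add[symmetric])
qed

text \<open>A function that meets the level \<open>c\<close> only with positive slope leaves it upwards, and cannot come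
back: at the first return it would arrive from above.\<close>

lemma stays_above:
  fixes \<theta> \<theta>' :: "real \<Rightarrow> real"
  assumes cont: "continuous_on {a..b} \<theta>"
    and der: "\<And>x. x \<in> {a..b} \<Longrightarrow> \<theta> x = c \<Longrightarrow>
        (\<theta> has_real_derivative \<theta>' x) (at x within {a..b}) \<and> \<theta>' x > 0"
    and st: "a \<le> s" "s < t" "t \<le> b" and ge: "\<theta> s \<ge> c"
  shows "\<theta> t > c"
proof (rule ccontr)
  assume neg: "\<not> \<theta> t > c"
  obtain r where r: "s \<le> r" "r \<le> t" "\<theta> r > c"
  proof (cases "\<theta> s > c")
    case True
    then show thesis using that[of s] st by simp
  next
    case False
    with ge have eq: "\<theta> s = c" by simp
    obtain d where d: "d > 0" "\<And>h. h > 0 \<Longrightarrow> s + h \<in> {a..b} \<Longrightarrow> h < d \<Longrightarrow> \<theta> s < \<theta> (s + h)"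
      using has_real_derivative_pos_inc_right[of \<theta> "\<theta>' s" s "{a..b}"] der[of s] st eq by auto
    define h where "h = min (d / 2) (t - s)"
    have h: "0 < h" "h < d" "h \<le> t - s" using d(1) st by (auto simp: h_def min_def)
    then have "\<theta> s < \<theta> (s + h)" using st by (intro d(2)) auto
    then show thesis using that[of "s + h"] h eq by simp
  qed
  define Z where "Z = {u \<in> {r..t}. \<theta> u \<le> c}"
  have contr: "continuous_on {r..t} \<theta>" using r st by (auto intro: continuous_on_subset[OF cont])
  then have "closed Z" unfolding Z_def
    by (intro continuous_on_closed_Collect_le) auto
  then have "compact Z"
    by (auto simp: compact_eq_bounded_closed Z_def intro: bounded_subset[of "{r..t}"])
  moreover have "t \<in> Z" using r neg by (auto simp: Z_def)
  ultimately obtain u where u: "u \<in> Z" "\<And>v. v \<in> Z \<Longrightarrow> u \<le> v"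
    using compact_attains_inf[of Z] by blast
  have ur: "r \<le> u" "u \<le> t" "\<theta> u \<le> c" using u(1) by (auto simp: Z_def)
  with r have "r < u" by (cases "r = u") auto
  note ur = \<open>r < u\<close> ur
  have above: "\<theta> v > c" if "r \<le> v" "v < u" for v
    using u(2)[of v] that ur by (force simp: Z_def)
  have "\<theta> u = c"
  proof (rule ccontr)
    assume "\<theta> u \<noteq> c"
    moreover have "continuous_on {r..u} \<theta>" using ur by (auto intro: continuous_on_subset[OF contr])
    ultimately obtain v where "r \<le> v" "v \<le> u" "\<theta> v = c"
      using IVT2'[of \<theta> u c r] ur r by auto
    then show False using above[of v] \<open>\<theta> u \<noteq> c\<close> by (cases "v = u") auto
  qed
  then obtain e where e: "e > 0" "\<And>h. h > 0 \<Longrightarrow> u - h \<in> {a..b} \<Longrightarrow> h < e \<Longrightarrow> \<theta> (u - h) < \<theta> u"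
    using has_real_derivative_pos_inc_left[of \<theta> "\<theta>' u" u "{a..b}"] der[of u] ur r st by auto
  have "\<theta> (u - min (e / 2) (u - r)) < \<theta> u"
    by (rule e(2)) (use e(1) ur r st in auto)
  moreover have "\<theta> (u - min (e / 2) (u - r)) > c"
    by (rule above) (use e(1) ur in auto)
  ultimately show False using \<open>\<theta> u = c\<close> by simp
qed

lemma locally_zero_derivative:
  fixes f :: "real \<Rightarrow> real"
  assumes "(f has_real_derivative D) (at x)" "x \<in> {a<..<b}" "\<And>u. u \<in> {a<..<b} \<Longrightarrow> f u = 0"
  shows "D = 0"
proof -
  have "((\<lambda>_. 0) has_real_derivative D) (at x)"
    by (rule has_field_derivative_transform_within_open[OF assms(1), of "{a<..<b}"]) (use assms in auto)
  then show ?thesis using DERIV_unique[OF _ DERIV_const] by blast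
qed

lemma continuous_interval_bounded:
  fixes f :: "real \<Rightarrow> real"
  assumes "continuous_on {a..b} f"
  obtains N where "N > 0" "\<And>x. x \<in> {a..b} \<Longrightarrow> \<bar>f x\<bar> \<le> N"
proof -
  obtain N where N: "\<forall>y\<in>f ` {a..b}. norm y \<le> N"
    using compact_imp_bounded[OF compact_continuous_image[OF assms compact_Icc]]
    unfolding bounded_iff by blast
  have "\<bar>f x\<bar> \<le> max N 1" if "x \<in> {a..b}" for x
  proof -
    have "norm (f x) \<le> N" using N that by blast
    then show ?thesis by simp
  qed
  then show thesis using that[of "max N 1"] by simp
qed

text \<open>By the fundamental theorem of calculus \<open>F\<close> is an integral of the continuous function \<open>F'\<close>, so the
derivative exists at the exceptional points as well. This glues the pieces of the generalized
sine without computing one-sided derivatives at the joints.\<close>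

lemma has_derivative_remove_exceptions:
  fixes F F' :: "real \<Rightarrow> real"
  assumes "finite E" and F: "continuous_on {a..b} F" and F': "continuous_on {a..b} F'"
    and der: "\<And>x. x \<in> {a<..<b} - E \<Longrightarrow> (F has_real_derivative F' x) (at x)"
    and x: "x \<in> {a<..<b}"
  shows "(F has_real_derivative F' x) (at x)"
proof -
  have int: "integral {a..u} F' = F u - F a" if "u \<in> {a..b}" for u
  proof (rule integral_unique)
    show "(F' has_integral F u - F a) {a..u}"
      by (rule fundamental_theorem_of_calculus_interior_strong[OF assms(1)])
         (use that der in \<open>auto simp: has_real_derivative_iff_has_vector_derivative[symmetric]
            intro: continuous_on_subset[OF F]\<close>)
  qed
  have "((\<lambda>u. F a + integral {a..u} F') has_real_derivative 0 + F' x) (at x within {a..b})"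
    by (intro DERIV_add DERIV_const integral_has_real_derivative F') (use x in auto)
  then have "((\<lambda>u. F a + integral {a..u} F') has_real_derivative F' x) (at x)"
    using x by (simp add: at_within_Icc_at)
  then show ?thesis
    by (rule has_field_derivative_transform_within_open[where S="{a<..<b}"]) (use x int in auto)
qed

lemma isCont_shift_iff: "isCont f (x + c) \<longleftrightarrow> isCont (\<lambda>x. f (x + c)) (x::real)" for f :: "real \<Rightarrow> real"
  using LIM_offset[of f "f (x + c)" "x + c" c] LIM_offset[of "\<lambda>x. f (x + c)" "f (x + c)" x "- c"]
  by (auto simp: isCont_def)

lemma DERIV_reflect: "(f has_real_derivative D) (at (c - x)) \<Longrightarrow> ((\<lambda>x. f (c - x)) has_real_derivative - D) (at x)"
  for f :: "real \<Rightarrow> real"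
proof -
  assume f: "(f has_real_derivative D) (at (c - x))"
  have "((\<lambda>x. c - x) has_real_derivative -1) (at x)" by (auto intro!: derivative_eq_intros)
  from DERIV_chain2[OF f this] show ?thesis by simp
qed

lemma DERIV_minus_iff: "((\<lambda>x. - f x) has_real_derivative - D) (at x) \<longleftrightarrow> (f has_real_derivative D) (at x)"
  for f :: "real \<Rightarrow> real"
  using DERIV_minus[of f D x UNIV] DERIV_minus[of "\<lambda>x. - f x" "- D" x UNIV] by auto

lemma DERIV_shift_iff: "(f has_real_derivative D) (at (x + c)) \<longleftrightarrow> ((\<lambda>x. f (x + c)) has_real_derivative D) (at x)"
  for f :: "real \<Rightarrow> real"
  using DERIV_shift[of f D x c] by simp

text \<open>Extends coefficients given on \<open>[0,1]\<close> continuously to the whole line.\<close>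

definition clamp01 :: "real \<Rightarrow> real" where "clamp01 x = max 0 (min 1 x)"

lemma clamp01: "continuous_on A clamp01" "clamp01 x \<in> {0..1}" "x \<in> {0..1} \<Longrightarrow> clamp01 x = x"
  by (auto simp: clamp01_def[abs_def] intro!: continuous_intros)

section \<open>Solutions of differential equations as limits of delayed equations\<close>

text \<open>Each step of the iteration is correct on a further time interval of length \<open>h\<close>: the integrand at
time \<open>s\<close> only looks at the previous iterate at time \<open>s - h\<close>. For \<open>t \<le> 0\<close> the integral is over the
empty set, so the iterates are constant there and supply the history of the delay.\<close>

primrec tonelli :: "(real \<Rightarrow> 'a \<Rightarrow> 'a) \<Rightarrow> real \<Rightarrow> nat \<Rightarrow> 'a::euclidean_space \<Rightarrow> real \<Rightarrow> 'a" where
  "tonelli V h 0 x t = x"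
| "tonelli V h (Suc j) x t = x + integral {0..t} (\<lambda>s. V s (tonelli V h j x (s - h)))"

definition ode_solution :: "(real \<Rightarrow> 'a \<Rightarrow> 'a::euclidean_space) \<Rightarrow> 'a \<Rightarrow> (real \<Rightarrow> 'a) \<Rightarrow> bool" where
  "ode_solution V x g \<longleftrightarrow>
     g 0 = x \<and> (\<forall>t\<in>{0..1}. (g has_vector_derivative V t (g t)) (at t within {0..1}))"

locale bounded_field =
  fixes V :: "real \<Rightarrow> 'a::euclidean_space \<Rightarrow> 'a" and B :: real
  assumes cont: "continuous_on UNIV (\<lambda>z. V (fst z) (snd z))"
    and bound: "norm (V t x) \<le> B"
begin

lemma B_nonneg: "B \<ge> 0"
  using bound[of 0 0] norm_ge_zero[of "V 0 0"] by linarith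

lemma field_continuous:
  "continuous_on S u \<Longrightarrow> continuous_on S v \<Longrightarrow> continuous_on S (\<lambda>x. V (u x) (v x))"
  using continuous_on_compose2[OF cont, of S "\<lambda>x. (u x, v x)"] by (auto intro!: continuous_intros)

text \<open>The integral over \<open>{0..t}\<close> vanishes for negative \<open>t\<close>, so the bound holds on the whole line.\<close>

lemma integral_lipschitz:
  assumes "continuous_on UNIV y"
  shows "norm (integral {0..t} (\<lambda>s. V s (y s)) - integral {0..t'} (\<lambda>s. V s (y s))) \<le> B * \<bar>t - t'\<bar>"
proof -
  have int: "(\<lambda>s. V s (y s)) integrable_on {a..b}" for a b
    by (intro integrable_continuous_real field_continuous continuous_intros
        continuous_on_subset[OF assms]) auto
  have main: "norm (integral {0..t} (\<lambda>s. V s (y s)) - integral {0..t'} (\<lambda>s. V s (y s))) \<le> B * \<bar>t - t'\<bar>"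
    if "t' \<le> t" for t t'
  proof (cases "t' \<ge> 0")
    case True
    have "integral {0..t'} (\<lambda>s. V s (y s)) + integral {t'..t} (\<lambda>s. V s (y s)) = integral {0..t} (\<lambda>s. V s (y s))"
      using that True int by (intro Henstock_Kurzweil_Integration.integral_combine) auto
    moreover have "norm (integral {t'..t} (\<lambda>s. V s (y s))) \<le> B * (t - t')"
      using that by (intro integral_bound field_continuous continuous_intros bound
        continuous_on_subset[OF assms]) auto
    ultimately have "norm (integral {0..t} (\<lambda>s. V s (y s)) - integral {0..t'} (\<lambda>s. V s (y s))) \<le> B * (t - t')"
      by (metis add_diff_cancel_left')
    then show ?thesis using that by simp
  next
    case False
    show ?thesis
    proof (cases "t \<ge> 0")
      case True
      have "norm (integral {0..t} (\<lambda>s. V s (y s))) \<le> B * (t - 0)"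
        using True by (intro integral_bound field_continuous continuous_intros bound
          continuous_on_subset[OF assms]) auto
      also have "\<dots> \<le> B * \<bar>t - t'\<bar>" using False B_nonneg by (intro mult_left_mono) auto
      finally show ?thesis using False by simp
    next
      case False
      then show ?thesis using that B_nonneg by simp
    qed
  qed
  show ?thesis
    using main[of t' t] main[of t t'] by (cases "t' \<le> t") (auto simp: norm_minus_commute abs_minus_commute)
qed

text \<open>Joint continuity in the initial value and time is what the induction needs, since the integrand
is evaluated along the previous iterate. It follows from continuity in the initial value for
fixed time and the Lipschitz bound in time.\<close>

lemma tonelli_continuous: "continuous_on UNIV (\<lambda>z. tonelli V h j (fst z) (snd z))"
proof (induction j)
  case 0
  then show ?case by (simp add: continuous_intros)
next
  case (Suc j)
  let ?I = "\<lambda>x t. integral {0..t} (\<lambda>s. V s (tonelli V h j x (s - h)))"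
  have joint: "continuous_on UNIV (\<lambda>z. V (snd z) (tonelli V h j (fst z) (snd z - h)))"
    by (intro field_continuous continuous_on_compose2[OF Suc, of UNIV "\<lambda>z. (fst z, snd z - h)", simplified]
        continuous_intros)
  have in_x: "continuous_on UNIV (\<lambda>x. ?I x t)" for t
    using integral_continuous_on_param[of UNIV 0 t "\<lambda>x s. V s (tonelli V h j x (s - h))"]
      continuous_on_subset[OF joint]
    by (auto simp: case_prod_beta')
  have in_t: "norm (?I x t - ?I x t') \<le> B * \<bar>t - t'\<bar>" for x t t'
    by (intro integral_lipschitz continuous_on_compose2[OF Suc, of UNIV "\<lambda>s. (x, s - h)", simplified]
        continuous_intros)
  have "continuous (at z) (\<lambda>z. ?I (fst z) (snd z))" for z
  proof -
    obtain x t where z: "z = (x, t)" by fastforce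
    have "((\<lambda>z. ?I (fst z) (snd z) - ?I (fst z) t) \<longlongrightarrow> 0) (at z)"
    proof (rule Lim_null_comparison)
      show "\<forall>\<^sub>F z' in at z. norm (?I (fst z') (snd z') - ?I (fst z') t) \<le> B * \<bar>snd z' - t\<bar>"
        using in_t by simp
      have "((\<lambda>z'. B * \<bar>snd z' - t\<bar>) \<longlongrightarrow> B * \<bar>snd z - t\<bar>) (at z)"
        by (intro tendsto_intros)
      then show "((\<lambda>z'. B * \<bar>snd z' - t\<bar>) \<longlongrightarrow> 0) (at z)" by (simp add: z)
    qed
    moreover have "((\<lambda>z. ?I (fst z) t) \<longlongrightarrow> ?I (fst z) t) (at z)"
      using in_x[of t] tendsto_fst[OF tendsto_ident_at, of z UNIV]
      by (auto simp: continuous_on_eq_continuous_at intro: isCont_tendsto_compose)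
    ultimately have "((\<lambda>z. ?I (fst z) (snd z)) \<longlongrightarrow> 0 + ?I (fst z) t) (at z)"
      using tendsto_add by fastforce
    then show ?thesis by (simp add: continuous_at z)
  qed
  then have "continuous_on UNIV (\<lambda>z. ?I (fst z) (snd z))"
    by (simp add: continuous_on_eq_continuous_at)
  then show ?case by (auto intro!: continuous_intros)
qed

lemma tonelli_continuous_compose:
  "continuous_on S u \<Longrightarrow> continuous_on S v \<Longrightarrow> continuous_on S (\<lambda>s. tonelli V h j (u s) (v s))"
  using continuous_on_compose2[OF tonelli_continuous continuous_on_Pair, of S u v h j] by simp

lemma tonelli_stable:
  assumes "h > 0" "t \<le> real j * h"
  shows "tonelli V h (Suc j) x t = tonelli V h j x t"
  using assms(2)
proof (induction j arbitrary: t)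
  case 0
  then show ?case by (cases "t = 0") auto
next
  case (Suc j)
  have "integral {0..t} (\<lambda>s. V s (tonelli V h (Suc j) x (s - h))) =
      integral {0..t} (\<lambda>s. V s (tonelli V h j x (s - h)))"
  proof (rule integral_cong)
    fix s assume "s \<in> {0..t}"
    then have "s - h \<le> real j * h" using Suc.prems by (auto simp: algebra_simps)
    then show "V s (tonelli V h (Suc j) x (s - h)) = V s (tonelli V h j x (s - h))"
      using Suc.IH by metis
  qed
  then show ?case by (metis tonelli.simps(2))
qed

text \<open>With delay \<open>1/(k+1)\<close> the iteration is stationary on \<open>[0,1]\<close> after \<open>k+1\<close> steps.\<close>

definition delayed :: "nat \<Rightarrow> 'a \<Rightarrow> real \<Rightarrow> 'a" where
  "delayed k = tonelli V (1 / real (Suc k)) (Suc k)"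

lemma delayed_eq:
  assumes "t \<le> 1"
  shows "delayed k x t = x + integral {0..t} (\<lambda>s. V s (delayed k x (s - 1 / real (Suc k))))"
proof -
  have "t \<le> real (Suc k) * (1 / real (Suc k))" using assms by simp
  from tonelli_stable[OF _ this, of x] show ?thesis
    unfolding delayed_def tonelli.simps(2)[of V _ "Suc k"] by simp
qed

lemma delayed_lipschitz: "norm (delayed k x t - delayed k x t') \<le> B * \<bar>t - t'\<bar>"
  using integral_lipschitz[of "\<lambda>s. tonelli V (1 / real (Suc k)) k x (s - 1 / real (Suc k))" t t',
      OF tonelli_continuous_compose[OF continuous_on_const continuous_on_diff[OF continuous_on_id continuous_on_const]]]
  unfolding delayed_def tonelli.simps add_diff_cancel_left by simp

lemma delayed_continuous: "continuous_on UNIV (\<lambda>x. delayed k x t)"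
  unfolding delayed_def by (intro tonelli_continuous_compose continuous_intros)

text \<open>The delayed solutions are uniformly bounded and equi-Lipschitz, so a subsequence converges
uniformly. The shift by the delay disappears in the limit by the Lipschitz bound, and dominated
convergence carries the integral equation over.\<close>

lemma delayed_limit:
  assumes "x \<longlonglongrightarrow> x0" and "filterlim m at_top sequentially"
  obtains g r where "strict_mono (r :: nat \<Rightarrow> nat)" "ode_solution V x0 g"
    "\<And>t. t \<in> {0..1} \<Longrightarrow> (\<lambda>k. delayed (m (r k)) (x (r k)) t) \<longlonglongrightarrow> g t"
proof -
  define F where "F k = delayed (m k) (x k)" for k
  obtain M where M: "\<And>k. norm (x k) \<le> M"
    using convergent_imp_Bseq[of x] assms(1) by (auto simp: convergent_def Bseq_def)
  have F0: "F k 0 = x k" for k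
    unfolding F_def by (subst delayed_eq) auto
  have lip: "norm (F k t - F k t') \<le> B * \<bar>t - t'\<bar>" for k t t'
    unfolding F_def by (rule delayed_lipschitz)
  have bdd: "norm (F k t) \<le> M + B" if "t \<in> {0..1}" for k t
  proof -
    have "norm (F k t) \<le> norm (F k 0) + norm (F k t - F k 0)" by (metis add_diff_cancel_left' norm_triangle_sub)
    also have "\<dots> \<le> M + B * \<bar>t - 0\<bar>" using F0[of k] M[of k] lip[of k t 0] by simp
    also have "\<dots> \<le> M + B" using that B_nonneg by (auto intro!: mult_left_le)
    finally show ?thesis .
  qed
  have equi: "\<exists>d. 0 < d \<and> (\<forall>n y. y \<in> {0..1} \<and> norm (t - y) < d \<longrightarrow> norm (F n t - F n y) < e)"
    if "e > 0" for t e :: real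
  proof (intro exI[of _ "e / (B + 1)"] conjI allI impI)
    show "0 < e / (B + 1)" using that B_nonneg by (simp add: field_simps)
    fix n y assume y: "y \<in> {0..1} \<and> norm (t - y) < e / (B + 1)"
    have "norm (F n t - F n y) \<le> B * \<bar>t - y\<bar>" by (rule lip)
    also have "\<dots> \<le> (B + 1) * \<bar>t - y\<bar>" by (simp add: algebra_simps)
    also have "\<dots> < e" using y B_nonneg by (auto simp: field_simps)
    finally show "norm (F n t - F n y) < e" .
  qed
  obtain g r where g: "continuous_on {0..1} g" "strict_mono (r :: nat \<Rightarrow> nat)"
    "\<And>e. 0 < e \<Longrightarrow> \<exists>N. \<forall>n t. n \<ge> N \<and> t \<in> {0..1} \<longrightarrow> norm (F (r n) t - g t) < e"
    using Arzela_Ascoli[of "{0..1::real}" F "M + B"] bdd equi by (metis compact_Icc)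
  have lim: "(\<lambda>k. F (r k) t) \<longlonglongrightarrow> g t" if "t \<in> {0..1}" for t
    unfolding LIMSEQ_iff using g(3) that by blast
  have rlim: "filterlim r at_top sequentially" using g(2) by (rule filterlim_subseq)
  have delay: "(\<lambda>k. 1 / real (Suc (m (r k)))) \<longlonglongrightarrow> 0"
    using filterlim_compose[OF LIMSEQ_inverse_real_of_nat filterlim_compose[OF assms(2) rlim]]
    by (simp add: inverse_eq_divide)
  have lim_delayed: "(\<lambda>k. F (r k) (s - 1 / real (Suc (m (r k))))) \<longlonglongrightarrow> g s" if "s \<in> {0..1}" for s
  proof -
    have "(\<lambda>k. F (r k) (s - 1 / real (Suc (m (r k)))) - F (r k) s) \<longlonglongrightarrow> 0"
    proof (rule Lim_null_comparison)
      show "\<forall>\<^sub>F k in sequentially. norm (F (r k) (s - 1 / real (Suc (m (r k)))) - F (r k) s)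
          \<le> B * (1 / real (Suc (m (r k))))"
        using lip[of "r _" "s - 1 / real (Suc (m (r _)))" s] by (intro always_eventually allI) simp
      show "(\<lambda>k. B * (1 / real (Suc (m (r k))))) \<longlonglongrightarrow> 0"
        using tendsto_mult[OF tendsto_const delay, of B] by simp
    qed
    from tendsto_add[OF this lim[OF that]] show ?thesis by simp
  qed
  have int_eq: "g t = x0 + integral {0..t} (\<lambda>s. V s (g s))" if t: "t \<in> {0..1}" for t
  proof -
    have "(\<lambda>k. integral {0..t} (\<lambda>s. V s (F (r k) (s - 1 / real (Suc (m (r k)))))))
        \<longlonglongrightarrow> integral {0..t} (\<lambda>s. V s (g s))"
    proof (rule dominated_convergence(2))
      show "(\<lambda>s. V s (F (r k) (s - 1 / real (Suc (m (r k)))))) integrable_on {0..t}" for k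
        unfolding F_def delayed_def
        by (intro integrable_continuous_real field_continuous continuous_intros
            tonelli_continuous_compose)
      show "(\<lambda>s. B) integrable_on {0..t}" by (rule integrable_const_ivl)
      show "norm (V s (F (r k) (s - 1 / real (Suc (m (r k)))))) \<le> B" for k s by (rule bound)
      show "(\<lambda>k. V s (F (r k) (s - 1 / real (Suc (m (r k)))))) \<longlonglongrightarrow> V s (g s)" if "s \<in> {0..t}" for s
      proof -
        have "continuous_on UNIV (V s)" by (intro field_continuous continuous_intros)
        then show ?thesis
          using lim_delayed[of s] that t
          by (auto simp: continuous_on_eq_continuous_at intro: isCont_tendsto_compose)
      qed
    qed
    moreover have "(\<lambda>k. x (r k)) \<longlonglongrightarrow> x0" using filterlim_compose[OF assms(1) rlim] .
    ultimately have "(\<lambda>k. F (r k) t) \<longlonglongrightarrow> x0 + integral {0..t} (\<lambda>s. V s (g s))"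
      using t tendsto_add unfolding F_def by (subst delayed_eq) auto
    then show ?thesis using lim[OF t] LIMSEQ_unique by blast
  qed
  have "(g has_vector_derivative V t (g t)) (at t within {0..1})" if t: "t \<in> {0..1}" for t
  proof -
    have "((\<lambda>u. x0 + integral {0..u} (\<lambda>s. V s (g s))) has_vector_derivative 0 + V t (g t)) (at t within {0..1})"
      by (intro has_vector_derivative_add has_vector_derivative_const integral_has_vector_derivative
          field_continuous continuous_intros g(1) t)
    then show ?thesis
      using int_eq t by (auto elim!: has_vector_derivative_transform[rotated 2])
  qed
  moreover have "g 0 = x0" using int_eq[of 0] by simp
  ultimately have "ode_solution V x0 g" by (simp add: ode_solution_def)
  then show thesis using that g(2) lim unfolding F_def by blast
qed

lemma peano: obtains g where "ode_solution V x0 g"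
  using delayed_limit[of "\<lambda>_. x0" x0 "\<lambda>k. k"] by (auto simp: filterlim_ident)

text \<open>A Kneser-type theorem: solutions need not be unique, so \<open>l (g 1)\<close> is a multivalued function of
the parameter \<open>\<mu>\<close>. At the two end parameters the delayed solutions inherit the strict inequalities for
small delays, since otherwise a limit of them would be a true solution violating them. Hence for
small delays the intermediate value theorem yields a parameter that hits \<open>c\<close>, and a limit of
these parameters and delayed solutions is as required.\<close>

lemma shooting:
  fixes x :: "real \<Rightarrow> 'a" and l :: "'a \<Rightarrow> real"
  assumes ab: "a \<le> b" and x: "continuous_on {a..b} x" and l: "continuous_on UNIV l"
    and lo: "\<And>g. ode_solution V (x a) g \<Longrightarrow> l (g 1) < c"
    and hi: "\<And>g. ode_solution V (x b) g \<Longrightarrow> l (g 1) > c"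
  obtains \<mu> g where "\<mu> \<in> {a..b}" "ode_solution V (x \<mu>) g" "l (g 1) = c"
proof -
  have tl: "(\<lambda>k. l (u k)) \<longlonglongrightarrow> l v" if "u \<longlonglongrightarrow> v" for u and v :: 'a
    using l that by (auto simp: continuous_on_eq_continuous_at intro: isCont_tendsto_compose)
  have fin: "\<forall>\<^sub>F k in sequentially. s * l (delayed k y 1) < s * c"
    if lt: "\<And>g. ode_solution V y g \<Longrightarrow> s * l (g 1) < s * c" for y and s :: real
  proof (rule ccontr)
    assume "\<not> ?thesis"
    then have "\<exists>\<^sub>F k in sequentially. s * l (delayed k y 1) \<ge> s * c"
      by (simp add: not_eventually not_less)
    then obtain m :: "nat \<Rightarrow> nat" where m: "strict_mono m" "\<And>k. s * l (delayed (m k) y 1) \<ge> s * c"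
      using infinite_enumerate[of "{k. s * l (delayed k y 1) \<ge> s * c}"]
      by (auto simp: INFM_iff_infinite cofinite_eq_sequentially[symmetric])
    obtain g r where g: "strict_mono (r :: nat \<Rightarrow> nat)" "ode_solution V y g"
      "\<And>t. t \<in> {0..1} \<Longrightarrow> (\<lambda>k. delayed (m (r k)) y t) \<longlonglongrightarrow> g t"
      using delayed_limit[OF tendsto_const filterlim_subseq[OF m(1)], of y] by blast
    have "(\<lambda>k. s * l (delayed (m (r k)) y 1)) \<longlonglongrightarrow> s * l (g 1)"
      by (intro tendsto_intros tl g(3)) auto
    then have "s * c \<le> s * l (g 1)" using m(2) by (intro LIMSEQ_le_const) auto
    then show False using lt[OF g(2)] by simp
  qed
  have "\<forall>\<^sub>F k in sequentially. 1 * l (delayed k (x a) 1) < 1 * c" by (rule fin) (use lo in simp)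
  moreover have "\<forall>\<^sub>F k in sequentially. (-1) * l (delayed k (x b) 1) < (-1) * c"
    by (rule fin) (use hi in simp)
  ultimately have "\<forall>\<^sub>F k in sequentially. l (delayed k (x a) 1) < c \<and> l (delayed k (x b) 1) > c"
    by eventually_elim simp
  then obtain N where N: "\<And>k. k \<ge> N \<Longrightarrow> l (delayed k (x a) 1) < c \<and> l (delayed k (x b) 1) > c"
    by (auto simp: eventually_sequentially)
  have "\<exists>\<mu>\<in>{a..b}. l (delayed (k + N) (x \<mu>) 1) = c" for k
  proof -
    have "continuous_on {a..b} (\<lambda>\<mu>. l (delayed (k + N) (x \<mu>) 1))"
      by (rule continuous_on_compose2[OF l continuous_on_compose2[OF delayed_continuous x]]) auto
    then show ?thesis
      using IVT'[of "\<lambda>\<mu>. l (delayed (k + N) (x \<mu>) 1)" a c b] N[of "k + N"] ab by force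
  qed
  then obtain \<mu> where \<mu>: "\<And>k. \<mu> k \<in> {a..b}" "\<And>k. l (delayed (k + N) (x (\<mu> k)) 1) = c" by metis
  obtain \<mu>0 q where q: "\<mu>0 \<in> {a..b}" "strict_mono (q :: nat \<Rightarrow> nat)" "(\<mu> \<circ> q) \<longlonglongrightarrow> \<mu>0"
    using compact_imp_seq_compact[OF compact_Icc[of a b]] \<mu>(1) by (metis seq_compact_def)
  have "(\<lambda>k. x (\<mu> (q k))) \<longlonglongrightarrow> x \<mu>0"
    using x q \<mu>(1) by (intro continuous_on_tendsto_compose[OF x, of "\<lambda>k. \<mu> (q k)"]) (auto simp: o_def)
  moreover have "filterlim (\<lambda>k. q k + N) at_top sequentially"
    using filterlim_subseq[OF q(2)] by (rule filterlim_at_top_mono) auto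
  ultimately obtain g r where g: "strict_mono (r :: nat \<Rightarrow> nat)" "ode_solution V (x \<mu>0) g"
    "\<And>t. t \<in> {0..1} \<Longrightarrow> (\<lambda>k. delayed (q (r k) + N) (x (\<mu> (q (r k)))) t) \<longlonglongrightarrow> g t"
    using delayed_limit by blast
  have "(\<lambda>k. l (delayed (q (r k) + N) (x (\<mu> (q (r k)))) 1)) \<longlonglongrightarrow> l (g 1)"
    by (intro tl g(3)) auto
  then have "l (g 1) = c" using \<mu>(2) LIMSEQ_unique[OF _ tendsto_const] by simp
  then show thesis using that q(1) g(2) by blast
qed

end

section \<open>Signed powers\<close>

lemma spow_minus [simp]: "spow p (- y) = - spow p y"
  by (simp add: spow_def)

lemma spow_zero [simp]: "spow p 0 = 0"
  by (simp add: spow_def)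

lemma spow_mult: "spow p (x * y) = spow p x * spow p y"
  by (simp add: spow_def abs_mult powr_mult sgn_mult)

lemma spow_pos: "y > 0 \<Longrightarrow> spow p y = y powr (p - 1)"
  by (simp add: spow_def)

lemma spow_exp: "spow p (exp l * s) = exp ((p - 1) * l) * spow p s"
  by (simp add: spow_mult spow_pos powr_def)

lemma spow_eq_0_iff [simp]: "spow p y = 0 \<longleftrightarrow> y = 0"
  by (auto simp: spow_def sgn_if)

lemma abs_spow: "\<bar>spow p y\<bar> = \<bar>y\<bar> powr (p - 1)"
  by (cases "y = 0") (auto simp: spow_def abs_mult)

lemma mult_spow: "y * spow p y = \<bar>y\<bar> powr p"
proof (cases "y = 0")
  case False
  then have "y * spow p y = \<bar>y\<bar> powr 1 * \<bar>y\<bar> powr (p - 1)"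
    by (simp add: spow_def mult_ac abs_sgn[symmetric])
  also have "\<dots> = \<bar>y\<bar> powr (1 + (p - 1))" by (rule powr_add[symmetric])
  finally show ?thesis by simp
qed simp

lemma spow_has_derivative:
  assumes "y \<noteq> 0"
  shows "(spow p has_real_derivative (p - 1) * \<bar>y\<bar> powr (p - 2)) (at y)"
proof (cases "y > 0")
  case True
  have "((\<lambda>y. y powr (p - 1)) has_real_derivative (p - 1) * y powr (p - 1 - 1)) (at y)"
    using True by (intro has_real_derivative_powr)
  then have "((\<lambda>y. y powr (p - 1)) has_real_derivative (p - 1) * \<bar>y\<bar> powr (p - 2)) (at y)"
    using True by (simp add: algebra_simps)
  then show ?thesis
    by (rule has_field_derivative_transform_within_open[where S="{0<..}"])
       (use True in \<open>auto simp: spow_pos\<close>)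
next
  case False
  with assms have "y < 0" by simp
  have "((\<lambda>y. - ((- y) powr (p - 1))) has_real_derivative - ((p - 1) * (- y) powr (p - 1 - 1) * (- 1))) (at y)"
    by (rule derivative_intros DERIV_chain2[of "\<lambda>y. y powr (p - 1)"] has_real_derivative_powr
        derivative_eq_intros | use \<open>y < 0\<close> in simp)+
  then have "((\<lambda>y. - ((- y) powr (p - 1))) has_real_derivative (p - 1) * \<bar>y\<bar> powr (p - 2)) (at y)"
    using \<open>y < 0\<close> by (simp add: algebra_simps)
  then show ?thesis
    by (rule has_field_derivative_transform_within_open[where S="{..<0}"])
       (use \<open>y < 0\<close> in \<open>auto simp: spow_def\<close>)
qed

lemma tendsto_spow [tendsto_intros]:
  assumes "p > 1" "(f \<longlongrightarrow> a) F"
  shows "((\<lambda>x. spow p (f x)) \<longlongrightarrow> spow p a) F"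
proof (cases "a = 0")
  case True
  have "((\<lambda>x. \<bar>f x\<bar> powr (p - 1)) \<longlongrightarrow> \<bar>a\<bar> powr (p - 1)) F"
    using assms by (intro tendsto_powr' tendsto_intros) (auto simp: eventually_mono)
  then have "((\<lambda>x. \<bar>spow p (f x)\<bar>) \<longlongrightarrow> 0) F" by (simp add: abs_spow True)
  then show ?thesis by (simp add: True tendsto_rabs_zero_iff)
next
  case False
  then show ?thesis
    using DERIV_isCont[OF spow_has_derivative] assms(2) by (metis isCont_tendsto_compose)
qed

lemma continuous_on_spow [continuous_intros]:
  "p > 1 \<Longrightarrow> continuous_on S f \<Longrightarrow> continuous_on S (\<lambda>x. spow p (f x))"
  by (auto simp: continuous_on_def intro!: tendsto_spow)

lemma abs_powr_has_derivative:
  assumes "p > 1"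
  shows "((\<lambda>y. \<bar>y\<bar> powr p) has_real_derivative p * spow p y) (at y)"
proof (cases "y = 0")
  case True
  have "((\<lambda>h. spow p h) \<longlongrightarrow> spow p 0) (at 0)"
    using assms by (intro tendsto_spow tendsto_ident_at) auto
  moreover have "\<bar>h\<bar> powr p / h = spow p h" if "h \<noteq> 0" for h
    using that mult_spow[of h p] by (simp add: field_simps)
  ultimately have "((\<lambda>h. \<bar>h\<bar> powr p / h) \<longlongrightarrow> 0) (at 0)"
    by (auto intro: Lim_transform_eventually simp: eventually_at_filter)
  then show ?thesis using True by (simp add: DERIV_def)
next
  case False
  then have "((\<lambda>y. y * spow p y) has_real_derivative
      1 * spow p y + (p - 1) * \<bar>y\<bar> powr (p - 2) * y) (at y)"
    by (intro DERIV_mult DERIV_ident spow_has_derivative)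
  moreover have "\<bar>y\<bar> powr (p - 2) * y = spow p y"
  proof -
    have "\<bar>y\<bar> powr (p - 2) * \<bar>y\<bar> powr 1 = \<bar>y\<bar> powr (p - 2 + 1)" by (rule powr_add[symmetric])
    then show ?thesis using False by (simp add: spow_def mult.assoc[symmetric] abs_mult_sgn[symmetric])
        (metis abs_mult_sgn mult.assoc)
  qed
  ultimately show ?thesis by (simp add: mult_spow algebra_simps)
qed

text \<open>The exponent \<open>p' = p/(p - 1)\<close> dual to \<open>p\<close>; \<open>spow p'\<close> is the inverse function of \<open>spow p\<close>.\<close>

definition conjugate_exponent :: "real \<Rightarrow> real" where "conjugate_exponent p = p / (p - 1)"

lemma conjugate_exponent_gt_1: "p > 1 \<Longrightarrow> conjugate_exponent p > 1"
  by (simp add: conjugate_exponent_def field_simps)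

lemma conjugate_exponent_mult: "p > 1 \<Longrightarrow> (conjugate_exponent p - 1) * (p - 1) = 1"
  by (simp add: conjugate_exponent_def field_simps)

lemma spow_conj: "p > 1 \<Longrightarrow> spow (conjugate_exponent p) (spow p y) = y"
proof -
  assume p: "p > 1"
  have "(\<bar>y\<bar> powr (p - 1)) powr (conjugate_exponent p - 1) = \<bar>y\<bar> powr ((conjugate_exponent p - 1) * (p - 1))"
    by (simp add: powr_powr mult.commute)
  then have "spow (conjugate_exponent p) (spow p y) = \<bar>y\<bar> * sgn (spow p y)"
    using conjugate_exponent_mult[OF p] by (simp add: spow_def[of "conjugate_exponent p"] abs_spow)
  moreover have "sgn (spow p y) = sgn y" by (simp add: spow_def sgn_if)
  ultimately show ?thesis by (simp add: abs_mult_sgn)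
qed

lemma spow_inject: "p > 1 \<Longrightarrow> spow p a = spow p b \<longleftrightarrow> a = b"
  using spow_conj by metis

lemma abs_spow_powr_conj: "p > 1 \<Longrightarrow> \<bar>spow p y\<bar> powr conjugate_exponent p = \<bar>y\<bar> powr p"
  by (simp add: abs_spow powr_powr conjugate_exponent_def)

section \<open>The generalized sine\<close>

locale p_trig =
  fixes p :: real
  assumes p: "p > 1"
begin

abbreviation "kern \<equiv> \<lambda>t. 1 / (1 - t powr p) powr (1 / p)"
abbreviation "\<pi> \<equiv> pi_p p"
abbreviation "S \<equiv> S_p p"
abbreviation "arcS \<equiv> arcS_p p"
abbreviation "arcS_inv \<equiv> the_inv_into {0..1} arcS"

lemma powr_p_less_1: "0 \<le> t \<Longrightarrow> t < 1 \<Longrightarrow> t powr p < 1"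
  using p powr_less_mono2[of p t 1] by simp

lemma kern_continuous: "continuous_on {0..<1} kern"
proof -
  have "(1 - t powr p) powr (1 / p) \<noteq> 0" if "t \<in> {0..<1}" for t
    using powr_p_less_1[of t] that by simp
  moreover have "continuous_on {0..<1} (\<lambda>t. (1 - t powr p) powr (1 / p))"
  proof (rule continuous_on_powr')
    show "continuous_on {0..<1} (\<lambda>t. 1 - t powr p)"
      using p by (intro continuous_on_diff continuous_on_const continuous_on_powr' continuous_on_id) auto
    show "\<forall>t\<in>{0..<1}. 0 \<le> 1 - t powr p \<and> (1 - t powr p = 0 \<longrightarrow> 0 < 1 / p)"
      using powr_p_less_1 by force
  qed (rule continuous_on_const)
  ultimately show ?thesis by (intro continuous_on_divide continuous_on_const) auto
qed

text \<open>Since \<open>t\<^sup>p \<le> t\<close> on \<open>[0,1]\<close>, the kernel is dominated by \<open>(1 - t)\<^sup>-\<^sup>1\<^sup>/\<^sup>p\<close>, whose exponent is above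
\<open>-1\<close>.\<close>

lemma kern_integrable: "kern integrable_on {0..1}"
proof -
  define e where "e = 1 - 1 / p"
  have e: "e > 0" using p by (simp add: e_def)
  have "((\<lambda>t. (1 - t) powr (- (1 / p))) has_integral (- ((1 - 1) powr e / e)) - (- ((1 - 0) powr e / e))) {0..1::real}"
  proof (rule fundamental_theorem_of_calculus_interior)
    show "continuous_on {0..1} (\<lambda>t. - ((1 - t) powr e / e))"
      using e by (intro continuous_intros continuous_on_powr') auto
    fix t :: real assume t: "t \<in> {0<..<1}"
    have "((\<lambda>t. - ((1 - t) powr e / e)) has_real_derivative (1 - t) powr (- (1 / p))) (at t)"
    proof -
      have "((\<lambda>t. 1 - t) has_real_derivative -1) (at t)" by (auto intro!: derivative_eq_intros)
      then have "((\<lambda>t. (1 - t) powr e) has_real_derivative e * (1 - t) powr (e - of_nat 1) * -1) (at t)"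
        by (rule DERIV_fun_powr) (use t in simp)
      then have "((\<lambda>t. - ((1 - t) powr e / e)) has_real_derivative - (e * (1 - t) powr (e - of_nat 1) * -1 / e)) (at t)"
        by (intro DERIV_minus DERIV_cdivide)
      moreover have "- (e * (1 - t) powr (e - of_nat 1) * -1 / e) = (1 - t) powr (- (1 / p))"
        using e by simp (simp add: e_def)
      ultimately show ?thesis by (simp only:)
    qed
    then show "((\<lambda>t. - ((1 - t) powr e / e)) has_vector_derivative (1 - t) powr (- (1 / p))) (at t)"
      by (simp add: has_real_derivative_iff_has_vector_derivative)
  qed simp
  then have dom: "(\<lambda>t. (1 - t) powr (- (1 / p))) integrable_on {0<..<1::real}"
    using has_integral_integrable integrable_on_Icc_iff_Ioo by blast
  have "kern integrable_on {0<..<1}"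
  proof (rule measurable_bounded_by_integrable_imp_integrable[OF _ dom])
    show "kern \<in> borel_measurable (lebesgue_on {0<..<1})"
      by (rule continuous_imp_measurable_on_sets_lebesgue[OF continuous_on_subset[OF kern_continuous]]) auto
    fix t :: real assume t: "t \<in> {0<..<1}"
    have "t powr p \<le> t powr 1" using t p by (intro powr_mono') auto
    then have "(1 - t) powr (1 / p) \<le> (1 - t powr p) powr (1 / p)"
      using t p by (intro powr_mono2) auto
    then have "kern t \<le> 1 / (1 - t) powr (1 / p)"
      using t powr_p_less_1[of t] by (intro divide_left_mono mult_pos_pos) auto
    then show "norm (kern t) \<le> (1 - t) powr (- (1 / p))" by (simp add: powr_minus_divide)
  qed auto
  then show ?thesis by (simp add: integrable_on_Icc_iff_Ioo)
qed

lemma arcS_continuous: "continuous_on {0..1} arcS"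
  unfolding arcS_p_def using indefinite_integral_continuous_1[OF kern_integrable] .

lemma arcS_0: "arcS 0 = 0"
  by (simp add: arcS_p_def)

lemma arcS_deriv: "0 < w \<Longrightarrow> w < 1 \<Longrightarrow> (arcS has_real_derivative kern w) (at w)"
proof -
  assume w: "0 < w" "w < 1"
  define b where "b = (w + 1) / 2"
  have b: "w < b" "b < 1" using w by (auto simp: b_def)
  have "((\<lambda>x. integral {0..x} kern) has_real_derivative kern w) (at w within {0..b})"
    by (rule integral_has_real_derivative) (use w b in \<open>auto intro: continuous_on_subset[OF kern_continuous]\<close>)
  then show ?thesis using w b by (simp add: arcS_p_def[abs_def] at_within_Icc_at)
qed

lemma kern_pos: "0 < w \<Longrightarrow> w < 1 \<Longrightarrow> kern w > 0"
  using powr_p_less_1[of w] p by simp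

lemma arcS_less: "0 \<le> u \<Longrightarrow> u < v \<Longrightarrow> v \<le> 1 \<Longrightarrow> arcS u < arcS v"
proof -
  assume uv: "0 \<le> u" "u < v" "v \<le> 1"
  show ?thesis
  proof (rule DERIV_pos_imp_increasing_open[OF \<open>u < v\<close>])
    fix w assume "u < w" "w < v"
    then have "0 < w" "w < 1" using uv by auto
    then show "\<exists>y. DERIV arcS w :> y \<and> y > 0" using arcS_deriv kern_pos by blast
  next
    show "continuous_on {u..v} arcS"
      using uv by (intro continuous_on_subset[OF arcS_continuous]) auto
  qed
qed

lemma arcS_inj: "inj_on arcS {0..1}"
  by (rule linorder_inj_onI) (auto dest: arcS_less)

lemma pi_p_eq: "\<pi> = 2 * arcS 1"
  unfolding pi_p_def arcS_p_def
  by (subst integral_mult_right[symmetric]) simp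

lemma pi_pos: "\<pi> > 0"
  using arcS_less[of 0 1] by (simp add: pi_p_eq arcS_0)

lemma arcS_image: "arcS ` {0..1} = {0..\<pi> / 2}"
proof -
  have "arcS ` {0..1} \<subseteq> {0..\<pi> / 2}"
  proof
    fix y assume "y \<in> arcS ` {0..1}"
    then obtain w where "w \<in> {0..1}" "y = arcS w" by blast
    then show "y \<in> {0..\<pi> / 2}"
      using arcS_less[of 0 w] arcS_less[of w 1] by (cases "w = 0"; cases "w = 1") (auto simp: pi_p_eq arcS_0)
  qed
  moreover have "y \<in> arcS ` {0..1}" if "y \<in> {0..\<pi> / 2}" for y
    using IVT'[of arcS 0 y 1] that arcS_continuous by (force simp: pi_p_eq arcS_0)
  ultimately show ?thesis by blast
qed

lemma arcS_inv_in: "x \<in> {0..\<pi> / 2} \<Longrightarrow> arcS_inv x \<in> {0..1}"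
  using the_inv_into_into[OF arcS_inj, of x "{0..1}"] arcS_image by auto

lemma arcS_arcS_inv: "x \<in> {0..\<pi> / 2} \<Longrightarrow> arcS (arcS_inv x) = x"
  using f_the_inv_into_f[OF arcS_inj, of x] arcS_image by auto

lemma arcS_inv_arcS: "w \<in> {0..1} \<Longrightarrow> arcS_inv (arcS w) = w"
  using the_inv_into_f_f[OF arcS_inj] by auto

lemma arcS_inv_0: "arcS_inv 0 = 0"
  using arcS_inv_arcS[of 0] by (simp add: arcS_0)

lemma arcS_inv_half: "arcS_inv (\<pi> / 2) = 1"
  using arcS_inv_arcS[of 1] by (simp add: pi_p_eq)

lemma arcS_inv_continuous: "continuous_on {0..\<pi> / 2} arcS_inv"
  using continuous_on_inv[OF arcS_continuous] arcS_inv_arcS arcS_image by auto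

lemma arcS_inv_strict: "0 < x \<Longrightarrow> x < \<pi> / 2 \<Longrightarrow> 0 < arcS_inv x \<and> arcS_inv x < 1"
  using arcS_inv_in[of x] arcS_arcS_inv[of x] arcS_0 pi_p_eq by (cases "arcS_inv x = 0"; cases "arcS_inv x = 1") auto

lemma arcS_inv_deriv:
  assumes "0 < x" "x < \<pi> / 2"
  shows "(arcS_inv has_real_derivative (1 - arcS_inv x powr p) powr (1 / p)) (at x)"
proof -
  have "(arcS_inv has_real_derivative inverse (kern (arcS_inv x))) (at x)"
  proof (rule DERIV_inverse_function[where f=arcS and a=0 and b="\<pi> / 2"])
    show "(arcS has_real_derivative kern (arcS_inv x)) (at (arcS_inv x))"
      using arcS_inv_strict[OF assms] by (intro arcS_deriv) auto
    show "kern (arcS_inv x) \<noteq> 0" using kern_pos arcS_inv_strict[OF assms] by (metis less_irrefl)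
    show "isCont arcS_inv x"
      using continuous_on_interior[OF arcS_inv_continuous] assms by simp
  qed (use assms arcS_arcS_inv in auto)
  then show ?thesis by simp
qed

lemma half_0: "S_p_half p 0 = 0" and half_pi: "S_p_half p \<pi> = 0"
  using pi_pos by (auto simp: S_p_half_def arcS_inv_0)

lemma S_base: "0 \<le> x \<Longrightarrow> x \<le> \<pi> \<Longrightarrow> S x = S_p_half p x"
proof -
  assume x: "0 \<le> x" "x \<le> \<pi>"
  then have "\<lfloor>x / (2 * \<pi>)\<rfloor> = 0" using pi_pos by (intro floor_unique) auto
  then show ?thesis using x by (simp add: S_p_def)
qed

lemma S_periodic_int: "S (x + 2 * \<pi> * of_int k) = S x"
proof -
  have "(x + 2 * \<pi> * of_int k) / (2 * \<pi>) = x / (2 * \<pi>) + of_int k"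
    using pi_pos by (simp add: field_simps)
  then show ?thesis by (simp add: S_p_def algebra_simps)
qed

lemma S_antiperiodic: "S (x + \<pi>) = - S x"
proof -
  have main: "S (r + \<pi>) = - S r" if r: "0 \<le> r" "r < 2 * \<pi>" for r
  proof (cases "r < \<pi>")
    case True
    have "\<lfloor>(r + \<pi>) / (2 * \<pi>)\<rfloor> = 0" using pi_pos r True by (intro floor_unique) auto
    then have "S (r + \<pi>) = - S_p_half p r"
      using r True half_0 half_pi by (cases "r = 0") (auto simp: S_p_def)
    then show ?thesis using r True by (simp add: S_base)
  next
    case False
    have "S (r + \<pi>) = S (r - \<pi>)" using S_periodic_int[of "r - \<pi>" 1] by (simp add: algebra_simps)
    also have "\<dots> = S_p_half p (r - \<pi>)" using False r by (intro S_base) auto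
    moreover have "S r = - S_p_half p (r - \<pi>)"
    proof -
      have "\<lfloor>r / (2 * \<pi>)\<rfloor> = 0" using pi_pos r by (intro floor_unique) auto
      then show ?thesis
        using r False half_0 half_pi by (cases "r = \<pi>") (auto simp: S_p_def)
    qed
    ultimately show ?thesis by simp
  qed
  define k where "k = \<lfloor>x / (2 * \<pi>)\<rfloor>"
  define r where "r = x - 2 * \<pi> * of_int k"
  have "of_int k \<le> x / (2 * \<pi>)" "x / (2 * \<pi>) < of_int k + 1" by (auto simp: k_def)
  then have "0 \<le> r" "r < 2 * \<pi>" using pi_pos by (auto simp: r_def field_simps)
  from main[OF this] have "S (r + \<pi>) = - S r" .
  moreover have "S x = S r" "S (x + \<pi>) = S (r + \<pi>)"
    using S_periodic_int[of r k] S_periodic_int[of "r + \<pi>" k] by (auto simp: r_def algebra_simps)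
  ultimately show ?thesis by simp
qed

lemma reduce_angle: obtains k :: int and r where "x = r + of_int k * \<pi>" "0 \<le> r" "r < \<pi>"
proof -
  define k where "k = \<lfloor>x / \<pi>\<rfloor>"
  define r where "r = x - of_int k * \<pi>"
  have "of_int k \<le> x / \<pi>" "x / \<pi> < of_int k + 1" by (auto simp: k_def)
  then have "0 \<le> r" "r < \<pi>" using pi_pos by (auto simp: r_def field_simps)
  then show thesis using that[of r k] by (simp add: r_def)
qed

text \<open>Reduces statements about the whole line to the half period \<open>[0, \<pi>\<^sub>p)\<close> when they are invariant
under the shift by \<open>\<pi>\<^sub>p\<close>, which acts on \<open>S\<close> and \<open>C\<close> by a change of sign.\<close>

lemma antiperiod_induct [case_names base shift]:
  assumes base: "\<And>x. 0 \<le> x \<Longrightarrow> x < \<pi> \<Longrightarrow> Q x" and shift: "\<And>x. Q (x + \<pi>) \<longleftrightarrow> Q x"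
  shows "Q x"
proof -
  have int: "Q (r + of_int k * \<pi>) \<longleftrightarrow> Q r" for r and k :: int
  proof (induction k rule: int_induct[where k=0])
    case (step1 i)
    then show ?case using shift[of "r + of_int i * \<pi>"] by (simp add: algebra_simps)
  next
    case (step2 i)
    then show ?case using shift[of "r + of_int (i - 1) * \<pi>"] by (simp add: algebra_simps)
  qed simp
  obtain k :: int and r where kr: "x = r + of_int k * \<pi>" "0 \<le> r" "r < \<pi>" by (rule reduce_angle)
  then show ?thesis using base[of r] int[of r k] by simp
qed

lemma S_first: "0 \<le> x \<Longrightarrow> x \<le> \<pi> / 2 \<Longrightarrow> S x = arcS_inv x"
  using pi_pos by (simp add: S_base S_p_half_def)

lemma S_second: "\<pi> / 2 \<le> x \<Longrightarrow> x \<le> \<pi> \<Longrightarrow> S x = arcS_inv (\<pi> - x)"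
proof -
  assume x: "\<pi> / 2 \<le> x" "x \<le> \<pi>"
  show ?thesis
  proof (cases "x = \<pi> / 2")
    case True
    then have "\<pi> - x = x" by simp
    moreover have "S x = arcS_inv x" by (rule S_first) (use x True pi_pos in auto)
    ultimately show ?thesis by (simp only:)
  next
    case False
    then show ?thesis using x pi_pos by (simp add: S_base S_p_half_def)
  qed
qed

lemma S_reflect: "S (\<pi> - x) = S x"
proof -
  have base: "S (\<pi> - x) = S x" if "0 \<le> x" "x \<le> \<pi>" for x
    using that pi_pos S_first[of x] S_second[of "\<pi> - x"] S_second[of x] S_first[of "\<pi> - x"]
    by (cases "x \<le> \<pi> / 2") auto
  show ?thesis
  proof (induction x rule: antiperiod_induct)
    case (base x)
    then show ?case using \<open>\<And>x. 0 \<le> x \<Longrightarrow> x \<le> \<pi> \<Longrightarrow> S (\<pi> - x) = S x\<close> by simp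
  next
    case (shift x)
    show ?case using S_antiperiodic[of x] S_antiperiodic[of "- x"] S_antiperiodic[of "\<pi> - x - \<pi>"] by auto
  qed
qed

lemma S_0: "S 0 = 0"
  using pi_pos by (simp add: S_first arcS_inv_0)

lemma S_pos: "0 < x \<Longrightarrow> x < \<pi> \<Longrightarrow> S x > 0"
proof -
  assume x: "0 < x" "x < \<pi>"
  consider "x < \<pi> / 2" | "x = \<pi> / 2" | "x > \<pi> / 2" by linarith
  then show ?thesis
  proof cases
    case 1
    then show ?thesis using arcS_inv_strict[of x] S_first[of x] x by simp
  next
    case 2
    have "S x = arcS_inv x" by (rule S_first) (use x 2 in auto)
    then show ?thesis unfolding 2 arcS_inv_half by simp
  next
    case 3
    then show ?thesis using arcS_inv_strict[of "\<pi> - x"] S_second[of x] x by simp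
  qed
qed

lemma S_abs_le_1: "\<bar>S x\<bar> \<le> 1"
proof (induction x rule: antiperiod_induct)
  case (base x)
  then have "S x \<in> {0..1}"
  proof (cases "x \<le> \<pi> / 2")
    case True
    with base show ?thesis using arcS_inv_in[of x] by (simp add: S_first)
  next
    case False
    with base show ?thesis using arcS_inv_in[of "\<pi> - x"] by (simp add: S_second)
  qed
  then show ?case by simp
qed (simp add: S_antiperiodic)

lemma S_continuous_base: "continuous_on {-\<pi>..\<pi>} S"
proof -
  have "continuous_on {0..\<pi> / 2} S"
    using arcS_inv_continuous by (rule continuous_on_eq) (simp add: S_first)
  moreover have "continuous_on {\<pi> / 2..\<pi>} S"
  proof (rule continuous_on_eq)
    show "continuous_on {\<pi> / 2..\<pi>} (\<lambda>x. arcS_inv (\<pi> - x))"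
      by (rule continuous_on_compose2[OF arcS_inv_continuous]) (auto intro!: continuous_intros)
  qed (simp add: S_second)
  ultimately have "continuous_on ({0..\<pi> / 2} \<union> {\<pi> / 2..\<pi>}) S"
    by (intro continuous_on_closed_Un) auto
  moreover have "{0..\<pi> / 2} \<union> {\<pi> / 2..\<pi>} = {0..\<pi>}" using pi_pos by auto
  ultimately have right: "continuous_on {0..\<pi>} S" by simp
  have "continuous_on {-\<pi>..0} (\<lambda>x. - S (x + \<pi>))"
    by (intro continuous_on_minus continuous_on_compose2[OF right] continuous_intros) auto
  then have "continuous_on {-\<pi>..0} S" by (simp add: S_antiperiodic)
  with right have "continuous_on ({-\<pi>..0} \<union> {0..\<pi>}) S"
    by (intro continuous_on_closed_Un) auto
  moreover have "{-\<pi>..0} \<union> {0..\<pi>} = {-\<pi>..\<pi>}" using pi_pos by auto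
  ultimately show ?thesis by simp
qed

lemma S_isCont: "isCont S x"
proof (induction x rule: antiperiod_induct)
  case (base x)
  then show ?case using continuous_on_interior[OF S_continuous_base] pi_pos by simp
next
  case (shift x)
  have "isCont (\<lambda>x. - S x) x \<longleftrightarrow> isCont S x"
    using continuous_minus[of "at x" S] continuous_minus[of "at x" "\<lambda>x. - S x"] by auto
  then show ?case by (simp add: isCont_shift_iff S_antiperiodic)
qed

lemma S_continuous: "continuous_on A S"
  using S_isCont by (simp add: continuous_at_imp_continuous_on)

lemma S_zero_shift: "S (x + \<pi> / 2) = 0 \<Longrightarrow> \<bar>S x\<bar> = 1"
proof (induction x rule: antiperiod_induct)
  case (base x)
  consider "x < \<pi> / 2" | "x = \<pi> / 2" | "x > \<pi> / 2" by linarith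
  then show ?case
  proof cases
    case 1
    then show ?thesis using S_pos[of "x + \<pi> / 2"] base pi_pos by simp
  next
    case 2
    have "S x = arcS_inv x" by (rule S_first) (use 2 pi_pos in auto)
    then show ?thesis unfolding 2 arcS_inv_half by simp
  next
    case 3
    have "x + \<pi> / 2 = x - \<pi> / 2 + \<pi>" by simp
    then have "S (x + \<pi> / 2) = - S (x - \<pi> / 2)" by (simp only: S_antiperiodic)
    then show ?thesis using S_pos[of "x - \<pi> / 2"] base 3 by simp
  qed
next
  case (shift x)
  have "x + \<pi> + \<pi> / 2 = x + \<pi> / 2 + \<pi>" by simp
  then show ?case by (simp only: S_antiperiodic) simp
qed

text \<open>The derivative of \<open>S\<close>, given in closed form: \<open>|S'|\<close> is determined by \<open>|S|\<^sup>p + |S'|\<^sup>p = 1\<close>, and \<open>S'\<close> has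
the sign of \<open>S\<close> shifted by a quarter period. The closed form makes continuity accessible before
differentiability at the turning points is known.\<close>

definition C :: "real \<Rightarrow> real" where
  "C x = sgn (S (x + \<pi> / 2)) * (1 - \<bar>S x\<bar> powr p) powr (1 / p)"

lemma C_antiperiodic: "C (x + \<pi>) = - C x"
proof -
  have "x + \<pi> + \<pi> / 2 = x + \<pi> / 2 + \<pi>" by simp
  then show ?thesis unfolding C_def by (simp only: S_antiperiodic sgn_minus abs_minus_cancel mult_minus_left)
qed

lemma C_reflect: "C (\<pi> - x) = - C x"
proof -
  have "S (\<pi> - x + \<pi> / 2) = S (x - \<pi> / 2)"
    using S_reflect[of "x - \<pi> / 2"] by (simp add: algebra_simps)
  also have "\<dots> = - S (x - \<pi> / 2 + \<pi>)" unfolding S_antiperiodic by simp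
  also have "x - \<pi> / 2 + \<pi> = x + \<pi> / 2" by simp
  finally show ?thesis by (simp add: C_def S_reflect sgn_minus)
qed

lemma S_powr_le_1: "\<bar>S x\<bar> powr p \<le> 1"
  using powr_mono2[of p "\<bar>S x\<bar>" 1] S_abs_le_1 p by simp

lemma pythagoras: "\<bar>S x\<bar> powr p + \<bar>C x\<bar> powr p = 1"
proof (cases "S (x + \<pi> / 2) = 0")
  case True
  then show ?thesis using S_zero_shift by (simp add: C_def)
next
  case False
  have "\<bar>C x\<bar> powr p = 1 - \<bar>S x\<bar> powr p"
    using False p S_powr_le_1[of x] by (simp add: C_def abs_mult abs_sgn_eq powr_powr)
  then show ?thesis by simp
qed

lemma C_abs_le_1: "\<bar>C x\<bar> \<le> 1"
proof (rule ccontr)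
  assume "\<not> ?thesis"
  then have "\<bar>C x\<bar> powr p > 1" using p by (intro gr_one_powr) auto
  moreover have "\<bar>S x\<bar> powr p \<ge> 0" by simp
  ultimately show False using pythagoras[of x] by linarith
qed

lemma C_isCont: "isCont C x"
proof -
  have root: "((\<lambda>y. (1 - \<bar>S y\<bar> powr p) powr (1 / p)) \<longlongrightarrow> (1 - \<bar>S x\<bar> powr p) powr (1 / p)) (at x)"
  proof (rule tendsto_powr')
    have "((\<lambda>y. \<bar>S y\<bar> powr p) \<longlongrightarrow> \<bar>S x\<bar> powr p) (at x)"
      using S_isCont[of x] p by (intro tendsto_powr' tendsto_rabs tendsto_const) (auto simp: isCont_def)
    then show "((\<lambda>y. 1 - \<bar>S y\<bar> powr p) \<longlongrightarrow> 1 - \<bar>S x\<bar> powr p) (at x)"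
      by (intro tendsto_diff tendsto_const)
  qed (use p S_powr_le_1 in auto)
  show ?thesis
  proof (cases "S (x + \<pi> / 2) = 0")
    case True
    then have "C x = 0" "(1 - \<bar>S x\<bar> powr p) powr (1 / p) = 0" using S_zero_shift[of x] by (auto simp: C_def)
    moreover have "(C \<longlongrightarrow> 0) (at x)"
    proof (rule Lim_null_comparison[OF _ root[unfolded calculation]])
      show "\<forall>\<^sub>F y in at x. norm (C y) \<le> (1 - \<bar>S y\<bar> powr p) powr (1 / p)"
        by (rule always_eventually) (auto simp: C_def abs_mult abs_sgn_eq)
    qed
    ultimately show ?thesis by (simp add: isCont_def)
  next
    case False
    have "isCont (\<lambda>y. S (y + \<pi> / 2)) x" using S_isCont isCont_shift_iff by blast
    then have "((\<lambda>y. sgn (S (y + \<pi> / 2))) \<longlongrightarrow> sgn (S (x + \<pi> / 2))) (at x)"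
      using False by (intro tendsto_sgn) (auto simp: isCont_def)
    from tendsto_mult[OF this root] show ?thesis by (simp add: isCont_def C_def[abs_def])
  qed
qed

lemma C_continuous: "continuous_on A C"
  using C_isCont by (simp add: continuous_at_imp_continuous_on)

lemma C_first: "0 < x \<Longrightarrow> x < \<pi> / 2 \<Longrightarrow> C x = (1 - arcS_inv x powr p) powr (1 / p)"
  using S_pos[of "x + \<pi> / 2"] pi_pos arcS_inv_strict[of x] by (simp add: C_def S_first)

text \<open>On the first quarter period the inverse function theorem applies. The second equation is the
\<open>p\<close>-Laplace equation of the generalized sine, from \<open>\<phi>(C) = (1 - S\<^sup>p)\<^sup>(\<^sup>p\<^sup>-\<^sup>1\<^sup>)\<^sup>/\<^sup>p\<close>.\<close>

lemma derivs_first: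
  assumes "0 < x" "x < \<pi> / 2"
  shows "(S has_real_derivative C x) (at x)"
    and "((\<lambda>x. spow p (C x)) has_real_derivative (1 - p) * spow p (S x)) (at x)"
proof -
  have mem: "x \<in> {0<..<\<pi> / 2}" using assms by simp
  note inv = arcS_inv_deriv[OF assms]
  have "(S has_real_derivative (1 - arcS_inv x powr p) powr (1 / p)) (at x)"
    by (rule has_field_derivative_transform_within_open[OF inv _ mem]) (auto simp: S_first)
  then show "(S has_real_derivative C x) (at x)" using assms by (simp add: C_first)
  have s: "0 < arcS_inv x" "arcS_inv x < 1" using arcS_inv_strict[OF assms] by auto
  define b where "b = 1 - arcS_inv x powr p"
  have b: "b > 0" using s powr_p_less_1[of "arcS_inv x"] by (simp add: b_def)
  have "((\<lambda>x. arcS_inv x powr p) has_real_derivative p * arcS_inv x powr (p - of_nat 1) * b powr (1 / p)) (at x)"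
    unfolding b_def by (rule DERIV_fun_powr[OF inv s(1)])
  then have "((\<lambda>x. 1 - arcS_inv x powr p) has_real_derivative
      0 - p * arcS_inv x powr (p - of_nat 1) * b powr (1 / p)) (at x)"
    by (intro DERIV_diff DERIV_const)
  then have "((\<lambda>x. (1 - arcS_inv x powr p) powr ((p - 1) / p)) has_real_derivative
      (p - 1) / p * (1 - arcS_inv x powr p) powr ((p - 1) / p - of_nat 1) *
      (0 - p * arcS_inv x powr (p - of_nat 1) * b powr (1 / p))) (at x)"
    by (rule DERIV_fun_powr) (use b in \<open>simp add: b_def\<close>)
  also have "(p - 1) / p * (1 - arcS_inv x powr p) powr ((p - 1) / p - of_nat 1) *
      (0 - p * arcS_inv x powr (p - of_nat 1) * b powr (1 / p)) =
      (1 - p) * arcS_inv x powr (p - 1) * (b powr ((p - 1) / p - 1) * b powr (1 / p))"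
    using p by (simp add: b_def[symmetric]) (simp add: algebra_simps)
  also have "b powr ((p - 1) / p - 1) * b powr (1 / p) = b powr ((p - 1) / p - 1 + 1 / p)"
    by (rule powr_add[symmetric])
  also have "(p - 1) / p - 1 + 1 / p = 0" using p by (simp add: field_simps)
  finally have "((\<lambda>x. (1 - arcS_inv x powr p) powr ((p - 1) / p)) has_real_derivative
      (1 - p) * spow p (S x)) (at x)"
    using b s assms by (simp add: S_first spow_pos)
  then show "((\<lambda>x. spow p (C x)) has_real_derivative (1 - p) * spow p (S x)) (at x)"
  proof (rule has_field_derivative_transform_within_open[OF _ _ mem])
    fix u assume u: "u \<in> {0<..<\<pi> / 2}"
    then have "1 - arcS_inv u powr p > 0"
      using arcS_inv_strict[of u] powr_p_less_1[of "arcS_inv u"] by simp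
    then show "(1 - arcS_inv u powr p) powr ((p - 1) / p) = spow p (C u)"
      using u by (simp add: C_first spow_pos powr_powr)
  qed simp
qed

lemma derivs_generic:
  assumes "-\<pi> < x" "x < \<pi>" "x \<notin> {- \<pi> / 2, 0, \<pi> / 2}"
  shows "(S has_real_derivative C x) (at x)"
    and "((\<lambda>x. spow p (C x)) has_real_derivative (1 - p) * spow p (S x)) (at x)"
proof -
  have right: "(S has_real_derivative C x) (at x) \<and>
      ((\<lambda>x. spow p (C x)) has_real_derivative (1 - p) * spow p (S x)) (at x)"
    if "0 < x" "x < \<pi>" "x \<noteq> \<pi> / 2" for x
  proof (cases "x < \<pi> / 2")
    case True
    then show ?thesis using derivs_first that by blast
  next
    case False
    then have y: "0 < \<pi> - x" "\<pi> - x < \<pi> / 2" using that by auto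
    from DERIV_reflect[OF derivs_first(1)[OF y]] DERIV_reflect[OF derivs_first(2)[OF y]]
    show ?thesis by (auto simp: S_reflect C_reflect DERIV_minus_iff)
  qed
  have "(S has_real_derivative C x) (at x) \<and>
      ((\<lambda>x. spow p (C x)) has_real_derivative (1 - p) * spow p (S x)) (at x)"
  proof (cases "x > 0")
    case True
    then show ?thesis using right assms by auto
  next
    case False
    have y: "0 < x + \<pi>" "x + \<pi> < \<pi>" "x + \<pi> \<noteq> \<pi> / 2" using assms False by auto
    have "((\<lambda>x. S (x + \<pi>)) has_real_derivative C (x + \<pi>)) (at x)"
      "((\<lambda>x. spow p (C (x + \<pi>))) has_real_derivative (1 - p) * spow p (S (x + \<pi>))) (at x)"
      using right[OF y] DERIV_shift[of S] DERIV_shift[of "\<lambda>x. spow p (C x)"] by (simp_all add: add.commute)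
    then show ?thesis by (simp add: S_antiperiodic C_antiperiodic DERIV_minus_iff)
  qed
  then show "(S has_real_derivative C x) (at x)"
    "((\<lambda>x. spow p (C x)) has_real_derivative (1 - p) * spow p (S x)) (at x)" by auto
qed

lemma S_deriv: "(S has_real_derivative C x) (at x)"
proof (induction x rule: antiperiod_induct)
  case (base x)
  show ?case
    by (rule has_derivative_remove_exceptions[where E="{- \<pi> / 2, 0, \<pi> / 2}" and a="-\<pi>" and b="\<pi>"])
       (use base pi_pos derivs_generic(1) S_continuous C_continuous in auto)
next
  case (shift x)
  show ?case
    by (simp add: DERIV_shift_iff S_antiperiodic C_antiperiodic DERIV_minus_iff)
qed

lemma spow_C_deriv: "((\<lambda>x. spow p (C x)) has_real_derivative (1 - p) * spow p (S x)) (at x)"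
proof (induction x rule: antiperiod_induct)
  case (base x)
  show ?case
    by (rule has_derivative_remove_exceptions[where E="{- \<pi> / 2, 0, \<pi> / 2}" and a="-\<pi>" and b="\<pi>"])
       (use base pi_pos derivs_generic(2) p in \<open>auto intro!: continuous_intros S_continuous C_continuous\<close>)
next
  case (shift x)
  show ?case
    by (simp add: DERIV_shift_iff S_antiperiodic C_antiperiodic DERIV_minus_iff)
qed

lemma deriv_S: "deriv S x = C x"
  using S_deriv by (rule DERIV_imp_deriv)

lemma S_shift_int: "S (x + of_int k * \<pi>) = (if even k then S x else - S x)"
  and C_shift_int: "C (x + of_int k * \<pi>) = (if even k then C x else - C x)"
proof -
  have "S (x + of_int k * \<pi>) = (if even k then S x else - S x) \<and>
    C (x + of_int k * \<pi>) = (if even k then C x else - C x)"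
  proof (induction k rule: int_induct[where k=0])
    case (step1 i)
    then show ?case
      using S_antiperiodic[of "x + of_int i * \<pi>"] C_antiperiodic[of "x + of_int i * \<pi>"]
      by (auto simp: algebra_simps)
  next
    case (step2 i)
    then show ?case
      using S_antiperiodic[of "x + of_int (i - 1) * \<pi>"] C_antiperiodic[of "x + of_int (i - 1) * \<pi>"]
      by (auto simp: algebra_simps)
  qed simp
  then show "S (x + of_int k * \<pi>) = (if even k then S x else - S x)"
    "C (x + of_int k * \<pi>) = (if even k then C x else - C x)" by auto
qed

lemma S_eq_0_iff: "S x = 0 \<longleftrightarrow> (\<exists>k::int. x = of_int k * \<pi>)"
proof -
  obtain k :: int and r where kr: "x = r + of_int k * \<pi>" "0 \<le> r" "r < \<pi>" by (rule reduce_angle)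
  have "S x = 0 \<longleftrightarrow> S r = 0" by (simp add: kr(1) S_shift_int)
  also have "\<dots> \<longleftrightarrow> r = 0" using S_pos[of r] S_0 kr by force
  also have "\<dots> \<longleftrightarrow> (\<exists>j::int. x = of_int j * \<pi>)"
  proof
    assume "\<exists>j::int. x = of_int j * \<pi>"
    then obtain j :: int where "x = of_int j * \<pi>" by blast
    with kr have r: "r = of_int (j - k) * \<pi>" by (simp add: algebra_simps)
    with kr pi_pos have "of_int (j - k) * \<pi> < 1 * \<pi>" "0 * \<pi> \<le> of_int (j - k) * \<pi>" by auto
    then have "of_int (j - k) < (1::real)" "(0::real) \<le> of_int (j - k)"
      using pi_pos mult_less_cancel_right_pos[of \<pi>] mult_le_cancel_right_pos[of \<pi>] by blast+
    then show "r = 0" using r by simp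
  qed (use kr in auto)
  finally show ?thesis .
qed

text \<open>The signed power \<open>\<phi>(C)\<close> has derivative \<open>-(p - 1) \<phi>(S) < 0\<close> between \<open>0\<close> and \<open>\<pi>\<^sub>p\<close>.\<close>

lemma C_inj: "0 \<le> a \<Longrightarrow> a < b \<Longrightarrow> b \<le> \<pi> \<Longrightarrow> C a \<noteq> C b"
proof -
  assume ab: "0 \<le> a" "a < b" "b \<le> \<pi>"
  have "spow p (C a) > spow p (C b)"
  proof (rule DERIV_neg_imp_decreasing_open[OF ab(2)])
    fix x assume "a < x" "x < b"
    then have "spow p (S x) > 0" using S_pos[of x] ab by (simp add: spow_pos)
    then have "(1 - p) * spow p (S x) < 0" using p by (intro mult_neg_pos) auto
    then show "\<exists>y. DERIV (\<lambda>x. spow p (C x)) x :> y \<and> y < 0" using spow_C_deriv by blast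
  qed (use p in \<open>intro continuous_intros C_continuous\<close>)
  then show ?thesis by auto
qed

text \<open>After reduction to \<open>[0, \<pi>\<^sub>p)\<close> both points lie on the half of the curve \<open>|u|\<^sup>p + |v|\<^sup>p = 1\<close> with
\<open>u > 0\<close> or at \<open>(0, 1)\<close>. A ray meets the curve once, and \<open>C\<close> is injective there.\<close>

lemma parallel_imp_congruent:
  assumes "S a * C b = C a * S b"
  obtains k :: int where "a = b + of_int k * \<pi>"
proof -
  obtain i :: int and r where i: "a = r + of_int i * \<pi>" "0 \<le> r" "r < \<pi>" by (rule reduce_angle)
  obtain j :: int and s where j: "b = s + of_int j * \<pi>" "0 \<le> s" "s < \<pi>" by (rule reduce_angle)
  have eq: "S r * C s = C r * S s"
    using assms unfolding i(1) j(1) S_shift_int C_shift_int by (auto split: if_splits)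
  have nz: "S x \<noteq> 0 \<or> C x \<noteq> 0" for x using pythagoras[of x] by auto
  have "r = s"
  proof (cases "r = 0 \<or> s = 0")
    case True
    then have "S r = 0 \<and> S s = 0" using eq nz[of r] nz[of s] S_0 by auto
    then show ?thesis using S_pos[of r] S_pos[of s] i j by force
  next
    case False
    then have pos: "S r > 0" "S s > 0" using S_pos i j by auto
    \<comment> \<open>parallel vectors on the unit curve with positive first components agree\<close>
    define c where "c = S s / S r"
    have c: "S s = c * S r" "C s = c * C r" "c > 0" using pos eq by (auto simp: c_def field_simps)
    have "1 = c powr p * (\<bar>S r\<bar> powr p + \<bar>C r\<bar> powr p)"
      using pythagoras[of s] c by (simp add: abs_mult powr_mult distrib_left)
    then have "c powr p = 1 powr p" using pythagoras[of r] by simp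
    then have "c = 1" using c(3) p by (metis less_irrefl less_numeral_extra(1) not_less_iff_gr_or_eq
        powr_less_mono2 less_imp_le zero_less_one less_trans)
    then have "C r = C s" using c by simp
    then show ?thesis using C_inj[of r s] C_inj[of s r] i j by (cases r s rule: linorder_cases) auto
  qed
  then have "a = b + of_int (i - j) * \<pi>" using i j by (simp add: algebra_simps)
  then show thesis using that by blast
qed

lemma powr_S_deriv: "((\<lambda>x. \<bar>S x\<bar> powr p) has_real_derivative p * spow p (S x) * C x) (at x)"
  using DERIV_chain2[OF abs_powr_has_derivative[OF p] S_deriv] .

text \<open>Although \<open>C\<close> need not be Lipschitz, \<open>|S|\<^sup>p\<close> always is. It is through this function alone that the
angle enters its linear equation.\<close>

lemma powr_S_lipschitz: "\<bar>\<bar>S x\<bar> powr p - \<bar>S y\<bar> powr p\<bar> \<le> p * \<bar>x - y\<bar>"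
proof -
  have "norm (\<bar>S x\<bar> powr p - \<bar>S y\<bar> powr p) \<le> p * norm (x - y)"
  proof (rule field_differentiable_bound[where S=UNIV])
    fix z
    show "((\<lambda>x. \<bar>S x\<bar> powr p) has_real_derivative p * spow p (S z) * C z) (at z within UNIV)"
      using powr_S_deriv by simp
    have "\<bar>spow p (S z)\<bar> \<le> 1"
      using S_abs_le_1[of z] p powr_mono2[of "p - 1" "\<bar>S z\<bar>" 1] by (simp add: abs_spow)
    then have "\<bar>spow p (S z)\<bar> * \<bar>C z\<bar> \<le> 1 * 1" using C_abs_le_1[of z] by (intro mult_mono) auto
    then show "norm (p * spow p (S z) * C z) \<le> p" using p by (simp add: abs_mult mult.assoc)
  qed auto
  then show ?thesis by simp
qed

end

section \<open>Half-linear equations\<close>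

text \<open>For \<open>m > 1\<close> the function \<open>|v|\<^sup>m\<close> is Lipschitz on bounded sets, so the square of the difference
satisfies the hypotheses of the two-sided Gronwall lemma.\<close>

lemma riccati_unique:
  fixes \<zeta> \<eta> A K :: "real \<Rightarrow> real"
  assumes m: "m > 1" and cont: "continuous_on {a..b} \<zeta>" "continuous_on {a..b} \<eta>"
    and der: "\<And>x. x \<in> {a<..<b} \<Longrightarrow> (\<zeta> has_real_derivative A x + K x * \<bar>\<zeta> x\<bar> powr m) (at x)"
      "\<And>x. x \<in> {a<..<b} \<Longrightarrow> (\<eta> has_real_derivative A x + K x * \<bar>\<eta> x\<bar> powr m) (at x)"
    and bd: "\<And>x. x \<in> {a<..<b} \<Longrightarrow> \<bar>K x\<bar> \<le> B"
    and st: "s \<in> {a..b}" "t \<in> {a..b}" and eq: "\<zeta> s = \<eta> s"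
  shows "\<zeta> t = \<eta> t"
proof -
  obtain N1 where N1: "\<And>x. x \<in> {a..b} \<Longrightarrow> \<bar>\<zeta> x\<bar> \<le> N1"
    using continuous_interval_bounded[OF cont(1)] by blast
  obtain N2 where N2: "\<And>x. x \<in> {a..b} \<Longrightarrow> \<bar>\<eta> x\<bar> \<le> N2"
    using continuous_interval_bounded[OF cont(2)] by blast
  define N where "N = max N1 N2"
  \<comment> \<open>a Lipschitz constant of \<open>|v|\<^sup>m\<close> on \<open>[-N,N]\<close>\<close>
  define Lp where "Lp = m * N powr (m - 1)"
  have N: "\<bar>\<zeta> x\<bar> \<le> N" "\<bar>\<eta> x\<bar> \<le> N" if "x \<in> {a..b}" for x
    using N1[OF that] N2[OF that] by (auto simp: N_def)
  have lip: "\<bar>\<bar>u\<bar> powr m - \<bar>v\<bar> powr m\<bar> \<le> Lp * \<bar>u - v\<bar>" if "\<bar>u\<bar> \<le> N" "\<bar>v\<bar> \<le> N" for u v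
  proof -
    have "norm (\<bar>u\<bar> powr m - \<bar>v\<bar> powr m) \<le> Lp * norm (u - v)"
    proof (rule field_differentiable_bound[where S="{-N..N}"])
      fix z assume z: "z \<in> {-N..N}"
      show "((\<lambda>y. \<bar>y\<bar> powr m) has_real_derivative m * spow m z) (at z within {-N..N})"
        using abs_powr_has_derivative[OF m] by (rule has_field_derivative_at_within)
      have "\<bar>spow m z\<bar> \<le> N powr (m - 1)"
        unfolding abs_spow using z m by (intro powr_mono2) auto
      then show "norm (m * spow m z) \<le> Lp" using m by (simp add: Lp_def abs_mult)
    qed (use that in auto)
    then show ?thesis by simp
  qed
  have "(\<zeta> t - \<eta> t)\<^sup>2 \<le> exp (2 * B * Lp * \<bar>t - s\<bar>) * (\<zeta> s - \<eta> s)\<^sup>2"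
  proof (rule gronwall_two_sided[OF _ _ _ st])
    show "continuous_on {a..b} (\<lambda>x. (\<zeta> x - \<eta> x)\<^sup>2)" by (intro continuous_intros cont)
    fix x assume x: "x \<in> {a<..<b}"
    let ?d = "\<bar>\<zeta> x\<bar> powr m - \<bar>\<eta> x\<bar> powr m"
    have "((\<lambda>x. (\<zeta> x - \<eta> x)\<^sup>2) has_real_derivative
        of_nat 2 * ((A x + K x * \<bar>\<zeta> x\<bar> powr m) - (A x + K x * \<bar>\<eta> x\<bar> powr m)) * (\<zeta> x - \<eta> x) ^ (2 - Suc 0)) (at x)"
      by (rule DERIV_power[OF DERIV_diff[OF der(1)[OF x] der(2)[OF x]], THEN DERIV_cong]) simp
    then show "((\<lambda>x. (\<zeta> x - \<eta> x)\<^sup>2) has_real_derivative 2 * (K x * ?d) * (\<zeta> x - \<eta> x)) (at x)"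
      by (simp add: algebra_simps)
    have B: "\<bar>K x\<bar> \<le> B" using bd[OF x] .
    have "\<bar>K x * ?d\<bar> \<le> B * (Lp * \<bar>\<zeta> x - \<eta> x\<bar>)"
      unfolding abs_mult using B lip N x by (intro mult_mono) auto
    then have "\<bar>K x * ?d\<bar> * \<bar>\<zeta> x - \<eta> x\<bar> \<le> B * (Lp * \<bar>\<zeta> x - \<eta> x\<bar>) * \<bar>\<zeta> x - \<eta> x\<bar>"
      by (intro mult_right_mono) auto
    also have "\<dots> = B * Lp * (\<zeta> x - \<eta> x)\<^sup>2" by (simp add: power2_eq_square)
    finally show "\<bar>2 * (K x * ?d) * (\<zeta> x - \<eta> x)\<bar> \<le> 2 * B * Lp * (\<zeta> x - \<eta> x)\<^sup>2"
      by (simp add: abs_mult)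
  qed
  then show ?thesis using eq by simp
qed

text \<open>The equation \<open>\<phi>(y')' = -(p - 1) m(x) \<phi>(y)\<close>, homogeneous of degree \<open>p - 1\<close> but not additive. The
derivative \<open>y'\<close> is carried along because only its signed power is differentiable.\<close>

definition half_linear :: "real \<Rightarrow> (real \<Rightarrow> real) \<Rightarrow> (real \<Rightarrow> real) \<Rightarrow> (real \<Rightarrow> real) \<Rightarrow> bool" where
  "half_linear p m y y' \<longleftrightarrow> continuous_on {0..1} y' \<and>
     (\<forall>x\<in>{0..1}. (y has_real_derivative y' x) (at x within {0..1})) \<and>
     (\<forall>x\<in>{0<..<1}. ((\<lambda>t. spow p (y' t)) has_real_derivative - (p - 1) * m x * spow p (y x)) (at x))"

lemma half_linear_continuous:
  assumes "half_linear p m y y'"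
  shows "continuous_on {0..1} y" "continuous_on {0..1} y'"
proof -
  have "continuous (at x within {0..1}) y" if "x \<in> {0..1}" for x
    using assms[unfolded half_linear_def, THEN conjunct2, THEN conjunct1] that DERIV_continuous by metis
  then show "continuous_on {0..1} y" by (simp add: continuous_on_eq_continuous_within)
  show "continuous_on {0..1} y'" using assms[unfolded half_linear_def, THEN conjunct1] .
qed

lemma half_linear_deriv:
  assumes "half_linear p m y y'" "x \<in> {0<..<1}"
  shows "(y has_real_derivative y' x) (at x)"
    "((\<lambda>t. spow p (y' t)) has_real_derivative - (p - 1) * m x * spow p (y x)) (at x)"
proof -
  have "x \<in> {0..1}" using assms(2) by simp
  then have "(y has_real_derivative y' x) (at x within {0..1})"
    using assms(1)[unfolded half_linear_def, THEN conjunct2, THEN conjunct1] by metis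
  then show "(y has_real_derivative y' x) (at x)" using assms(2) by (simp add: at_within_Icc_at)
  show "((\<lambda>t. spow p (y' t)) has_real_derivative - (p - 1) * m x * spow p (y x)) (at x)"
    using assms(1)[unfolded half_linear_def, THEN conjunct2, THEN conjunct2] assms(2) by metis
qed

text \<open>The quantity \<open>R = |y|\<^sup>p + |y'|\<^sup>p\<close> satisfies \<open>|R'| \<le> p (1 + M) R\<close>. It has to be differentiated
as \<open>|\<phi>(y')|\<close> to the dual exponent, since \<open>y'\<close> itself may fail to be differentiable.\<close>

lemma half_linear_nonvanishing:
  assumes p: "p > 1" and sol: "half_linear p m y y'" and m: "\<And>x. x \<in> {0<..<1} \<Longrightarrow> \<bar>m x\<bar> \<le> M"
    and nz: "s \<in> {0..1}" "y s \<noteq> 0" and x: "x \<in> {0..1}"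
  shows "y x \<noteq> 0 \<or> y' x \<noteq> 0"
proof (rule ccontr)
  assume "\<not> ?thesis"
  then have zero: "y x = 0" "y' x = 0" by auto
  define R where "R x = \<bar>y x\<bar> powr p + \<bar>spow p (y' x)\<bar> powr conjugate_exponent p" for x
  note pc = conjugate_exponent_gt_1[OF p]
  have "R s \<le> exp ((p * (1 + M)) * \<bar>s - x\<bar>) * R x"
  proof (rule gronwall_two_sided[OF _ _ _ x nz(1)])
    have "p \<noteq> 0" "conjugate_exponent p \<noteq> 0" using p pc by auto
    then show "continuous_on {0..1} R"
      unfolding R_def using half_linear_continuous[OF sol] p pc
      by (intro continuous_intros continuous_on_powr') auto
    fix u :: real assume u: "u \<in> {0<..<1}"
    have dR: "(R has_real_derivative p * spow p (y u) * y' u +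
        conjugate_exponent p * spow (conjugate_exponent p) (spow p (y' u)) * (- (p - 1) * m u * spow p (y u))) (at u)"
      unfolding R_def
      by (intro DERIV_add DERIV_chain2[OF abs_powr_has_derivative[OF p]] half_linear_deriv[OF sol u]
          DERIV_chain2[OF abs_powr_has_derivative[OF pc]])
    have "conjugate_exponent p * (p - 1) = p" using p by (simp add: conjugate_exponent_def)
    then have "conjugate_exponent p * y' u * (- (p - 1) * m u * spow p (y u)) = - p * (y' u * m u * spow p (y u))"
      by (metis (no_types, opaque_lifting) mult.assoc mult.commute mult_minus_left)
    then have "p * spow p (y u) * y' u +
        conjugate_exponent p * spow (conjugate_exponent p) (spow p (y' u)) * (- (p - 1) * m u * spow p (y u)) =
        p * (1 - m u) * (spow p (y u) * y' u)"
      unfolding spow_conj[OF p] by (simp add: right_diff_distrib left_diff_distrib)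
    with dR show "(R has_real_derivative p * (1 - m u) * (spow p (y u) * y' u)) (at u)" by simp
    have "\<bar>spow p (y u) * y' u\<bar> \<le> max \<bar>y u\<bar> \<bar>y' u\<bar> powr (p - 1) * max \<bar>y u\<bar> \<bar>y' u\<bar>"
      unfolding abs_mult abs_spow using p by (intro mult_mono powr_mono2) auto
    also have "\<dots> = max \<bar>y u\<bar> \<bar>y' u\<bar> powr p"
      using mult_spow[of "max \<bar>y u\<bar> \<bar>y' u\<bar>" p] by (simp add: spow_def sgn_if max_def mult.commute split: if_splits)
    also have "\<dots> \<le> R u" unfolding R_def abs_spow_powr_conj[OF p] by (auto simp: max_def)
    finally have main: "\<bar>spow p (y u) * y' u\<bar> \<le> R u" .
    have "\<bar>1 - m u\<bar> \<le> 1 + M" using m[OF u] by linarith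
    then have "\<bar>1 - m u\<bar> * \<bar>spow p (y u) * y' u\<bar> \<le> (1 + M) * R u"
      using main by (intro mult_mono) auto
    then show "\<bar>p * (1 - m u) * (spow p (y u) * y' u)\<bar> \<le> p * (1 + M) * R u"
      using p by (simp add: abs_mult mult.assoc)
  qed
  also have "R x = 0" by (simp add: R_def zero)
  finally have "R s \<le> 0" by simp
  moreover have "R s > 0" unfolding R_def using nz(2) by (simp add: add_pos_nonneg)
  ultimately show False by simp
qed

text \<open>The Riccati equation in the chart \<open>y \<noteq> 0\<close>. The dual exponent is above \<open>1\<close>, which makes the
right-hand side locally Lipschitz; the same would fail for the inverse of this variable.\<close>

lemma half_linear_slope:
  assumes p: "p > 1" and sol: "half_linear p m y y'" and x: "x \<in> {0<..<1}" and nz: "y x \<noteq> 0"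
  shows "((\<lambda>t. spow p (y' t / y t)) has_real_derivative
    - (p - 1) * m x + (- (p - 1)) * \<bar>spow p (y' x / y x)\<bar> powr conjugate_exponent p) (at x)"
proof -
  have inv: "((\<lambda>t. inverse (y t)) has_real_derivative - (inverse (y x) * y' x * inverse (y x))) (at x)"
    using half_linear_deriv(1)[OF sol x] nz by (rule DERIV_inverse')
  have dd: "((\<lambda>t. spow p (y' t) * spow p (inverse (y t))) has_real_derivative
      (- (p - 1) * m x * spow p (y x)) * spow p (inverse (y x)) +
      ((p - 1) * \<bar>inverse (y x)\<bar> powr (p - 2) * - (inverse (y x) * y' x * inverse (y x))) * spow p (y' x)) (at x)"
    by (intro DERIV_mult half_linear_deriv(2)[OF sol x] DERIV_chain2[OF spow_has_derivative inv])
       (use nz in simp)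
  have "spow p (y x) * spow p (inverse (y x)) = 1"
    using nz by (simp add: spow_mult[symmetric]) (simp add: spow_def)
  then have e1: "(- (p - 1) * m x * spow p (y x)) * spow p (inverse (y x)) = - (p - 1) * m x"
    by (simp add: mult.assoc)
  have e2: "\<bar>inverse (y x)\<bar> powr (p - 2) * (inverse (y x) * y' x * inverse (y x)) * spow p (y' x)
      = \<bar>y' x / y x\<bar> powr p"
  proof -
    have "\<bar>inverse (y x)\<bar> powr (p - 2) * (inverse (y x) * inverse (y x)) = \<bar>inverse (y x)\<bar> powr (p - 2) * \<bar>inverse (y x)\<bar> powr 2"
      using nz by (simp add: power2_eq_square[symmetric] power_inverse)
    also have "\<dots> = \<bar>inverse (y x)\<bar> powr (p - 2 + 2)" by (rule powr_add[symmetric])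
    finally have 1: "\<bar>inverse (y x)\<bar> powr (p - 2) * (inverse (y x) * inverse (y x)) = \<bar>inverse (y x)\<bar> powr p" by simp
    have "\<bar>inverse (y x)\<bar> powr (p - 2) * (inverse (y x) * y' x * inverse (y x)) * spow p (y' x)
      = (\<bar>inverse (y x)\<bar> powr (p - 2) * (inverse (y x) * inverse (y x))) * (y' x * spow p (y' x))"
      by (simp only: mult_ac)
    also have "\<dots> = \<bar>inverse (y x)\<bar> powr p * \<bar>y' x\<bar> powr p" unfolding 1 mult_spow ..
    also have "\<dots> = \<bar>y' x / y x\<bar> powr p" by (simp add: powr_mult[symmetric] abs_mult[symmetric] field_simps)
    finally show ?thesis .
  qed
  have e3: "((p - 1) * a * - b) * c = - (p - 1) * (a * b * c)" for a b c by (simp add: algebra_simps)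
  show ?thesis
    using dd unfolding abs_spow_powr_conj[OF p] e1 e3 e2 unfolding spow_mult[symmetric] divide_inverse[symmetric] .
qed

text \<open>The Riccati equation in the chart \<open>y' \<noteq> 0\<close>. Here \<open>y/y'\<close> is used without signed power, since
then the exponent is \<open>p > 1\<close>.\<close>

lemma half_linear_coslope:
  assumes p: "p > 1" and sol: "half_linear p m y y'" and x: "x \<in> {0<..<1}" and nz: "y' x \<noteq> 0"
  shows "((\<lambda>t. y t / y' t) has_real_derivative 1 + m x * \<bar>y x / y' x\<bar> powr p) (at x)"
proof -
  let ?q = "conjugate_exponent p" and ?v = "\<bar>y' x\<bar>"
  define D where "D = (?q - 1) * \<bar>spow p (y' x)\<bar> powr (?q - 2) * (- (p - 1) * m x * spow p (y x))"
  have "((\<lambda>t. spow ?q (spow p (y' t))) has_real_derivative D) (at x)"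
    unfolding D_def by (intro DERIV_chain2[OF spow_has_derivative half_linear_deriv(2)[OF sol x]]) (use nz in simp)
  then have dy': "(y' has_real_derivative D) (at x)" by (simp add: spow_conj[OF p])
  have "(p - 1) * (?q - 2) = 2 - p" using conjugate_exponent_mult[OF p] by (simp add: algebra_simps)
  then have v2: "\<bar>spow p (y' x)\<bar> powr (?q - 2) = ?v powr (2 - p)" by (simp add: abs_spow powr_powr)
  have "a * v * (- b * c * s) = (a * b) * (- (v * c * s))" for a b c v s :: real by (simp add: mult_ac)
  then have "D = ((?q - 1) * (p - 1)) * (- (\<bar>y' x\<bar> powr (2 - p) * m x * spow p (y x)))"
    unfolding D_def v2 .
  then have D: "D = - (\<bar>y' x\<bar> powr (2 - p) * m x * spow p (y x))" by (simp add: conjugate_exponent_mult[OF p])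
  have "?v powr (2 - p) / (y' x * y' x) = ?v powr (2 - p) / ?v powr 2"
    using nz by (simp add: power2_eq_square)
  also have "\<dots> = ?v powr (2 - p - 2)" by (rule powr_diff[symmetric])
  finally have v: "?v powr (2 - p) / (y' x * y' x) = inverse (?v powr p)" by (simp add: powr_minus)
  have "- (y x * D) / (y' x * y' x) = m x * (y x * spow p (y x)) * (?v powr (2 - p) / (y' x * y' x))"
    unfolding D by simp
  also have "\<dots> = m x * (\<bar>y x\<bar> powr p * inverse (?v powr p))" unfolding v mult_spow by simp
  also have "\<bar>y x\<bar> powr p * inverse (?v powr p) = \<bar>y x / y' x\<bar> powr p"
    by (simp add: powr_divide divide_inverse[symmetric])
  finally have e: "- (y x * D) / (y' x * y' x) = m x * \<bar>y x / y' x\<bar> powr p" .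
  have "((\<lambda>t. y t / y' t) has_real_derivative (y' x * y' x - y x * D) / (y' x * y' x)) (at x)"
    by (rule DERIV_divide[OF half_linear_deriv(1)[OF sol x] dy' nz])
  also have "(y' x * y' x - y x * D) / (y' x * y' x) = 1 + (- (y x * D) / (y' x * y' x))"
    using nz by (simp add: field_simps)
  finally show ?thesis unfolding e .
qed

lemma nonzero_nearby:
  fixes g :: "real \<Rightarrow> real"
  assumes "continuous_on {0..1} g" "x0 \<in> {0..1}" "g x0 \<noteq> 0"
  obtains d where "d > 0" "\<And>x. x \<in> {0..1} \<Longrightarrow> \<bar>x - x0\<bar> < d \<Longrightarrow> g x \<noteq> 0"
proof -
  obtain d where "d > 0" "\<And>x. x \<in> {0..1} \<Longrightarrow> dist x x0 < d \<Longrightarrow> dist (g x) (g x0) < \<bar>g x0\<bar>"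
    using assms unfolding continuous_on_iff by (metis zero_less_abs_iff)
  then show thesis using that[of d] by (fastforce simp: dist_real_def)
qed

text \<open>Uniqueness up to scaling. For \<open>p \<noteq> 2\<close> no Wronskian identity is available. Instead, the set of
points where the two solutions are parallel is shown to be open and closed: near a point where
both \<open>y\<close> or both \<open>y'\<close> are nonzero the Riccati equations propagate equality of the slopes, and at
every other point the solutions are not parallel, which persists nearby.\<close>

lemma half_linear_parallel:
  assumes p: "p > 1" and sol: "half_linear p m y1 y1'" "half_linear p m y2 y2'"
    and m: "\<And>x. x \<in> {0<..<1} \<Longrightarrow> \<bar>m x\<bar> \<le> M"
    and nz: "\<And>x. x \<in> {0..1} \<Longrightarrow> y1 x \<noteq> 0 \<or> y1' x \<noteq> 0" "\<And>x. x \<in> {0..1} \<Longrightarrow> y2 x \<noteq> 0 \<or> y2' x \<noteq> 0"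
    and init: "y1 0 * y2' 0 = y1' 0 * y2 0"
  shows "y1 1 * y2' 1 = y1' 1 * y2 1"
proof -
  note cont = half_linear_continuous[OF sol(1)] half_linear_continuous[OF sol(2)]
  define P where "P x \<longleftrightarrow> y1 x * y2' x = y1' x * y2 x" for x
  have "P 1"
  proof (rule connected_induction_simple[of "{0..1::real}" 0 1 P])
    fix x0 :: real assume x0: "x0 \<in> {0..1}"
    have "\<exists>d>0. \<forall>s\<in>{0..1}. \<forall>t\<in>{0..1}. \<bar>s - x0\<bar> < d \<longrightarrow> \<bar>t - x0\<bar> < d \<longrightarrow> P s \<longrightarrow> P t"
    proof -
      consider "y1 x0 * y2 x0 \<noteq> 0" | "y1' x0 * y2' x0 \<noteq> 0" | "y1 x0 * y2' x0 - y1' x0 * y2 x0 \<noteq> 0"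
        using nz[OF x0]
        by (cases "y1 x0 = 0"; cases "y2 x0 = 0"; cases "y1' x0 = 0"; cases "y2' x0 = 0") auto
      then show ?thesis
      proof cases
        case 1
        obtain d where d: "d > 0" "\<And>x. x \<in> {0..1} \<Longrightarrow> \<bar>x - x0\<bar> < d \<Longrightarrow> y1 x * y2 x \<noteq> 0"
          by (rule nonzero_nearby[of "\<lambda>x. y1 x * y2 x" x0]) (use 1 x0 cont in \<open>auto intro!: continuous_intros\<close>)
        have "P t" if st: "s \<in> {0..1}" "t \<in> {0..1}" "\<bar>s - x0\<bar> < d" "\<bar>t - x0\<bar> < d" and "P s" for s t
        proof -
          let ?a = "min s t" and ?b = "max s t"
          have nz': "y1 x \<noteq> 0" "y2 x \<noteq> 0" if "x \<in> {?a..?b}" for x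
          proof -
            have "x \<in> {0..1}" "\<bar>x - x0\<bar> < d" using that st by (auto simp: min_def max_def abs_if split: if_splits)
            from d(2)[OF this] show "y1 x \<noteq> 0" "y2 x \<noteq> 0" by auto
          qed
          have sub: "{?a..?b} \<subseteq> {0..1}" using st by auto
          have "spow p (y1' t / y1 t) = spow p (y2' t / y2 t)"
          proof (rule riccati_unique[where \<zeta>="\<lambda>x. spow p (y1' x / y1 x)"
              and \<eta>="\<lambda>x. spow p (y2' x / y2 x)" and m="conjugate_exponent p" and a="?a" and b="?b" and s=s
              and A="\<lambda>x. - (p - 1) * m x" and K="\<lambda>x. - (p - 1)" and B="p - 1"])
            show "continuous_on {?a..?b} (\<lambda>x. spow p (y1' x / y1 x))"
              "continuous_on {?a..?b} (\<lambda>x. spow p (y2' x / y2 x))"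
              using nz' p by (auto intro!: continuous_intros continuous_on_subset[OF cont(1) sub]
                continuous_on_subset[OF cont(2) sub] continuous_on_subset[OF cont(3) sub] continuous_on_subset[OF cont(4) sub])
            fix x assume x: "x \<in> {?a<..<?b}"
            then have x1: "x \<in> {0<..<1}" and x2: "x \<in> {?a..?b}" using st by auto
            show "((\<lambda>x. spow p (y1' x / y1 x)) has_real_derivative
                - (p - 1) * m x + - (p - 1) * \<bar>spow p (y1' x / y1 x)\<bar> powr conjugate_exponent p) (at x)"
              "((\<lambda>x. spow p (y2' x / y2 x)) has_real_derivative
                - (p - 1) * m x + - (p - 1) * \<bar>spow p (y2' x / y2 x)\<bar> powr conjugate_exponent p) (at x)"
              using half_linear_slope[OF p sol(1) x1 nz'(1)[OF x2]] half_linear_slope[OF p sol(2) x1 nz'(2)[OF x2]] .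
          next
            have "y1' s / y1 s = y2' s / y2 s" using \<open>P s\<close> nz'[of s] by (simp add: P_def field_simps)
            then show "spow p (y1' s / y1 s) = spow p (y2' s / y2 s)" by simp
          qed (use p conjugate_exponent_gt_1 in auto)
          then have "y1' t / y1 t = y2' t / y2 t" by (simp add: spow_inject[OF p])
          then show "P t" using nz'[of t] by (simp add: P_def field_simps)
        qed
        then show ?thesis using d(1) by blast
      next
        case 2
        obtain d where d: "d > 0" "\<And>x. x \<in> {0..1} \<Longrightarrow> \<bar>x - x0\<bar> < d \<Longrightarrow> y1' x * y2' x \<noteq> 0"
          by (rule nonzero_nearby[of "\<lambda>x. y1' x * y2' x" x0]) (use 2 x0 cont in \<open>auto intro!: continuous_intros\<close>)
        have "P t" if st: "s \<in> {0..1}" "t \<in> {0..1}" "\<bar>s - x0\<bar> < d" "\<bar>t - x0\<bar> < d" and "P s" for s t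
        proof -
          let ?a = "min s t" and ?b = "max s t"
          have nz': "y1' x \<noteq> 0" "y2' x \<noteq> 0" if "x \<in> {?a..?b}" for x
          proof -
            have "x \<in> {0..1}" "\<bar>x - x0\<bar> < d" using that st by (auto simp: min_def max_def abs_if split: if_splits)
            from d(2)[OF this] show "y1' x \<noteq> 0" "y2' x \<noteq> 0" by auto
          qed
          have sub: "{?a..?b} \<subseteq> {0..1}" using st by auto
          have "y1 t / y1' t = y2 t / y2' t"
          proof (rule riccati_unique[where \<zeta>="\<lambda>x. y1 x / y1' x"
              and \<eta>="\<lambda>x. y2 x / y2' x" and m=p and a="?a" and b="?b" and s=s
              and A="\<lambda>x. 1" and K="m" and B=M])
            show "continuous_on {?a..?b} (\<lambda>x. y1 x / y1' x)" "continuous_on {?a..?b} (\<lambda>x. y2 x / y2' x)"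
              using nz' p by (auto intro!: continuous_intros continuous_on_subset[OF cont(1) sub]
                continuous_on_subset[OF cont(2) sub] continuous_on_subset[OF cont(3) sub] continuous_on_subset[OF cont(4) sub])
            fix x assume x: "x \<in> {?a<..<?b}"
            then have x1: "x \<in> {0<..<1}" and x2: "x \<in> {?a..?b}" using st by auto
            show "((\<lambda>x. y1 x / y1' x) has_real_derivative 1 + m x * \<bar>y1 x / y1' x\<bar> powr p) (at x)"
              "((\<lambda>x. y2 x / y2' x) has_real_derivative 1 + m x * \<bar>y2 x / y2' x\<bar> powr p) (at x)"
              using half_linear_coslope[OF p sol(1) x1 nz'(1)[OF x2]] half_linear_coslope[OF p sol(2) x1 nz'(2)[OF x2]] .
            show "\<bar>m x\<bar> \<le> M" using m[OF x1] .
          next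
            show "y1 s / y1' s = y2 s / y2' s" using \<open>P s\<close> nz'[of s] by (simp add: P_def field_simps)
          qed (use p in auto)
          then show "P t" using nz'[of t] by (simp add: P_def field_simps)
        qed
        then show ?thesis using d(1) by blast
      next
        case 3
        obtain d where d: "d > 0" "\<And>x. x \<in> {0..1} \<Longrightarrow> \<bar>x - x0\<bar> < d \<Longrightarrow> y1 x * y2' x - y1' x * y2 x \<noteq> 0"
          by (rule nonzero_nearby[of "\<lambda>x. y1 x * y2' x - y1' x * y2 x" x0])
             (use 3 x0 cont in \<open>auto intro!: continuous_intros\<close>)
        then show ?thesis unfolding P_def by (intro exI[of _ d]) auto
      qed
    qed
    then obtain d where d: "d > 0" "\<And>s t. s \<in> {0..1} \<Longrightarrow> t \<in> {0..1} \<Longrightarrow> \<bar>s - x0\<bar> < d \<Longrightarrow> \<bar>t - x0\<bar> < d \<Longrightarrow> P s \<Longrightarrow> P t"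
      by blast
    show "\<exists>T. openin (top_of_set {0..1}) T \<and> x0 \<in> T \<and> (\<forall>x\<in>T. \<forall>y\<in>T. P x \<longrightarrow> P y)"
      using d x0 by (intro exI[of _ "{0..1} \<inter> ball x0 d"] conjI ballI impI openin_open_Int open_ball)
        (auto simp: dist_real_def abs_minus_commute)
  qed (use init in \<open>auto simp: P_def\<close>)
  then show ?thesis by (simp add: P_def)
qed

section \<open>The Pruefer transformation\<close>

context p_trig
begin

lemma S_or_C_nonzero: "S x \<noteq> 0 \<or> C x \<noteq> 0"
  using pythagoras[of x] by auto

text \<open>Here \<open>h\<close> is an arbitrary function, so that the linear and the nonlinear equation are covered at
once. The terms with \<open>h\<close> cancel in \<open>y'\<close>, and \<open>|S|\<^sup>p + |C|\<^sup>p = 1\<close> does the rest.\<close>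

lemma prufer_solution:
  fixes \<theta> L h :: "real \<Rightarrow> real"
  assumes \<theta>: "\<And>x. x \<in> {0..1} \<Longrightarrow>
      (\<theta> has_real_derivative \<bar>C (\<theta> x)\<bar> powr p + S (\<theta> x) * h x) (at x within {0..1})"
    and L: "\<And>x. x \<in> {0..1} \<Longrightarrow>
      (L has_real_derivative C (\<theta> x) * (spow p (S (\<theta> x)) - h x)) (at x within {0..1})"
  shows "continuous_on {0..1} (\<lambda>x. exp (L x) * C (\<theta> x))"
    and "x \<in> {0..1} \<Longrightarrow> ((\<lambda>x. exp (L x) * S (\<theta> x)) has_real_derivative exp (L x) * C (\<theta> x)) (at x within {0..1})"
    and "x \<in> {0..1} \<Longrightarrow> ((\<lambda>x. spow p (exp (L x) * C (\<theta> x))) has_real_derivative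
        - (p - 1) * (exp ((p - 1) * L x) * h x)) (at x within {0..1})"
proof -
  have "continuous_on {0..1} \<theta>" "continuous_on {0..1} L"
    using \<theta> L DERIV_continuous by (metis continuous_on_eq_continuous_within)+
  then show "continuous_on {0..1} (\<lambda>x. exp (L x) * C (\<theta> x))"
    by (intro continuous_intros continuous_on_compose2[OF C_continuous[of UNIV]]) auto
  assume x: "x \<in> {0..1}"
  let ?s = "S (\<theta> x)" and ?c = "C (\<theta> x)" and ?e = "exp (L x)"
  have "((\<lambda>x. exp (L x) * S (\<theta> x)) has_real_derivative
      ?e * (?c * (spow p ?s - h x)) * ?s + ?c * (\<bar>?c\<bar> powr p + ?s * h x) * ?e) (at x within {0..1})"
    by (intro DERIV_mult DERIV_chain2[OF DERIV_exp] DERIV_chain2[OF S_deriv] \<theta> L x)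
  moreover have "?e * (?c * (spow p ?s - h x)) * ?s + ?c * (\<bar>?c\<bar> powr p + ?s * h x) * ?e
      = ?e * ?c * (?s * spow p ?s + \<bar>?c\<bar> powr p)" by (simp add: algebra_simps)
  ultimately show "((\<lambda>x. exp (L x) * S (\<theta> x)) has_real_derivative ?e * ?c) (at x within {0..1})"
    by (simp add: mult_spow pythagoras)
  let ?E = "exp ((p - 1) * L x)"
  have "((\<lambda>x. exp ((p - 1) * L x) * spow p (C (\<theta> x))) has_real_derivative
      ?E * ((p - 1) * (?c * (spow p ?s - h x))) * spow p ?c +
      (1 - p) * spow p ?s * (\<bar>?c\<bar> powr p + ?s * h x) * ?E) (at x within {0..1})"
    by (intro DERIV_mult DERIV_chain2[OF DERIV_exp] DERIV_chain2[OF spow_C_deriv] DERIV_cmult \<theta> L x)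
  moreover have "?E * ((p - 1) * (?c * (spow p ?s - h x))) * spow p ?c +
      (1 - p) * spow p ?s * (\<bar>?c\<bar> powr p + ?s * h x) * ?E =
      (p - 1) * ?E * ((?c * spow p ?c) * (spow p ?s - h x) - spow p ?s * \<bar>?c\<bar> powr p - (?s * spow p ?s) * h x)"
    by (simp add: algebra_simps)
  also have "(?c * spow p ?c) * (spow p ?s - h x) - spow p ?s * \<bar>?c\<bar> powr p - (?s * spow p ?s) * h x
      = - (h x * (\<bar>?s\<bar> powr p + \<bar>?c\<bar> powr p))" unfolding mult_spow by (simp add: algebra_simps)
  finally show "((\<lambda>x. spow p (exp (L x) * C (\<theta> x))) has_real_derivative
        - (p - 1) * (?E * h x)) (at x within {0..1})"
    unfolding spow_exp pythagoras by (simp add: algebra_simps)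
qed

lemma prufer_bvp_solution:
  fixes \<theta> L h :: "real \<Rightarrow> real"
  assumes \<theta>: "\<And>x. x \<in> {0..1} \<Longrightarrow>
      (\<theta> has_real_derivative \<bar>C (\<theta> x)\<bar> powr p + S (\<theta> x) * h x) (at x within {0..1})"
    and L: "\<And>x. x \<in> {0..1} \<Longrightarrow>
      (L has_real_derivative C (\<theta> x) * (spow p (S (\<theta> x)) - h x)) (at x within {0..1})"
    and ends: "\<theta> 0 = \<alpha>" "\<theta> 1 = \<beta> + of_int k * \<pi>"
    and E: "\<And>x. x \<in> {0<..<1} \<Longrightarrow> E x (exp (L x) * S (\<theta> x)) (- (p - 1) * (exp ((p - 1) * L x) * h x))"
  shows "bvp_solution p \<alpha> \<beta> E (\<lambda>x. exp (L x) * S (\<theta> x))"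
  unfolding bvp_solution_def
proof (intro exI conjI ballI)
  note sol = prufer_solution[of \<theta> h L, OF \<theta> L]
  show "continuous_on {0..1} (\<lambda>x. exp (L x) * C (\<theta> x))" by (rule sol(1))
  show "((\<lambda>x. exp (L x) * S (\<theta> x)) has_real_derivative exp (L x) * C (\<theta> x)) (at x within {0..1})"
    if "x \<in> {0..1}" for x using sol(2) that by blast
  show "((\<lambda>t. spow p (exp (L t) * C (\<theta> t))) has_real_derivative - (p - 1) * (exp ((p - 1) * L x) * h x)) (at x)"
    if "x \<in> {0<..<1}" for x
    using sol(3)[of x] that by (simp add: at_within_Icc_at)
  show "E x (exp (L x) * S (\<theta> x)) (- (p - 1) * (exp ((p - 1) * L x) * h x))" if "x \<in> {0<..<1}" for x
    using E that .
  show "deriv S \<alpha> * (exp (L 0) * S (\<theta> 0)) - S \<alpha> * (exp (L 0) * C (\<theta> 0)) = 0"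
    by (simp add: deriv_S ends)
  show "deriv S \<beta> * (exp (L 1) * S (\<theta> 1)) - S \<beta> * (exp (L 1) * C (\<theta> 1)) = 0"
    unfolding deriv_S ends S_shift_int C_shift_int by simp
qed

text \<open>The solution \<open>e\<^sup>L S(\<theta>)\<close> vanishes where \<open>\<theta>\<close> is a multiple of \<open>\<pi>\<^sub>p\<close>, and all multiples are crossed
upwards. So \<open>\<theta>\<close> meets \<open>k \<pi>\<^sub>p\<close> exactly once for \<open>k = 1, ..., n\<close>, and no other multiple inside the
interval.\<close>

lemma zeros_of_angle:
  fixes \<theta> \<theta>' :: "real \<Rightarrow> real"
  assumes cont: "continuous_on {0..1} \<theta>"
    and der: "\<And>x. x \<in> {0..1} \<Longrightarrow> S (\<theta> x) = 0 \<Longrightarrow>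
        (\<theta> has_real_derivative \<theta>' x) (at x within {0..1}) \<and> \<theta>' x > 0"
    and start: "\<theta> 0 \<in> {0..<\<pi>}" and "\<beta> \<in> {0<..\<pi>}" "\<theta> 1 = \<beta> + real n * \<pi>"
  shows "finite {x\<in>{0<..<1}. S (\<theta> x) = 0} \<and> card {x\<in>{0<..<1}. S (\<theta> x) = 0} = n"
proof -
  define Z where "Z = {x\<in>{0<..<1}. S (\<theta> x) = 0}"
  have above: "\<theta> t > of_int k * \<pi>" if "0 \<le> s" "s < t" "t \<le> 1" "\<theta> s \<ge> of_int k * \<pi>" for s t and k :: int
    by (rule stays_above[OF cont _ that(1-3) that(4)]) (use der S_eq_0_iff in blast)
  have ex: "\<exists>x\<in>Z. \<theta> x = real k * \<pi>" if "k \<in> {1..n}" for k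
  proof -
    have "1 * \<pi> \<le> real k * \<pi>" "real k * \<pi> \<le> real n * \<pi>" using that pi_pos by (auto intro!: mult_right_mono)
    moreover have "0 \<le> \<theta> 0" "\<theta> 0 < \<pi>" "0 < \<beta>" using start assms by auto
    ultimately have lt: "\<theta> 0 < real k * \<pi>" "real k * \<pi> < \<theta> 1"
      using assms(5) by linarith+
    obtain x where x: "0 \<le> x" "x \<le> 1" "\<theta> x = real k * \<pi>"
      using IVT'[of \<theta> 0 "real k * \<pi>" 1] cont lt by auto
    then have "x \<noteq> 0" "x \<noteq> 1" using lt by auto
    moreover have "S (\<theta> x) = 0" using x(3) S_eq_0_iff by (metis of_int_of_nat_eq)
    ultimately show ?thesis using x by (intro bexI[of _ x]) (auto simp: Z_def)
  qed
  have uniq: "x = x'" if "x \<in> Z" "x' \<in> Z" "\<theta> x = \<theta> x'" for x x'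
  proof -
    obtain k :: int where k: "\<theta> x = of_int k * \<pi>" using \<open>x \<in> Z\<close> S_eq_0_iff by (auto simp: Z_def)
    have "\<not> x < x'" "\<not> x' < x" using above[of x x' k] above[of x' x k] k that by (auto simp: Z_def)
    then show ?thesis by simp
  qed
  have range: "\<exists>k\<in>{1..n}. \<theta> x = real k * \<pi>" if x: "x \<in> Z" for x
  proof -
    obtain k :: int where k: "\<theta> x = of_int k * \<pi>" using x S_eq_0_iff by (auto simp: Z_def)
    have "of_int 0 * \<pi> < \<theta> x" by (rule above[of 0]) (use x start in \<open>auto simp: Z_def\<close>)
    then have "k > 0" using k pi_pos by (simp add: zero_less_mult_iff)
    moreover have "of_int k * \<pi> < \<theta> 1" by (rule above[of x]) (use x k in \<open>auto simp: Z_def\<close>)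
    then have "of_int k * \<pi> < (1 + real n) * \<pi>" using assms by (simp add: algebra_simps)
    then have "of_int k < 1 + real n" using pi_pos by (simp only: mult_less_cancel_right_pos)
    then have "k \<le> int n" by linarith
    ultimately show ?thesis using k by (intro bexI[of _ "nat k"]) auto
  qed
  have "bij_betw (\<lambda>x. nat \<lfloor>\<theta> x / \<pi>\<rfloor>) Z {1..n}"
    unfolding bij_betw_def
  proof
    have num: "nat \<lfloor>\<theta> x / \<pi>\<rfloor> = k" if "\<theta> x = real k * \<pi>" for x k using that pi_pos by simp
    show "inj_on (\<lambda>x. nat \<lfloor>\<theta> x / \<pi>\<rfloor>) Z"
    proof (rule inj_onI)
      fix x x' assume xx: "x \<in> Z" "x' \<in> Z" and eq: "nat \<lfloor>\<theta> x / \<pi>\<rfloor> = nat \<lfloor>\<theta> x' / \<pi>\<rfloor>"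
      obtain j j' where "\<theta> x = real j * \<pi>" "\<theta> x' = real j' * \<pi>" using range xx by blast
      then have "\<theta> x = \<theta> x'" using num eq by metis
      then show "x = x'" using uniq xx by blast
    qed
    show "(\<lambda>x. nat \<lfloor>\<theta> x / \<pi>\<rfloor>) ` Z = {1..n}"
    proof
      show "(\<lambda>x. nat \<lfloor>\<theta> x / \<pi>\<rfloor>) ` Z \<subseteq> {1..n}"
      proof
        fix k assume "k \<in> (\<lambda>x. nat \<lfloor>\<theta> x / \<pi>\<rfloor>) ` Z"
        then obtain x where x: "x \<in> Z" "k = nat \<lfloor>\<theta> x / \<pi>\<rfloor>" by blast
        obtain j where "j \<in> {1..n}" "\<theta> x = real j * \<pi>" using range[OF x(1)] by blast
        then show "k \<in> {1..n}" using num[of x j] x(2) by simp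
      qed
      show "{1..n} \<subseteq> (\<lambda>x. nat \<lfloor>\<theta> x / \<pi>\<rfloor>) ` Z"
      proof
        fix k assume "k \<in> {1..n}"
        then obtain x where "x \<in> Z" "\<theta> x = real k * \<pi>" using ex by blast
        then show "k \<in> (\<lambda>x. nat \<lfloor>\<theta> x / \<pi>\<rfloor>) ` Z" using num[of x k] by (intro image_eqI[of _ _ x]) auto
      qed
    qed
  qed
  then have "finite Z" "card Z = n" using bij_betw_finite[of _ Z "{1..n}"] bij_betw_same_card[of _ Z "{1..n}"] by auto
  then show ?thesis by (simp add: Z_def)
qed

end

section \<open>The half-linear eigenvalue problem\<close>

locale sturm_liouville = p_trig p for p +
  fixes q w :: "real \<Rightarrow> real" and \<alpha> :: real
  assumes q: "continuous_on {0..1} q" and w: "continuous_on {0..1} w"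
    and w_pos: "x \<in> {0..1} \<Longrightarrow> w x > 0" and \<alpha>: "\<alpha> \<in> {0..<\<pi>}"
begin

text \<open>The right-hand side of the equation of the linear angle, with \<open>|C|\<^sup>p\<close> eliminated so that the angle
only enters through \<open>|S|\<^sup>p\<close>.\<close>

definition G :: "real \<Rightarrow> real \<Rightarrow> real \<Rightarrow> real" where
  "G \<mu> x \<theta> = 1 + (\<mu> * w x - q x - 1) * \<bar>S \<theta>\<bar> powr p"

lemma G_eq: "G \<mu> x \<theta> = \<bar>C \<theta>\<bar> powr p + S \<theta> * ((\<mu> * w x - q x) * spow p (S \<theta>))"
proof -
  have "\<bar>C \<theta>\<bar> powr p = 1 - \<bar>S \<theta>\<bar> powr p" using pythagoras[of \<theta>] by simp
  moreover have "S \<theta> * ((\<mu> * w x - q x) * spow p (S \<theta>)) = (\<mu> * w x - q x) * \<bar>S \<theta>\<bar> powr p"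
    by (simp add: mult_spow[symmetric])
  ultimately show ?thesis by (simp add: G_def algebra_simps)
qed

lemma coefficient_bounds:
  obtains W Q w0 where "W > 0" "Q > 0" "w0 > 0"
    "\<And>x. x \<in> {0..1} \<Longrightarrow> \<bar>w x\<bar> \<le> W" "\<And>x. x \<in> {0..1} \<Longrightarrow> \<bar>q x\<bar> \<le> Q" "\<And>x. x \<in> {0..1} \<Longrightarrow> w0 \<le> w x"
proof -
  obtain W where W: "W > 0" "\<And>x. x \<in> {0..1} \<Longrightarrow> \<bar>w x\<bar> \<le> W" using continuous_interval_bounded[OF w] by blast
  obtain Q where Q: "Q > 0" "\<And>x. x \<in> {0..1} \<Longrightarrow> \<bar>q x\<bar> \<le> Q" using continuous_interval_bounded[OF q] by blast
  obtain x0 where "x0 \<in> {0..1}" "\<And>x. x \<in> {0..1} \<Longrightarrow> w x0 \<le> w x"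
    using continuous_attains_inf[OF compact_Icc _ w] by force
  with W Q show thesis using that[of W Q "w x0"] w_pos by blast
qed

lemma G_lipschitz:
  obtains K where "K \<ge> 0" "\<And>x a b. x \<in> {0..1} \<Longrightarrow> \<bar>G \<mu> x a - G \<mu> x b\<bar> \<le> K * \<bar>a - b\<bar>"
proof -
  have "continuous_on {0..1} (\<lambda>x. \<mu> * w x - q x - 1)" by (intro continuous_intros q w)
  then obtain M where M: "M > 0" "\<And>x. x \<in> {0..1} \<Longrightarrow> \<bar>\<mu> * w x - q x - 1\<bar> \<le> M"
    using continuous_interval_bounded by blast
  have "\<bar>G \<mu> x a - G \<mu> x b\<bar> \<le> (M * p) * \<bar>a - b\<bar>" if "x \<in> {0..1}" for x a b
  proof -
    have "\<bar>G \<mu> x a - G \<mu> x b\<bar> = \<bar>\<mu> * w x - q x - 1\<bar> * \<bar>\<bar>S a\<bar> powr p - \<bar>S b\<bar> powr p\<bar>"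
      by (simp add: G_def abs_mult[symmetric] right_diff_distrib)
    also have "\<dots> \<le> M * (p * \<bar>a - b\<bar>)"
      using M that powr_S_lipschitz by (intro mult_mono) auto
    finally show ?thesis by simp
  qed
  then show thesis using that[of "M * p"] M p by simp
qed

text \<open>Both functions are approximate solutions of the linear angle equation; \<open>\<delta>\<close> bounds by how much the
defect of \<open>\<phi>\<close> exceeds that of \<open>\<psi>\<close>. The cases used are sub- and supersolutions (\<open>\<delta> = 0\<close>) and
perturbations of the eigenvalue parameter or of the nonlinearity.\<close>

lemma angle_comparison:
  assumes K: "K \<ge> 0" "\<And>x a b. x \<in> {0..1} \<Longrightarrow> \<bar>G \<mu> x a - G \<mu> x b\<bar> \<le> K * \<bar>a - b\<bar>"
    and cont: "continuous_on {0..1} \<phi>" "continuous_on {0..1} \<psi>"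
    and der: "\<And>x. x \<in> {0<..<1} \<Longrightarrow> (\<phi> has_real_derivative \<phi>' x) (at x)"
      "\<And>x. x \<in> {0<..<1} \<Longrightarrow> (\<psi> has_real_derivative \<psi>' x) (at x)"
    and le: "\<And>x. x \<in> {0<..<1} \<Longrightarrow> \<phi>' x - G \<mu> x (\<phi> x) \<le> \<psi>' x - G \<mu> x (\<psi> x) + \<delta>"
    and init: "\<phi> 0 \<le> \<psi> 0" "\<delta> \<ge> 0" and x: "x \<in> {0..1}"
  shows "\<phi> x \<le> \<psi> x + \<delta> * exp K"
proof -
  have "\<phi> x - \<psi> x \<le> \<delta> * (1 - 0) * exp (K * (1 - 0))"
  proof (rule one_sided_gronwall[where d="\<lambda>x. \<phi> x - \<psi> x" and d'="\<lambda>x. \<phi>' x - \<psi>' x" and a=0 and b=1])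
    show "continuous_on {0..1} (\<lambda>x. \<phi> x - \<psi> x)" by (intro continuous_intros cont)
    show "((\<lambda>x. \<phi> x - \<psi> x) has_real_derivative \<phi>' x - \<psi>' x) (at x)" if "x \<in> {0<..<1}" for x
      by (intro DERIV_diff der that)
    show "\<phi>' x - \<psi>' x \<le> K * (\<phi> x - \<psi> x) + \<delta>" if "x \<in> {0<..<1}" "\<phi> x - \<psi> x > 0" for x
      using le[OF that(1)] K(2)[of x "\<phi> x" "\<psi> x"] that by auto
  qed (use K init x in auto)
  then show ?thesis by simp
qed

definition linear_angle :: "real \<Rightarrow> (real \<Rightarrow> real) \<Rightarrow> bool" where
  "linear_angle \<mu> \<theta> \<longleftrightarrow> \<theta> 0 = \<alpha> \<and>
     (\<forall>x\<in>{0..1}. (\<theta> has_real_derivative G \<mu> x (\<theta> x)) (at x within {0..1}))"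

lemma linear_angleD:
  assumes "linear_angle \<mu> \<theta>"
  shows "\<theta> 0 = \<alpha>" "x \<in> {0..1} \<Longrightarrow> (\<theta> has_real_derivative G \<mu> x (\<theta> x)) (at x within {0..1})"
    "x \<in> {0<..<1} \<Longrightarrow> (\<theta> has_real_derivative G \<mu> x (\<theta> x)) (at x)" "continuous_on {0..1} \<theta>"
proof -
  show "\<theta> 0 = \<alpha>" using assms by (simp add: linear_angle_def)
  show d: "(\<theta> has_real_derivative G \<mu> x (\<theta> x)) (at x within {0..1})" if "x \<in> {0..1}" for x
    using assms that by (simp add: linear_angle_def)
  show "(\<theta> has_real_derivative G \<mu> x (\<theta> x)) (at x)" if "x \<in> {0<..<1}"
    using d[of x] that by (simp add: at_within_Icc_at)
  show "continuous_on {0..1} \<theta>"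
    using d DERIV_continuous by (metis continuous_on_eq_continuous_within)
qed

lemma linear_angle_exists: "\<exists>\<theta>. linear_angle \<mu> \<theta>"
proof -
  obtain W Q w0 where b: "W > 0" "Q > 0" "w0 > 0"
    "\<And>x. x \<in> {0..1} \<Longrightarrow> \<bar>w x\<bar> \<le> W" "\<And>x. x \<in> {0..1} \<Longrightarrow> \<bar>q x\<bar> \<le> Q" "\<And>x. x \<in> {0..1} \<Longrightarrow> w0 \<le> w x"
    by (rule coefficient_bounds) blast
  interpret bounded_field "\<lambda>x \<theta>. G \<mu> (clamp01 x) \<theta>" "1 + (\<bar>\<mu>\<bar> * W + Q + 1)"
  proof
    show "continuous_on UNIV (\<lambda>z. G \<mu> (clamp01 (fst z)) (snd z))"
      unfolding G_def using p
      by (intro continuous_intros continuous_on_powr' continuous_on_compose2[OF q] continuous_on_compose2[OF w]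
          continuous_on_compose2[OF S_continuous[of UNIV]] continuous_on_compose2[OF clamp01(1)[of UNIV]])
         (use clamp01(2) in auto)
    fix x \<theta>
    have "\<bar>\<mu> * w (clamp01 x)\<bar> \<le> \<bar>\<mu>\<bar> * W" unfolding abs_mult using b(4)[OF clamp01(2)] by (intro mult_left_mono) auto
    then have "\<bar>\<mu> * w (clamp01 x) - q (clamp01 x) - 1\<bar> \<le> \<bar>\<mu>\<bar> * W + Q + 1" using b(5)[OF clamp01(2), of x] by linarith
    then have "\<bar>\<mu> * w (clamp01 x) - q (clamp01 x) - 1\<bar> * \<bar>S \<theta>\<bar> powr p \<le> (\<bar>\<mu>\<bar> * W + Q + 1) * 1"
      using S_powr_le_1 by (intro mult_mono) auto
    then show "norm (G \<mu> (clamp01 x) \<theta>) \<le> 1 + (\<bar>\<mu>\<bar> * W + Q + 1)"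
      unfolding G_def real_norm_def using abs_triangle_ineq[of 1 "(\<mu> * w (clamp01 x) - q (clamp01 x) - 1) * \<bar>S \<theta>\<bar> powr p"]
      by (simp add: abs_mult)
  qed
  obtain \<theta> where "ode_solution (\<lambda>x \<theta>. G \<mu> (clamp01 x) \<theta>) \<alpha> \<theta>" by (rule peano)
  then have "linear_angle \<mu> \<theta>"
    by (auto simp: linear_angle_def ode_solution_def has_real_derivative_iff_has_vector_derivative clamp01(3))
  then show ?thesis by blast
qed

lemma linear_angle_le:
  assumes "linear_angle \<mu> \<phi>" "linear_angle \<nu> \<psi>" "\<mu> \<le> \<nu>" "x \<in> {0..1}"
  shows "\<phi> x \<le> \<psi> x"
proof -
  obtain K where K: "K \<ge> 0" "\<And>x a b. x \<in> {0..1} \<Longrightarrow> \<bar>G \<nu> x a - G \<nu> x b\<bar> \<le> K * \<bar>a - b\<bar>"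
    by (rule G_lipschitz[of \<nu>]) blast
  have "\<phi> x \<le> \<psi> x + 0 * exp K"
  proof (rule angle_comparison[OF K linear_angleD(4)[OF assms(1)] linear_angleD(4)[OF assms(2)]
        linear_angleD(3)[OF assms(1)] linear_angleD(3)[OF assms(2)]])
    fix x :: real assume x: "x \<in> {0<..<1}"
    then have "\<mu> * w x \<le> \<nu> * w x" using assms(3) w_pos[of x] by (intro mult_right_mono) auto
    then show "G \<mu> x (\<phi> x) - G \<nu> x (\<phi> x) \<le> G \<nu> x (\<psi> x) - G \<nu> x (\<psi> x) + 0"
      unfolding G_def by (simp add: mult_right_mono)
  qed (use linear_angleD[OF assms(1)] linear_angleD[OF assms(2)] assms in auto)
  then show ?thesis by simp
qed

definition endpoint :: "real \<Rightarrow> real" where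
  "endpoint \<mu> = (SOME \<theta>. linear_angle \<mu> \<theta>) 1"

lemma endpoint: "linear_angle \<mu> \<theta> \<Longrightarrow> \<theta> 1 = endpoint \<mu>"
  unfolding endpoint_def
  using linear_angle_le[of \<mu> \<theta> \<mu> "SOME \<theta>. linear_angle \<mu> \<theta>" 1]
    linear_angle_le[of \<mu> "SOME \<theta>. linear_angle \<mu> \<theta>" \<mu> \<theta> 1] someI[of "linear_angle \<mu>" \<theta>] by force

text \<open>If the endpoints agreed, Gronwall's inequality read backwards from \<open>1\<close> would make the two angles
equal throughout. Then \<open>S(\<theta>)\<close> would vanish identically, whereas \<open>\<theta>' = 1\<close> wherever it vanishes.\<close>

lemma endpoint_strict_mono: "\<mu> < \<nu> \<Longrightarrow> endpoint \<mu> < endpoint \<nu>"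
proof (rule ccontr)
  assume lt: "\<mu> < \<nu>" and neg: "\<not> endpoint \<mu> < endpoint \<nu>"
  obtain \<phi> \<psi> where \<phi>: "linear_angle \<mu> \<phi>" and \<psi>: "linear_angle \<nu> \<psi>" using linear_angle_exists by blast
  note \<phi>D = linear_angleD[OF \<phi>] and \<psi>D = linear_angleD[OF \<psi>]
  obtain K where K: "K \<ge> 0" "\<And>x a b. x \<in> {0..1} \<Longrightarrow> \<bar>G \<nu> x a - G \<nu> x b\<bar> \<le> K * \<bar>a - b\<bar>"
    by (rule G_lipschitz[of \<nu>]) blast
  have G_diff: "G \<nu> x t - G \<mu> x t = (\<nu> - \<mu>) * w x * \<bar>S t\<bar> powr p" for x t
    by (simp add: G_def algebra_simps)
  have zero: "\<psi> x = \<phi> x" if x: "x \<in> {0..1}" for x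
  proof -
    have "(\<psi> x - \<phi> x) * exp (K * x) \<le> (\<psi> 1 - \<phi> 1) * exp (K * 1)"
    proof (rule DERIV_nonneg_imp_increasing_open[of x 1 "\<lambda>x. (\<psi> x - \<phi> x) * exp (K * x)"])
      fix t assume "x < t" "t < 1"
      then have t: "t \<in> {0<..<1}" using x by auto
      have "((\<lambda>x. (\<psi> x - \<phi> x) * exp (K * x)) has_real_derivative
          (G \<nu> t (\<psi> t) - G \<mu> t (\<phi> t) + K * (\<psi> t - \<phi> t)) * exp (K * t)) (at t)"
        by (rule derivative_eq_intros \<psi>D(3)[OF t] \<phi>D(3)[OF t] refl | simp add: algebra_simps)+
      moreover have "0 \<le> (\<nu> - \<mu>) * w t * \<bar>S (\<phi> t)\<bar> powr p" using lt w_pos[of t] t by simp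
      then have "0 \<le> G \<nu> t (\<phi> t) - G \<mu> t (\<phi> t)" by (simp only: G_diff)
      then have "0 \<le> G \<nu> t (\<psi> t) - G \<mu> t (\<phi> t) + K * (\<psi> t - \<phi> t)"
        using K(2)[of t "\<psi> t" "\<phi> t"] linear_angle_le[OF \<phi> \<psi>, of t] lt t by auto
      ultimately show "\<exists>y. DERIV (\<lambda>x. (\<psi> x - \<phi> x) * exp (K * x)) t :> y \<and> 0 \<le> y"
        by (meson exp_ge_zero mult_nonneg_nonneg)
    qed (use x in \<open>auto intro!: continuous_intros continuous_on_subset[OF \<psi>D(4)] continuous_on_subset[OF \<phi>D(4)]\<close>)
    also have "\<dots> \<le> 0" using neg endpoint[OF \<phi>] endpoint[OF \<psi>] by (simp add: mult_le_0_iff)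
    finally have "\<psi> x \<le> \<phi> x" by (simp add: mult_le_0_iff)
    then show ?thesis using linear_angle_le[OF \<phi> \<psi>, of x] lt x by simp
  qed
  have S0: "S (\<phi> x) = 0" if x: "x \<in> {0<..<1}" for x
  proof -
    have "G \<nu> x (\<psi> x) - G \<mu> x (\<phi> x) = 0"
      by (rule locally_zero_derivative[OF DERIV_diff[OF \<psi>D(3)[OF x] \<phi>D(3)[OF x]] x]) (use zero in auto)
    then have "(\<nu> - \<mu>) * w x * \<bar>S (\<phi> x)\<bar> powr p = 0" using zero[of x] x by (simp flip: G_diff)
    then show ?thesis using lt w_pos[of x] x by auto
  qed
  have half: "(1/2::real) \<in> {0<..<1}" by simp
  have "C (\<phi> (1/2)) * G \<mu> (1/2) (\<phi> (1/2)) = 0"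
    by (rule locally_zero_derivative[OF DERIV_chain2[OF S_deriv \<phi>D(3)[OF half]] half S0])
  moreover have "G \<mu> (1/2) (\<phi> (1/2)) = 1" using S0[OF half] by (simp add: G_def)
  ultimately show False using S_or_C_nonzero[of "\<phi> (1/2)"] S0[OF half] by simp
qed

lemma endpoint_continuous: "continuous_on A endpoint"
proof (rule continuous_at_imp_continuous_on, rule ballI)
  fix \<mu>
  obtain W Q w0 where b: "W > 0" "Q > 0" "w0 > 0"
    "\<And>x. x \<in> {0..1} \<Longrightarrow> \<bar>w x\<bar> \<le> W" "\<And>x. x \<in> {0..1} \<Longrightarrow> \<bar>q x\<bar> \<le> Q" "\<And>x. x \<in> {0..1} \<Longrightarrow> w0 \<le> w x"
    by (rule coefficient_bounds) blast
  obtain K where K: "K \<ge> 0" "\<And>x a b. x \<in> {0..1} \<Longrightarrow> \<bar>G \<mu> x a - G \<mu> x b\<bar> \<le> K * \<bar>a - b\<bar>"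
    by (rule G_lipschitz[of \<mu>]) blast
  have main: "\<bar>endpoint \<nu> - endpoint \<mu>\<bar> \<le> \<bar>\<nu> - \<mu>\<bar> * W * exp K" for \<nu>
  proof -
    obtain \<phi> \<psi> where \<phi>: "linear_angle \<mu> \<phi>" and \<psi>: "linear_angle \<nu> \<psi>" using linear_angle_exists by blast
    note \<phi>D = linear_angleD[OF \<phi>] and \<psi>D = linear_angleD[OF \<psi>]
    have diff: "\<bar>G \<nu> x t - G \<mu> x t\<bar> \<le> \<bar>\<nu> - \<mu>\<bar> * W" if "x \<in> {0..1}" for x t
    proof -
      have "G \<nu> x t - G \<mu> x t = (\<nu> - \<mu>) * (w x * \<bar>S t\<bar> powr p)" by (simp add: G_def algebra_simps)
      moreover have "\<bar>w x\<bar> * \<bar>S t\<bar> powr p \<le> W * 1" using b(4)[OF that] S_powr_le_1 by (intro mult_mono) auto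
      ultimately show ?thesis by (simp add: abs_mult mult_left_mono mult.assoc)
    qed
    have "\<psi> 1 \<le> \<phi> 1 + (\<bar>\<nu> - \<mu>\<bar> * W) * exp K"
      by (rule angle_comparison[OF K \<psi>D(4) \<phi>D(4) \<psi>D(3) \<phi>D(3)])
         (use diff \<phi>D(1) \<psi>D(1) b in \<open>auto simp: abs_le_iff intro!: mult_nonneg_nonneg\<close>)
    moreover have "\<phi> 1 \<le> \<psi> 1 + (\<bar>\<nu> - \<mu>\<bar> * W) * exp K"
    proof (rule angle_comparison[OF K \<phi>D(4) \<psi>D(4) \<phi>D(3) \<psi>D(3)])
      fix x :: real assume "x \<in> {0<..<1}"
      then show "G \<mu> x (\<phi> x) - G \<mu> x (\<phi> x) \<le> G \<nu> x (\<psi> x) - G \<mu> x (\<psi> x) + \<bar>\<nu> - \<mu>\<bar> * W"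
        using diff[of x "\<psi> x"] by auto
    qed (use \<phi>D(1) \<psi>D(1) b in auto)
    ultimately show ?thesis using endpoint[OF \<phi>] endpoint[OF \<psi>] by (simp add: abs_le_iff)
  qed
  have "(endpoint \<longlongrightarrow> endpoint \<mu>) (at \<mu>)"
  proof (rule LIM_zero_cancel, rule Lim_null_comparison)
    show "\<forall>\<^sub>F \<nu> in at \<mu>. norm (endpoint \<nu> - endpoint \<mu>) \<le> \<bar>\<nu> - \<mu>\<bar> * W * exp K" using main by simp
    have "((\<lambda>\<nu>. \<bar>\<nu> - \<mu>\<bar> * W * exp K) \<longlongrightarrow> \<bar>\<mu> - \<mu>\<bar> * W * exp K) (at \<mu>)" by (intro tendsto_intros)
    then show "((\<lambda>\<nu>. \<bar>\<nu> - \<mu>\<bar> * W * exp K) \<longlongrightarrow> 0) (at \<mu>)" by simp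
  qed
  then show "isCont endpoint \<mu>" by (simp add: isCont_def)
qed

lemma endpoint_pos: "endpoint \<mu> > 0"
proof -
  obtain \<phi> where \<phi>: "linear_angle \<mu> \<phi>" using linear_angle_exists by blast
  have "\<phi> 1 > 0"
  proof (rule stays_above[OF linear_angleD(4)[OF \<phi>], where s=0 and \<theta>'="\<lambda>x. G \<mu> x (\<phi> x)"])
    show "(\<phi> has_real_derivative G \<mu> x (\<phi> x)) (at x within {0..1}) \<and> 0 < G \<mu> x (\<phi> x)"
      if "x \<in> {0..1}" "\<phi> x = 0" for x
      using linear_angleD(2)[OF \<phi> that(1)] that(2) by (simp add: G_def S_0)
  qed (use \<alpha> linear_angleD(1)[OF \<phi>] in auto)
  then show ?thesis using endpoint[OF \<phi>] by simp
qed

text \<open>For very negative \<open>\<mu>\<close> a linear function that descends from above \<open>\<alpha>\<close> to \<open>\<epsilon>\<close> without leaving \<open>(0, \<pi>\<^sub>p)\<close> is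
a supersolution, because \<open>|S|\<^sup>p\<close> is bounded below on its range.\<close>

lemma endpoint_small:
  assumes "\<epsilon> > 0"
  obtains \<mu> where "endpoint \<mu> \<le> \<epsilon>" "\<mu> \<le> \<nu>"
proof -
  define e where "e = min \<epsilon> (\<pi> / 2)"
  define a where "a = max \<alpha> e"
  have ea: "0 < e" "e \<le> \<epsilon>" "e \<le> a" "a < \<pi>" "\<alpha> \<le> a" using assms pi_pos \<alpha> by (auto simp: e_def a_def)
  have "continuous_on {e..a} (\<lambda>t. \<bar>S t\<bar> powr p)"
    using p by (intro continuous_intros continuous_on_powr' S_continuous) auto
  then obtain t0 where t0: "t0 \<in> {e..a}" "\<And>t. t \<in> {e..a} \<Longrightarrow> \<bar>S t0\<bar> powr p \<le> \<bar>S t\<bar> powr p"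
    using continuous_attains_inf[OF compact_Icc, of e a] ea by fastforce
  define c where "c = \<bar>S t0\<bar> powr p"
  have c: "c > 0" using S_pos[of t0] t0 ea by (simp add: c_def)
  obtain W Q w0 where b: "W > 0" "Q > 0" "w0 > 0"
    "\<And>x. x \<in> {0..1} \<Longrightarrow> \<bar>w x\<bar> \<le> W" "\<And>x. x \<in> {0..1} \<Longrightarrow> \<bar>q x\<bar> \<le> Q" "\<And>x. x \<in> {0..1} \<Longrightarrow> w0 \<le> w x"
    by (rule coefficient_bounds) blast
  \<comment> \<open>chosen so that \<open>\<mu> w - q - 1 \<le> -(1 + \<pi>\<^sub>p)/c\<close>, whence \<open>G \<le> -\<pi>\<^sub>p\<close> where \<open>|S|\<^sup>p \<ge> c\<close>\<close>
  define \<mu> where "\<mu> = min \<nu> (- (((1 + \<pi>) / c + Q) / w0))"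
  have \<mu>_neg: "\<mu> \<le> 0" using pi_pos c b by (auto simp: \<mu>_def intro!: min.coboundedI2)
  define \<psi> where "\<psi> x = a - (a - e) * x" for x :: real
  have \<psi>_in: "\<psi> x \<in> {e..a}" if "x \<in> {0..1}" for x
  proof -
    have "0 \<le> (a - e) * x" "(a - e) * x \<le> a - e" using that ea by (auto intro: mult_left_le)
    then show ?thesis by (simp add: \<psi>_def)
  qed
  have sup: "G \<mu> x (\<psi> x) \<le> - (a - e)" if x: "x \<in> {0..1}" for x
  proof -
    have "\<mu> * w x \<le> \<mu> * w0" using \<mu>_neg b(6)[OF x] by (intro mult_left_mono_neg)
    also have "\<mu> * w0 \<le> - (((1 + \<pi>) / c + Q) / w0) * w0" using b(3) by (intro mult_right_mono) (auto simp: \<mu>_def)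
    also have "\<dots> = - ((1 + \<pi>) / c + Q)" using b by simp
    finally have m: "\<mu> * w x - q x - 1 \<le> - ((1 + \<pi>) / c)" using b(5)[OF x] by linarith
    have "\<bar>S (\<psi> x)\<bar> powr p \<ge> c" using t0(2)[OF \<psi>_in[OF x]] by (simp add: c_def)
    moreover have "- ((1 + \<pi>) / c) \<le> 0" using c pi_pos by simp
    ultimately have "- ((1 + \<pi>) / c) * \<bar>S (\<psi> x)\<bar> powr p \<le> - ((1 + \<pi>) / c) * c" by (intro mult_left_mono_neg)
    moreover have "(\<mu> * w x - q x - 1) * \<bar>S (\<psi> x)\<bar> powr p \<le> - ((1 + \<pi>) / c) * \<bar>S (\<psi> x)\<bar> powr p"
      using m by (intro mult_right_mono) auto
    ultimately have "G \<mu> x (\<psi> x) \<le> 1 - (1 + \<pi>)" unfolding G_def using c by simp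
    then show ?thesis using ea by simp
  qed
  obtain \<phi> where \<phi>: "linear_angle \<mu> \<phi>" using linear_angle_exists by blast
  obtain K where K: "K \<ge> 0" "\<And>x a b. x \<in> {0..1} \<Longrightarrow> \<bar>G \<mu> x a - G \<mu> x b\<bar> \<le> K * \<bar>a - b\<bar>"
    by (rule G_lipschitz[of \<mu>]) blast
  have "\<phi> 1 \<le> \<psi> 1 + 0 * exp K"
  proof (rule angle_comparison[OF K linear_angleD(4)[OF \<phi>] _ linear_angleD(3)[OF \<phi>]])
    show "continuous_on {0..1} \<psi>" unfolding \<psi>_def by (intro continuous_intros)
    show "(\<psi> has_real_derivative - (a - e)) (at x)" for x
      unfolding \<psi>_def by (auto intro!: derivative_eq_intros)
    show "G \<mu> x (\<phi> x) - G \<mu> x (\<phi> x) \<le> - (a - e) - G \<mu> x (\<psi> x) + 0" if "x \<in> {0<..<1}" for x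
      using sup[of x] that by auto
  qed (use ea linear_angleD(1)[OF \<phi>] in \<open>auto simp: \<psi>_def\<close>)
  then have "endpoint \<mu> \<le> \<epsilon>" using endpoint[OF \<phi>] ea by (simp add: \<psi>_def)
  then show thesis using that[of \<mu>] by (simp add: \<mu>_def)
qed

lemma linear_amplitude:
  assumes "linear_angle \<mu> \<theta>"
  obtains L where "\<And>x. x \<in> {0..1} \<Longrightarrow> (L has_real_derivative
      C (\<theta> x) * (spow p (S (\<theta> x)) - (\<mu> * w x - q x) * spow p (S (\<theta> x)))) (at x within {0..1})"
proof -
  have "continuous_on {0..1} (\<lambda>x. C (\<theta> x) * (spow p (S (\<theta> x)) - (\<mu> * w x - q x) * spow p (S (\<theta> x))))"
    using p by (intro continuous_intros q w continuous_on_compose2[OF C_continuous[of UNIV]]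
      continuous_on_compose2[OF S_continuous[of UNIV]] linear_angleD(4)[OF assms]) auto
  from integral_has_real_derivative[OF this] show thesis using that by blast
qed

lemma endpoint_imp_eigenvalue:
  assumes "endpoint \<mu> = \<beta> + of_int k * \<pi>"
  shows "p_eigenvalue p q w \<alpha> \<beta> \<mu>"
proof -
  obtain \<theta> where \<theta>: "linear_angle \<mu> \<theta>" using linear_angle_exists by blast
  obtain L where L: "\<And>x. x \<in> {0..1} \<Longrightarrow> (L has_real_derivative
      C (\<theta> x) * (spow p (S (\<theta> x)) - (\<mu> * w x - q x) * spow p (S (\<theta> x)))) (at x within {0..1})"
    by (rule linear_amplitude[OF \<theta>]) blast
  have "bvp_solution p \<alpha> \<beta> (\<lambda>x s d. - d = (p - 1) * (\<mu> * w x - q x) * spow p s) (\<lambda>x. exp (L x) * S (\<theta> x))"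
  proof (rule prufer_bvp_solution[where h="\<lambda>x. (\<mu> * w x - q x) * spow p (S (\<theta> x))"])
    show "(\<theta> has_real_derivative \<bar>C (\<theta> x)\<bar> powr p + S (\<theta> x) * ((\<mu> * w x - q x) * spow p (S (\<theta> x))))
        (at x within {0..1})" if "x \<in> {0..1}" for x
      using linear_angleD(2)[OF \<theta> that] by (simp only: G_eq)
    show "- (- (p - 1) * (exp ((p - 1) * L x) * ((\<mu> * w x - q x) * spow p (S (\<theta> x))))) =
        (p - 1) * (\<mu> * w x - q x) * spow p (exp (L x) * S (\<theta> x))" for x
      unfolding spow_exp by (simp add: algebra_simps)
    show "\<theta> 1 = \<beta> + of_int k * \<pi>" using endpoint[OF \<theta>] assms by simp
  qed (use L linear_angleD(1)[OF \<theta>] in auto)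
  moreover have "\<exists>x\<in>{0..1}. exp (L x) * S (\<theta> x) \<noteq> 0"
  proof (rule ccontr)
    assume "\<not> ?thesis"
    then have S0: "S (\<theta> x) = 0" if "x \<in> {0<..<1}" for x using that by auto
    have half: "(1/2::real) \<in> {0<..<1}" by simp
    have "C (\<theta> (1/2)) * G \<mu> (1/2) (\<theta> (1/2)) = 0"
      by (rule locally_zero_derivative[OF DERIV_chain2[OF S_deriv linear_angleD(3)[OF \<theta> half]] half S0])
    moreover have "G \<mu> (1/2) (\<theta> (1/2)) = 1" using S0[OF half] by (simp add: G_def)
    ultimately show False using S_or_C_nonzero[of "\<theta> (1/2)"] S0[OF half] by simp
  qed
  ultimately show ?thesis unfolding p_eigenvalue_def by blast
qed

text \<open>The eigenfunction and the solution built from the linear angle are parallel at \<open>0\<close> by the boundary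
condition, hence at \<open>1\<close>, where the other boundary condition fixes the direction.\<close>

lemma eigenvalue_imp_endpoint:
  assumes "p_eigenvalue p q w \<alpha> \<beta> \<mu>"
  obtains k :: int where "endpoint \<mu> = \<beta> + of_int k * \<pi>"
proof -
  let ?m = "\<lambda>x. \<mu> * w x - q x"
  obtain y y' D s where cont: "continuous_on {0..1} y'"
    and dy: "\<And>x. x \<in> {0..1} \<Longrightarrow> (y has_real_derivative y' x) (at x within {0..1})"
    and dz: "\<And>x. x \<in> {0<..<1} \<Longrightarrow> ((\<lambda>t. spow p (y' t)) has_real_derivative D x) (at x)"
    and D: "\<And>x. x \<in> {0<..<1} \<Longrightarrow> - D x = (p - 1) * (\<mu> * w x - q x) * spow p (y x)"
    and bc: "C \<alpha> * y 0 - S \<alpha> * y' 0 = 0" "C \<beta> * y 1 - S \<beta> * y' 1 = 0"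
    and s: "s \<in> {0..1}" "y s \<noteq> 0"
    using assms unfolding p_eigenvalue_def bvp_solution_def deriv_S by blast
  have hy: "half_linear p ?m y y'"
    unfolding half_linear_def
  proof (intro conjI ballI cont dy)
    fix x :: real assume x: "x \<in> {0<..<1}"
    have "D x = - (p - 1) * (\<mu> * w x - q x) * spow p (y x)"
      using D[OF x] by (metis minus_minus mult_minus_left)
    then show "((\<lambda>t. spow p (y' t)) has_real_derivative - (p - 1) * (\<mu> * w x - q x) * spow p (y x)) (at x)"
      using dz[OF x] by simp
  qed
  have "continuous_on {0..1} ?m" by (intro continuous_intros q w)
  then obtain M where M: "\<And>x. x \<in> {0..1} \<Longrightarrow> \<bar>?m x\<bar> \<le> M" using continuous_interval_bounded by blast
  have nz: "y x \<noteq> 0 \<or> y' x \<noteq> 0" if "x \<in> {0..1}" for x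
    using half_linear_nonvanishing[OF p hy _ s that, of M] M by auto
  obtain \<theta> where \<theta>: "linear_angle \<mu> \<theta>" using linear_angle_exists by blast
  obtain L where L: "\<And>x. x \<in> {0..1} \<Longrightarrow> (L has_real_derivative
      C (\<theta> x) * (spow p (S (\<theta> x)) - (\<mu> * w x - q x) * spow p (S (\<theta> x)))) (at x within {0..1})"
    by (rule linear_amplitude[OF \<theta>]) blast
  have d\<theta>: "(\<theta> has_real_derivative \<bar>C (\<theta> x)\<bar> powr p + S (\<theta> x) * ((\<mu> * w x - q x) * spow p (S (\<theta> x))))
        (at x within {0..1})" if "x \<in> {0..1}" for x
    using linear_angleD(2)[OF \<theta> that] by (simp only: G_eq)
  note sol = prufer_solution[where h="\<lambda>x. ?m x * spow p (S (\<theta> x))", OF d\<theta> L]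
  have h2: "half_linear p ?m (\<lambda>x. exp (L x) * S (\<theta> x)) (\<lambda>x. exp (L x) * C (\<theta> x))"
    unfolding half_linear_def
  proof (intro conjI ballI)
    fix x :: real assume x: "x \<in> {0<..<1}"
    have eq: "- (p - 1) * (exp ((p - 1) * L x) * (?m x * spow p (S (\<theta> x)))) =
        - (p - 1) * ?m x * spow p (exp (L x) * S (\<theta> x))" unfolding spow_exp by (simp add: mult_ac)
    have "((\<lambda>t. spow p (exp (L t) * C (\<theta> t))) has_real_derivative
        - (p - 1) * (exp ((p - 1) * L x) * (?m x * spow p (S (\<theta> x))))) (at x)"
      using sol(3)[of x] x by (simp add: at_within_Icc_at)
    then show "((\<lambda>t. spow p (exp (L t) * C (\<theta> t))) has_real_derivative
        - (p - 1) * ?m x * spow p (exp (L x) * S (\<theta> x))) (at x)"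
      by (rule DERIV_cong[OF _ eq])
  qed (use sol in auto)
  have "y 1 * (exp (L 1) * C (\<theta> 1)) = y' 1 * (exp (L 1) * S (\<theta> 1))"
  proof (rule half_linear_parallel[OF p hy h2 _ nz])
    show "\<bar>?m x\<bar> \<le> M" if "x \<in> {0<..<1}" for x using M that by auto
    show "exp (L x) * S (\<theta> x) \<noteq> 0 \<or> exp (L x) * C (\<theta> x) \<noteq> 0" for x using S_or_C_nonzero[of "\<theta> x"] by simp
    show "y 0 * (exp (L 0) * C (\<theta> 0)) = y' 0 * (exp (L 0) * S (\<theta> 0))"
      using bc(1) linear_angleD(1)[OF \<theta>] by (simp add: mult_ac)
  qed
  then have par: "y 1 * C (\<theta> 1) = y' 1 * S (\<theta> 1)" by simp
  have "S (\<theta> 1) * C \<beta> = C (\<theta> 1) * S \<beta>"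
  proof (cases "y 1 = 0")
    case True
    then have "S (\<theta> 1) = 0" "S \<beta> = 0" using par bc(2) nz[of 1] by auto
    then show ?thesis by simp
  next
    case False
    have "y 1 * (S (\<theta> 1) * C \<beta>) = S (\<theta> 1) * (S \<beta> * y' 1)" using bc(2) by (simp add: mult_ac)
    also have "\<dots> = S \<beta> * (y 1 * C (\<theta> 1))" unfolding par by (simp add: mult_ac)
    finally show ?thesis using False by (simp add: mult_ac)
  qed
  then obtain k :: int where "\<theta> 1 = \<beta> + of_int k * \<pi>" by (rule parallel_imp_congruent)
  then have "endpoint \<mu> = \<beta> + of_int k * \<pi>" using endpoint[OF \<theta>] by simp
  then show thesis by (rule that)
qed

text \<open>Let \<open>endpoint (lam n) = \<beta> + K(n) \<pi>\<^sub>p\<close>. Then \<open>K\<close> is a strictly increasing map of the natural numbers.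
By the intermediate value theorem every number below a value of \<open>K\<close> belongs to some eigenvalue, so
the range of \<open>K\<close> is closed downwards and \<open>K\<close> is the identity.\<close>

lemma endpoint_of_nth_eigenvalue:
  assumes lam: "strict_mono lam" "range lam = {\<mu>. p_eigenvalue p q w \<alpha> \<beta> \<mu>}" and \<beta>: "\<beta> \<in> {0<..\<pi>}"
  shows "endpoint (lam n) = \<beta> + real n * \<pi>"
proof -
  have "\<exists>k. endpoint (lam n) = \<beta> + real k * \<pi>" for n
  proof -
    have "p_eigenvalue p q w \<alpha> \<beta> (lam n)" using lam(2) by blast
    then obtain k :: int where k: "endpoint (lam n) = \<beta> + of_int k * \<pi>" by (rule eigenvalue_imp_endpoint)
    then have "of_int k * \<pi> > - 1 * \<pi>" using endpoint_pos[of "lam n"] \<beta> by auto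
    then have "of_int k > (- 1 :: real)" using pi_pos by (simp only: mult_less_cancel_right_pos)
    then have "k \<ge> 0" by linarith
    then show ?thesis using k by (intro exI[of _ "nat k"]) simp
  qed
  then obtain K where K: "\<And>n. endpoint (lam n) = \<beta> + real (K n) * \<pi>" by metis
  have K_mono: "strict_mono K"
  proof (rule strict_monoI)
    fix i j :: nat assume "i < j"
    then have "endpoint (lam i) < endpoint (lam j)" using lam(1) by (intro endpoint_strict_mono) (simp add: strict_mono_def)
    then show "K i < K j" using pi_pos by (simp add: K)
  qed
  have down: "\<exists>m. K m = j" if "j < K n" for j n
  proof -
    obtain \<mu>0 where \<mu>0: "endpoint \<mu>0 \<le> \<beta>" "\<mu>0 \<le> lam n" by (rule endpoint_small[of \<beta>]) (use \<beta> in auto)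
    have "real j * \<pi> \<le> real (K n) * \<pi>" using that pi_pos by simp
    moreover have "0 \<le> real j * \<pi>" using pi_pos by simp
    ultimately have "endpoint \<mu>0 \<le> \<beta> + real j * \<pi>" "\<beta> + real j * \<pi> \<le> endpoint (lam n)"
      using \<mu>0(1) K[of n] by linarith+
    then obtain \<mu> where \<mu>: "endpoint \<mu> = \<beta> + real j * \<pi>"
      using IVT'[of endpoint \<mu>0 _ "lam n"] \<mu>0(2) endpoint_continuous by blast
    then have "p_eigenvalue p q w \<alpha> \<beta> \<mu>" using endpoint_imp_eigenvalue[of \<mu> \<beta> "int j"] by simp
    then have "\<mu> \<in> range lam" using lam(2) by simp
    then obtain m where "lam m = \<mu>" by blast
    then show ?thesis using K[of m] \<mu> pi_pos by (intro exI[of _ m]) simp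
  qed
  have "K n = n"
  proof (induction n rule: less_induct)
    case (less n)
    have "\<not> n < K n"
    proof
      assume "n < K n"
      then obtain m where m: "K m = n" using down by blast
      have "m < n" using strict_mono_less[OF K_mono, of m n] m \<open>n < K n\<close> by simp
      then show False using less m by force
    qed
    moreover have "n \<le> K n" using K_mono by (rule strict_mono_imp_increasing)
    ultimately show ?case by simp
  qed
  then show ?thesis using K[of n] by simp
qed

end

section \<open>Energy bounds for the nonlinear problem\<close>

locale nonlinear_problem = sturm_liouville +
  fixes f w' :: "real \<Rightarrow> real"
  assumes f_cont: "continuous_on UNIV f" and f_pos: "s > 0 \<Longrightarrow> f s > 0"
    and f_odd: "s > 0 \<Longrightarrow> f (- s) = - f s"
    and w'_cont: "continuous_on {0..1} w'"
    and w_deriv: "x \<in> {0..1} \<Longrightarrow> (w has_real_derivative w' x) (at x within {0..1})"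
begin

text \<open>The oddness of \<open>f\<close> in the form that reduces estimates of the nonlinear term to positive
arguments.\<close>

lemma f_sym: "s * f (r * s) = \<bar>s\<bar> * f (r * \<bar>s\<bar>)" if "r > 0"
proof (cases "s < 0")
  case True
  then have "r * \<bar>s\<bar> > 0" using that by (intro mult_pos_pos) auto
  from f_odd[OF this] show ?thesis using True by simp
qed auto

text \<open>The function \<open>h\<close> of the Pruefer system, for \<open>s = S(\<theta>)\<close> and \<open>l = L\<close>.\<close>

definition react :: "real \<Rightarrow> real \<Rightarrow> real \<Rightarrow> real" where
  "react x s l = w x * (f (exp l * s) / exp ((p - 1) * l)) - q x * spow p s"

text \<open>Solutions are considered on initial intervals \<open>[0,T]\<close> because the a priori bounds are first
applied up to the time at which a solution of the truncated system might leave the region where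
the truncation has no effect.\<close>

definition prufer_on :: "real \<Rightarrow> (real \<Rightarrow> real) \<Rightarrow> (real \<Rightarrow> real) \<Rightarrow> bool" where
  "prufer_on T \<theta> L \<longleftrightarrow> continuous_on {0..T} \<theta> \<and> continuous_on {0..T} L \<and>
     (\<forall>x\<in>{0<..<T}. (\<theta> has_real_derivative
        \<bar>C (\<theta> x)\<bar> powr p + S (\<theta> x) * react x (S (\<theta> x)) (L x)) (at x)) \<and>
     (\<forall>x\<in>{0<..<T}. (L has_real_derivative
        C (\<theta> x) * (spow p (S (\<theta> x)) - react x (S (\<theta> x)) (L x))) (at x))"

text \<open>An a priori bound that holds for all solutions and all pairs of times. Read at \<open>x = 0\<close> it bounds
the amplitude from above by its initial value; read at \<open>t = 0\<close> and contraposed, it bounds it from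
below.\<close>

definition amplitude_bound :: "real \<Rightarrow> real \<Rightarrow> bool" where
  "amplitude_bound a b \<longleftrightarrow> (\<forall>T \<theta> L. T \<le> 1 \<longrightarrow> prufer_on T \<theta> L \<longrightarrow>
     (\<forall>x\<in>{0..T}. \<forall>t\<in>{0..T}. L x \<le> a \<longrightarrow> L t < b))"

lemma amplitude_boundD:
  "amplitude_bound a b \<Longrightarrow> T \<le> 1 \<Longrightarrow> prufer_on T \<theta> L \<Longrightarrow> x \<in> {0..T} \<Longrightarrow> t \<in> {0..T} \<Longrightarrow>
    L x \<le> a \<Longrightarrow> L t < b"
  unfolding amplitude_bound_def by blast

lemma amplitude_bound_mono:
  "amplitude_bound a b \<Longrightarrow> a' \<le> a \<Longrightarrow> b \<le> b' \<Longrightarrow> amplitude_bound a' b'"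
  unfolding amplitude_bound_def by (meson order.trans less_le_trans)

lemma primitive:
  obtains F where "\<And>s. (F has_real_derivative f s) (at s)" "F 0 = 0" "\<And>s. F s \<ge> 0"
proof -
  have "\<exists>F. \<forall>x :: real. - \<infinity> < ereal x \<longrightarrow> ereal x < \<infinity> \<longrightarrow> (F has_vector_derivative f x) (at x)"
    using f_cont by (intro einterval_antiderivative) (auto simp: continuous_on_eq_continuous_at)
  then obtain F0 where F0: "\<And>x. (F0 has_real_derivative f x) (at x)"
    by (auto simp: has_real_derivative_iff_has_vector_derivative)
  define F where "F s = F0 s - F0 0" for s
  have dF: "(F has_real_derivative f s) (at s)" for s
    unfolding F_def using DERIV_diff[OF F0 DERIV_const] by simp
  have cF: "continuous_on A F" for A
    using dF DERIV_isCont by (blast intro: continuous_at_imp_continuous_on)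
  have F_0: "F 0 = 0" by (simp add: F_def)
  have "F s \<ge> 0" for s
  proof (cases "s \<ge> 0")
    case True
    have "F 0 \<le> F s"
    proof (rule DERIV_nonneg_imp_increasing_open[OF True _ cF])
      fix x :: real assume "0 < x" "x < s"
      then show "\<exists>y. DERIV F x :> y \<and> 0 \<le> y" using dF f_pos[of x] by (intro exI[of _ "f x"]) simp
    qed
    then show ?thesis using F_0 by simp
  next
    case False
    have "F s \<ge> F 0"
    proof (rule DERIV_nonpos_imp_decreasing_open[OF _ _ cF])
      fix x :: real assume "s < x" "x < 0"
      then have "f x \<le> 0" using f_pos[of "- x"] f_odd[of "- x"] by simp
      then show "\<exists>y. DERIV F x :> y \<and> y \<le> 0" using dF by blast
    qed (use False in simp)
    then show ?thesis using F_0 by simp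
  qed
  then show thesis using that dF F_0 by blast
qed

text \<open>In the original variables this is \<open>(|y|\<^sup>p + |y'|\<^sup>p)/p + w F(y)\<close>. The summand \<open>|y|\<^sup>p/p\<close> absorbs the term
with \<open>q\<close>, which the natural energy \<open>|y'|\<^sup>p/p + w F(y)\<close> does not control where \<open>F\<close> is much smaller
than \<open>|y|\<^sup>p\<close>.\<close>

definition energy :: "(real \<Rightarrow> real) \<Rightarrow> (real \<Rightarrow> real) \<Rightarrow> (real \<Rightarrow> real) \<Rightarrow> real \<Rightarrow> real" where
  "energy F \<theta> L x = exp (p * L x) / p + w x * F (exp (L x) * S (\<theta> x))"

text \<open>The derivative of the energy is \<open>(1 + q) \<phi>(y) y' + w' F(y)\<close>: the terms with \<open>f\<close> cancel. Both
summands are bounded by a multiple of the energy.\<close>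

lemma energy_estimate:
  assumes dF: "\<And>s. (F has_real_derivative f s) (at s)" and F_nonneg: "\<And>s. F s \<ge> 0"
  obtains K where "\<And>T \<theta> L x t. T \<le> 1 \<Longrightarrow> prufer_on T \<theta> L \<Longrightarrow> x \<in> {0..T} \<Longrightarrow> t \<in> {0..T} \<Longrightarrow>
    energy F \<theta> L t \<le> exp K * energy F \<theta> L x"
proof -
  obtain W Q w0 where b: "W > 0" "Q > 0" "w0 > 0"
    "\<And>x. x \<in> {0..1} \<Longrightarrow> \<bar>w x\<bar> \<le> W" "\<And>x. x \<in> {0..1} \<Longrightarrow> \<bar>q x\<bar> \<le> Q" "\<And>x. x \<in> {0..1} \<Longrightarrow> w0 \<le> w x"
    by (rule coefficient_bounds) blast
  obtain W' where W': "W' > 0" "\<And>x. x \<in> {0..1} \<Longrightarrow> \<bar>w' x\<bar> \<le> W'" using continuous_interval_bounded[OF w'_cont] by blast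
  define K where "K = p * (1 + Q) + W' / w0"
  have K: "K \<ge> 0" using p b W' by (simp add: K_def)
  have "energy F \<theta> L t \<le> exp K * energy F \<theta> L x"
    if T: "T \<le> 1" and sol: "prufer_on T \<theta> L" and xt: "x \<in> {0..T}" "t \<in> {0..T}" for T \<theta> L x t
  proof -
    let ?y = "\<lambda>x. exp (L x) * S (\<theta> x)"
    define H where "H = energy F \<theta> L"
    have H_def: "H = (\<lambda>x. exp (p * L x) / p + w x * F (?y x))" by (simp add: fun_eq_iff H_def energy_def)
    have cont: "continuous_on {0..T} \<theta>" "continuous_on {0..T} L" using sol by (auto simp: prufer_on_def)
    have cF: "continuous_on A F" for A
      using dF DERIV_isCont by (blast intro: continuous_at_imp_continuous_on)
    have H_nonneg: "H x \<ge> 0" if "x \<in> {0..T}" for x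
      using w_pos[of x] F_nonneg that T p unfolding H_def by (auto intro!: add_nonneg_nonneg mult_nonneg_nonneg less_imp_le)
    have "H t \<le> exp (K * \<bar>t - x\<bar>) * H x"
    proof (rule gronwall_two_sided[OF _ _ _ xt])
      show "continuous_on {0..T} H" unfolding H_def
        using T p by (intro continuous_intros cont continuous_on_subset[OF w] continuous_on_compose2[OF cF[of UNIV]]
            continuous_on_compose2[OF S_continuous[of UNIV]]) auto
      fix u assume u: "u \<in> {0<..<T}"
      then have u1: "u \<in> {0<..<1}" "u \<in> {0..1}" using T by auto
      let ?s = "S (\<theta> u)" and ?c = "C (\<theta> u)" and ?h = "react u (S (\<theta> u)) (L u)"
      have d\<theta>: "(\<theta> has_real_derivative \<bar>?c\<bar> powr p + ?s * ?h) (at u)"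
        and dL: "(L has_real_derivative ?c * (spow p ?s - ?h)) (at u)"
        using sol u by (auto simp: prufer_on_def)
      have dw: "(w has_real_derivative w' u) (at u)"
        using w_deriv[OF u1(2)] u1(1) by (simp add: at_within_Icc_at)
      have "((\<lambda>x. exp (L x) * S (\<theta> x)) has_real_derivative
          exp (L u) * (?c * (spow p ?s - ?h)) * ?s + ?c * (\<bar>?c\<bar> powr p + ?s * ?h) * exp (L u)) (at u)"
        by (intro DERIV_mult DERIV_chain2[OF DERIV_exp] DERIV_chain2[OF S_deriv] d\<theta> dL)
      moreover have "exp (L u) * (?c * (spow p ?s - ?h)) * ?s + ?c * (\<bar>?c\<bar> powr p + ?s * ?h) * exp (L u)
          = exp (L u) * ?c * (?s * spow p ?s + \<bar>?c\<bar> powr p)" by (simp add: algebra_simps)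
      ultimately have dy: "(?y has_real_derivative exp (L u) * ?c) (at u)" by (simp add: mult_spow pythagoras)
      let ?H' = "(1 + q u) * exp (p * L u) * (?c * spow p ?s) + w' u * F (?y u)"
      have "(H has_real_derivative exp (p * L u) * (p * (?c * (spow p ?s - ?h))) / p +
          (w' u * F (?y u) + f (?y u) * (exp (L u) * ?c) * w u)) (at u)"
        unfolding H_def by (intro DERIV_add DERIV_cdivide DERIV_chain2[OF DERIV_exp] DERIV_cmult dL DERIV_mult dw
            DERIV_chain2[OF dF dy])
      moreover have "exp (p * L u) * (p * (?c * (spow p ?s - ?h))) / p = exp (p * L u) * ?c * (spow p ?s - ?h)"
        using p by simp
      moreover have eh: "exp (p * L u) * ?h = w u * f (?y u) * exp (L u) - q u * exp (p * L u) * spow p ?s"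
      proof -
        have "exp (p * L u) = exp ((p - 1) * L u) * exp (L u)" by (simp add: exp_add[symmetric] algebra_simps)
        then have e: "exp (p * L u) / exp ((p - 1) * L u) = exp (L u)" by simp
        have "a * (b * (c / e) - d * s) = b * c * (a / e) - d * a * s" for a b c d e s :: real
          by (simp add: right_diff_distrib)
        then show ?thesis unfolding react_def e[symmetric] .
      qed
      have "exp (p * L u) * ?c * (spow p ?s - ?h) = ?c * (exp (p * L u) * spow p ?s - exp (p * L u) * ?h)"
        by (simp add: algebra_simps)
      then have "exp (p * L u) * ?c * (spow p ?s - ?h) =
          (1 + q u) * exp (p * L u) * (?c * spow p ?s) - f (?y u) * (exp (L u) * ?c) * w u"
        unfolding eh by (simp add: algebra_simps)
      ultimately show "(H has_real_derivative ?H') (at u)" by (simp add: algebra_simps)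
      have sc: "\<bar>?c * spow p ?s\<bar> \<le> 1 * 1"
        unfolding abs_mult abs_spow using C_abs_le_1 S_abs_le_1[of "\<theta> u"] p powr_mono2[of "p - 1" "\<bar>?s\<bar>" 1]
        by (intro mult_mono) auto
      have "\<bar>(1 + q u) * exp (p * L u) * (?c * spow p ?s)\<bar> \<le> ((1 + Q) * exp (p * L u)) * 1"
        unfolding abs_mult[of "(1 + q u) * exp (p * L u)"]
        using b(5)[OF u1(2)] b(2) sc by (intro mult_mono) (auto simp: abs_mult)
      also have "\<dots> = p * (1 + Q) * (exp (p * L u) / p)" using p by simp
      also have "\<dots> \<le> K * (exp (p * L u) / p)"
        unfolding K_def using W' b p by (intro mult_right_mono) auto
      finally have 1: "\<bar>(1 + q u) * exp (p * L u) * (?c * spow p ?s)\<bar> \<le> K * (exp (p * L u) / p)" .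
      have "\<bar>w' u * F (?y u)\<bar> \<le> W' * F (?y u)"
        unfolding abs_mult using W'(2)[OF u1(2)] F_nonneg by (intro mult_mono) auto
      also have "\<dots> = W' / w0 * (w0 * F (?y u))" using b by simp
      also have "\<dots> \<le> K * (w u * F (?y u))"
        unfolding K_def using b(6)[OF u1(2)] F_nonneg W' b p
        by (intro mult_mono) (auto intro!: mult_right_mono mult_nonneg_nonneg)
      finally have 2: "\<bar>w' u * F (?y u)\<bar> \<le> K * (w u * F (?y u))" .
      show "\<bar>?H'\<bar> \<le> K * H u"
        using abs_triangle_ineq[of "(1 + q u) * exp (p * L u) * (?c * spow p ?s)" "w' u * F (?y u)"] 1 2
        unfolding H_def by (simp only: distrib_left)
    qed
    also have "exp (K * \<bar>t - x\<bar>) * H x \<le> exp K * H x"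
    proof -
      have "K * \<bar>t - x\<bar> \<le> K" using K xt T by (intro mult_left_le) auto
      then show ?thesis using H_nonneg[OF xt(1)] by (intro mult_right_mono) auto
    qed
    finally show ?thesis by (simp add: H_def energy_def)
  qed
  then show thesis using that by blast
qed

text \<open>The energy at \<open>x\<close> is at most \<open>e\<^sup>p\<^sup>L\<^sup>(\<^sup>x\<^sup>)/p\<close> plus the values of \<open>w F\<close> near \<open>0\<close>, hence as small as desired
if \<open>L(x)\<close> is very negative; it bounds \<open>e\<^sup>p\<^sup>L\<^sup>(\<^sup>t\<^sup>)/p\<close>.\<close>

lemma amplitude_stays_small:
  obtains a where "amplitude_bound a b"
proof -
  obtain F where F: "\<And>s. (F has_real_derivative f s) (at s)" "F 0 = 0" "\<And>s. F s \<ge> 0" by (rule primitive) blast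
  obtain K where K: "\<And>T \<theta> L x t. T \<le> 1 \<Longrightarrow> prufer_on T \<theta> L \<Longrightarrow> x \<in> {0..T} \<Longrightarrow> t \<in> {0..T} \<Longrightarrow>
    energy F \<theta> L t \<le> exp K * energy F \<theta> L x" by (rule energy_estimate[OF F(1,3)]) blast
  obtain W where W: "W > 0" "\<And>x. x \<in> {0..1} \<Longrightarrow> \<bar>w x\<bar> \<le> W" using continuous_interval_bounded[OF w] by blast
  \<comment> \<open>each of the two summands of the energy may use half of \<open>e\<^sup>p\<^sup>b/p\<close>, after division by the factor \<open>e\<^sup>K\<close>\<close>
  define \<epsilon> where "\<epsilon> = exp (p * b) / p / (2 * exp K * W)"
  have \<epsilon>: "\<epsilon> > 0" using p W by (simp add: \<epsilon>_def)
  have "isCont F 0" using F(1) by (rule DERIV_isCont)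
  then obtain \<delta> where \<delta>: "\<delta> > 0" "\<And>s. \<bar>s\<bar> < \<delta> \<Longrightarrow> F s < \<epsilon>"
    using \<epsilon> F(2) F(3) unfolding continuous_at_eps_delta by (metis abs_of_nonneg diff_zero dist_real_def)
  define a where "a = min (ln (\<delta> / 2)) (b - (K + 1) / p)"
  have "L t < b" if T: "T \<le> 1" and sol: "prufer_on T \<theta> L" and xt: "x \<in> {0..T}" "t \<in> {0..T}" and La: "L x \<le> a" for T \<theta> L x t
  proof -
    have x1: "x \<in> {0..1}" "t \<in> {0..1}" using xt T by auto
    have "exp (L x) \<le> exp (ln (\<delta> / 2))" using La by (simp add: a_def)
    then have "exp (L x) \<le> \<delta> / 2" using \<delta>(1) by simp
    moreover have "exp (L x) * \<bar>S (\<theta> x)\<bar> \<le> exp (L x) * 1" using S_abs_le_1 by (intro mult_left_mono) auto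
    ultimately have "\<bar>exp (L x) * S (\<theta> x)\<bar> < \<delta>" using \<delta>(1) by (simp only: abs_mult abs_exp_cancel)
    then have "F (exp (L x) * S (\<theta> x)) < \<epsilon>" by (rule \<delta>(2))
    then have "w x * F (exp (L x) * S (\<theta> x)) < W * \<epsilon>"
      using W(2)[OF x1(1)] w_pos[OF x1(1)] F(3) W(1) by (intro mult_le_less_imp_less) auto
    then have 1: "exp K * (w x * F (exp (L x) * S (\<theta> x))) < exp (p * b) / p / 2"
      using W p by (simp add: \<epsilon>_def field_simps)
    have "p * L x \<le> p * (b - (K + 1) / p)" using La p by (intro mult_left_mono) (auto simp: a_def)
    also have "\<dots> = p * b - K - 1" using p by (simp add: field_simps)
    finally have "exp K * exp (p * L x) \<le> exp K * exp (p * b - K - 1)" by simp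
    also have "\<dots> = exp (p * b) / exp 1" by (simp add: exp_add[symmetric] exp_diff[symmetric])
    also have "\<dots> \<le> exp (p * b) / 2" using exp_ge_add_one_self[of 1] by (intro divide_left_mono) auto
    finally have "exp K * exp (p * L x) / p \<le> exp (p * b) / 2 / p" using p by (intro divide_right_mono) auto
    then have 2: "exp K * (exp (p * L x) / p) \<le> exp (p * b) / p / 2" by (simp add: field_simps)
    have "0 \<le> w t * F (exp (L t) * S (\<theta> t))" using w_pos[OF x1(2)] F(3) by simp
    then have "exp (p * L t) / p \<le> exp K * (exp (p * L x) / p + w x * F (exp (L x) * S (\<theta> x)))"
      using K[OF T sol xt] unfolding energy_def by linarith
    also have "\<dots> < exp (p * b) / p" using 1 2 by (simp add: distrib_left)
    finally show "L t < b" using p by (simp add: divide_less_cancel)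
  qed
  then show thesis using that unfolding amplitude_bound_def by blast
qed

text \<open>As before, now with the maximum of \<open>F\<close> on a bounded interval.\<close>

lemma amplitude_stays_bounded:
  obtains b where "amplitude_bound a b"
proof -
  obtain F where F: "\<And>s. (F has_real_derivative f s) (at s)" "F 0 = 0" "\<And>s. F s \<ge> 0" by (rule primitive) blast
  obtain K where K: "\<And>T \<theta> L x t. T \<le> 1 \<Longrightarrow> prufer_on T \<theta> L \<Longrightarrow> x \<in> {0..T} \<Longrightarrow> t \<in> {0..T} \<Longrightarrow>
    energy F \<theta> L t \<le> exp K * energy F \<theta> L x" by (rule energy_estimate[OF F(1,3)]) blast
  obtain W where W: "W > 0" "\<And>x. x \<in> {0..1} \<Longrightarrow> \<bar>w x\<bar> \<le> W" using continuous_interval_bounded[OF w] by blast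
  have "continuous_on {- exp a..exp a} F"
    using F(1) DERIV_isCont by (blast intro: continuous_at_imp_continuous_on)
  then obtain M where M: "M > 0" "\<And>s. s \<in> {- exp a..exp a} \<Longrightarrow> \<bar>F s\<bar> \<le> M" using continuous_interval_bounded by blast
  \<comment> \<open>the bound for the energy at time \<open>t\<close>\<close>
  define Z where "Z = exp K * (exp (p * a) / p + W * M)"
  have Z: "Z > 0" unfolding Z_def using p W M by (intro mult_pos_pos add_pos_pos) auto
  define b where "b = ln (2 * p * Z) / p"
  have "L t < b" if T: "T \<le> 1" and sol: "prufer_on T \<theta> L" and xt: "x \<in> {0..T}" "t \<in> {0..T}" and La: "L x \<le> a" for T \<theta> L x t
  proof -
    have x1: "x \<in> {0..1}" "t \<in> {0..1}" using xt T by auto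
    have "exp (L x) * \<bar>S (\<theta> x)\<bar> \<le> exp a * 1" using S_abs_le_1 La by (intro mult_mono) auto
    then have "\<bar>exp (L x) * S (\<theta> x)\<bar> \<le> exp a" by (simp add: abs_mult)
    then have "F (exp (L x) * S (\<theta> x)) \<le> M" using M(2)[of "exp (L x) * S (\<theta> x)"] by (simp add: abs_le_iff)
    then have 1: "w x * F (exp (L x) * S (\<theta> x)) \<le> W * M"
      using W(2)[OF x1(1)] F(3) W(1) by (intro mult_mono) auto
    have "exp (p * L x) / p \<le> exp (p * a) / p" using La p by (intro divide_right_mono) auto
    then have 2: "exp K * (exp (p * L x) / p + w x * F (exp (L x) * S (\<theta> x))) \<le> Z"
      unfolding Z_def using 1 by (intro mult_left_mono add_mono) auto
    have "0 \<le> w t * F (exp (L t) * S (\<theta> t))" using w_pos[OF x1(2)] F(3) by simp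
    then have "exp (p * L t) / p \<le> Z" using K[OF T sol xt] 2 unfolding energy_def by linarith
    then have "exp (p * L t) \<le> p * Z" using p by (simp add: field_simps)
    also have "\<dots> < 2 * p * Z" using p Z by simp
    also have "\<dots> = exp (p * b)" using p Z by (simp add: b_def)
    finally show "L t < b" using p by simp
  qed
  then show thesis using that unfolding amplitude_bound_def by blast
qed

section \<open>Shooting for the Pruefer angle\<close>

definition prufer_solution_from :: "real \<Rightarrow> (real \<Rightarrow> real) \<Rightarrow> (real \<Rightarrow> real) \<Rightarrow> bool" where
  "prufer_solution_from l \<theta> L \<longleftrightarrow> \<theta> 0 = \<alpha> \<and> L 0 = l \<and>
     (\<forall>x\<in>{0..1}. (\<theta> has_real_derivative
        \<bar>C (\<theta> x)\<bar> powr p + S (\<theta> x) * react x (S (\<theta> x)) (L x)) (at x within {0..1})) \<and>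
     (\<forall>x\<in>{0..1}. (L has_real_derivative
        C (\<theta> x) * (spow p (S (\<theta> x)) - react x (S (\<theta> x)) (L x))) (at x within {0..1}))"

lemma prufer_solution_on:
  assumes "prufer_solution_from l \<theta> L"
  shows "prufer_on 1 \<theta> L"
  unfolding prufer_on_def
proof (intro conjI ballI)
  note d = assms[unfolded prufer_solution_from_def, THEN conjunct2, THEN conjunct2]
  show "continuous_on {0..1} \<theta>" "continuous_on {0..1} L"
    using d DERIV_continuous by (metis continuous_on_eq_continuous_within)+
  fix x :: real assume x: "x \<in> {0<..<1}"
  then have "x \<in> {0..1}" by simp
  with d x show "(\<theta> has_real_derivative \<bar>C (\<theta> x)\<bar> powr p + S (\<theta> x) * react x (S (\<theta> x)) (L x)) (at x)"
    "(L has_real_derivative C (\<theta> x) * (spow p (S (\<theta> x)) - react x (S (\<theta> x)) (L x))) (at x)"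
    using at_within_Icc_at[of 0 x 1] by (metis greaterThanLessThan_iff)+
qed

text \<open>The Pruefer system with the amplitude in \<open>h\<close> clamped to \<open>[a,b]\<close>, which makes the vector field
bounded.\<close>

definition truncated :: "real \<Rightarrow> real \<Rightarrow> real \<Rightarrow> real \<times> real \<Rightarrow> real \<times> real" where
  "truncated a b x z =
     (let h = react (clamp01 x) (S (fst z)) (max a (min b (snd z)))
      in (\<bar>C (fst z)\<bar> powr p + S (fst z) * h, C (fst z) * (spow p (S (fst z)) - h)))"

lemma truncated_bounded_field:
  assumes "a \<le> b"
  obtains B where "bounded_field (truncated a b) B"
proof -
  define r where "r z = react (clamp01 (fst z)) (S (fst (snd z))) (max a (min b (snd (snd z))))" for z :: "real \<times> real \<times> real"
  have cr: "continuous_on UNIV r"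
    unfolding r_def react_def using p
    by (intro continuous_intros continuous_on_compose2[OF q] continuous_on_compose2[OF w]
        continuous_on_compose2[OF f_cont] continuous_on_compose2[OF S_continuous[of UNIV]]
        continuous_on_compose2[OF clamp01(1)[of UNIV]])
       (use clamp01(2) in auto)
  have "compact ((\<lambda>z. w (fst z) * (f (exp (snd (snd z)) * fst (snd z)) / exp ((p - 1) * snd (snd z)))
      - q (fst z) * spow p (fst (snd z))) ` ({0..1} \<times> {-1..1} \<times> {a..b}))"
    using p by (intro compact_continuous_image compact_Times compact_Icc continuous_intros
        continuous_on_compose2[OF q] continuous_on_compose2[OF w] continuous_on_compose2[OF f_cont]) auto
  then have "bounded ((\<lambda>z. react (fst z) (fst (snd z)) (snd (snd z))) ` ({0..1} \<times> {-1..1} \<times> {a..b}))"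
    unfolding react_def by (rule compact_imp_bounded)
  then obtain M where M: "\<And>x s l. x \<in> {0..1} \<Longrightarrow> s \<in> {-1..1} \<Longrightarrow> l \<in> {a..b} \<Longrightarrow> \<bar>react x s l\<bar> \<le> M"
    unfolding bounded_iff by force
  have rM: "\<bar>r z\<bar> \<le> M" for z
    unfolding r_def using S_abs_le_1[of "fst (snd z)"] assms clamp01(2) by (intro M) (auto simp: abs_le_iff)
  have eq: "truncated a b (fst z) (snd z) =
      (\<bar>C (fst (snd z))\<bar> powr p + S (fst (snd z)) * r z, C (fst (snd z)) * (spow p (S (fst (snd z))) - r z))" for z
    by (simp add: truncated_def r_def Let_def)
  have "bounded_field (truncated a b) ((1 + M) + (1 + M))"
  proof
    show "continuous_on UNIV (\<lambda>z. truncated a b (fst z) (snd z))"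
      unfolding eq using p
      by (intro continuous_intros continuous_on_powr' cr continuous_on_compose2[OF S_continuous[of UNIV]]
          continuous_on_compose2[OF C_continuous[of UNIV]]) auto
    fix x :: real and z :: "real \<times> real"
    let ?s = "S (fst z)" and ?c = "C (fst z)" and ?h = "r (x, z)"
    have "\<bar>?c\<bar> powr p \<le> 1" using pythagoras[of "fst z"] powr_ge_zero[of "\<bar>?s\<bar>" p] by linarith
    moreover have "\<bar>?s * ?h\<bar> \<le> 1 * M" unfolding abs_mult using S_abs_le_1 rM by (intro mult_mono) auto
    ultimately have 1: "\<bar>\<bar>?c\<bar> powr p + ?s * ?h\<bar> \<le> 1 + M"
      using powr_ge_zero[of "\<bar>?c\<bar>" p] by linarith
    have "\<bar>spow p ?s\<bar> \<le> 1" using S_abs_le_1[of "fst z"] p powr_mono2[of "p - 1" "\<bar>?s\<bar>" 1] by (simp add: abs_spow)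
    then have "\<bar>spow p ?s - ?h\<bar> \<le> 1 + M" using rM[of "(x, z)"] by linarith
    then have 2: "\<bar>?c * (spow p ?s - ?h)\<bar> \<le> 1 * (1 + M)"
      unfolding abs_mult using C_abs_le_1 by (intro mult_mono) auto
    show "norm (truncated a b x z) \<le> (1 + M) + (1 + M)"
      using eq[of "(x, z)"] norm_Pair_le[of "\<bar>?c\<bar> powr p + ?s * ?h" "?c * (spow p ?s - ?h)"] 1 2 by simp
  qed
  then show thesis by (rule that)
qed

text \<open>Consider the first time at which the amplitude reaches \<open>a\<close> or \<open>b\<close>. Up to then the truncation has no
effect, so the a priori bounds apply and exclude it.\<close>

lemma truncated_solution:
  assumes sol: "ode_solution (truncated a b) (\<alpha>, l) g"
    and lo: "amplitude_bound a l"
    and hi: "amplitude_bound l b"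
  shows "prufer_solution_from l (\<lambda>x. fst (g x)) (\<lambda>x. snd (g x))"
proof -
  define \<theta> where "\<theta> x = fst (g x)" for x
  define L where "L x = snd (g x)" for x
  have init: "\<theta> 0 = \<alpha>" "L 0 = l" using sol by (auto simp: ode_solution_def \<theta>_def L_def)
  let ?h = "\<lambda>x. react x (S (\<theta> x)) (max a (min b (L x)))"
  have d: "(\<theta> has_real_derivative \<bar>C (\<theta> x)\<bar> powr p + S (\<theta> x) * ?h x) (at x within {0..1}) \<and>
    (L has_real_derivative C (\<theta> x) * (spow p (S (\<theta> x)) - ?h x)) (at x within {0..1})" if x: "x \<in> {0..1}" for x
  proof -
    have "(g has_vector_derivative truncated a b x (g x)) (at x within {0..1})"
      using sol x by (simp add: ode_solution_def)
    from has_derivative_fst[OF this[unfolded has_vector_derivative_def]] has_derivative_snd[OF this[unfolded has_vector_derivative_def]]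
    show ?thesis using clamp01(3)[OF x]
      by (simp add: has_real_derivative_iff_has_vector_derivative has_vector_derivative_def truncated_def Let_def
          \<theta>_def[abs_def] L_def[abs_def])
  qed
  have cont: "continuous_on {0..1} \<theta>" "continuous_on {0..1} L"
    using d DERIV_continuous by (metis continuous_on_eq_continuous_within)+
  have on: "prufer_on T \<theta> L" if T: "0 \<le> T" "T \<le> 1" and in_ab: "\<And>x. x \<in> {0<..<T} \<Longrightarrow> a \<le> L x \<and> L x \<le> b" for T
    unfolding prufer_on_def
  proof (intro conjI ballI)
    show "continuous_on {0..T} \<theta>" "continuous_on {0..T} L" using T by (auto intro: continuous_on_subset[OF cont(1)] continuous_on_subset[OF cont(2)])
    fix x assume x: "x \<in> {0<..<T}"
    then have "max a (min b (L x)) = L x" using in_ab by simp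
    then show "(\<theta> has_real_derivative \<bar>C (\<theta> x)\<bar> powr p + S (\<theta> x) * react x (S (\<theta> x)) (L x)) (at x)"
      "(L has_real_derivative C (\<theta> x) * (spow p (S (\<theta> x)) - react x (S (\<theta> x)) (L x))) (at x)"
      using d[of x] x T by (auto simp: at_within_Icc_at)
  qed
  have good: "a < L x \<and> L x < b" if "x \<in> {0..1}" for x
  proof (rule ccontr)
    assume bad: "\<not> ?thesis"
    define Z where "Z = {x \<in> {0..1}. L x \<le> a} \<union> {x \<in> {0..1}. b \<le> L x}"
    have "closed Z" unfolding Z_def using cont
      by (intro closed_Un continuous_on_closed_Collect_le continuous_intros) auto
    then have "compact Z"
      by (auto simp: compact_eq_bounded_closed Z_def intro: bounded_subset[of "{0..1}"])
    moreover have "x \<in> Z" using bad that by (auto simp: Z_def)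
    ultimately obtain T where T: "T \<in> Z" "\<And>u. u \<in> Z \<Longrightarrow> T \<le> u" using compact_attains_inf[of Z] by blast
    have T01: "0 \<le> T" "T \<le> 1" using T(1) by (auto simp: Z_def)
    have "a \<le> L u \<and> L u \<le> b" if "u \<in> {0<..<T}" for u
      using T(2)[of u] that T01 by (force simp: Z_def)
    then have sol_T: "prufer_on T \<theta> L" using on T01 by blast
    have "\<not> L T \<le> a" using amplitude_boundD[OF lo T01(2) sol_T, of T 0] T01 init by auto
    moreover have "L T < b" using amplitude_boundD[OF hi T01(2) sol_T, of 0 T] T01 init by auto
    ultimately show False using T(1) by (auto simp: Z_def)
  qed
  have "max a (min b (L x)) = L x" if "x \<in> {0..1}" for x using good[OF that] by simp
  then show ?thesis
    unfolding prufer_solution_from_def \<theta>_def[symmetric] L_def[symmetric] using init d by (metis (no_types, lifting))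
qed

text \<open>The factor \<open>\<sigma>\<close> allows both orientations. The truncation interval is chosen from the a priori bounds
so that it contains all solutions that start with an amplitude between the two ends.\<close>

lemma nonlinear_shooting:
  fixes \<sigma> c :: real
  assumes \<sigma>: "\<sigma> \<noteq> 0"
    and small: "\<And>l \<theta> L. l \<le> l1 \<Longrightarrow> prufer_solution_from l \<theta> L \<Longrightarrow> \<sigma> * \<theta> 1 < \<sigma> * c"
    and large: "\<And>l \<theta> L. l \<ge> l2 \<Longrightarrow> prufer_solution_from l \<theta> L \<Longrightarrow> \<sigma> * \<theta> 1 > \<sigma> * c"
  obtains l \<theta> L where "prufer_solution_from l \<theta> L" "\<theta> 1 = c"
proof -
  define l0 where "l0 = min l1 l2"
  have l0: "l0 \<le> l1" "l0 \<le> l2" by (auto simp: l0_def)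
  obtain a where a: "amplitude_bound a l0" by (rule amplitude_stays_small[of l0]) blast
  obtain b where b: "amplitude_bound l2 b" by (rule amplitude_stays_bounded[of l2]) blast
  define b' where "b' = max a b"
  obtain B where "bounded_field (truncated a b') B"
    by (rule truncated_bounded_field[of a b']) (auto simp: b'_def)
  then interpret bounded_field "truncated a b'" B .
  have sol: "prufer_solution_from l (\<lambda>x. fst (g x)) (\<lambda>x. snd (g x))"
    if "ode_solution (truncated a b') (\<alpha>, l) g" "l0 \<le> l" "l \<le> l2" for l g
  proof (rule truncated_solution[OF that(1)])
    show "amplitude_bound a l" using amplitude_bound_mono[OF a] that by simp
    show "amplitude_bound l b'" using amplitude_bound_mono[OF b] that by (simp add: b'_def)
  qed
  obtain l g where l: "l \<in> {l0..l2}" "ode_solution (truncated a b') (\<alpha>, l) g" "\<sigma> * fst (g 1) = \<sigma> * c"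
  proof (rule shooting[of l0 l2 "\<lambda>l. (\<alpha>, l)" "\<lambda>z. \<sigma> * fst z" "\<sigma> * c"])
    show "\<sigma> * fst (g 1) < \<sigma> * c" if "ode_solution (truncated a b') (\<alpha>, l0) g" for g
      using small[OF l0(1) sol[OF that]] l0 by simp
    show "\<sigma> * c < \<sigma> * fst (g 1)" if "ode_solution (truncated a b') (\<alpha>, l2) g" for g
      using large[OF _ sol[OF that]] l0 by simp
  qed (use l0 in \<open>auto intro!: continuous_intros\<close>)
  then show thesis using that[OF sol[OF l(2)]] \<sigma> by auto
qed

text \<open>For \<open>\<sigma> = 1\<close> the function \<open>f\<close> lies below \<open>\<kappa> s\<^sup>p\<^sup>-\<^sup>1\<close>, and for \<open>\<sigma> = -1\<close> above it, up to an additive error \<open>c\<close>.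
In the Pruefer system this error appears divided by \<open>e\<^sup>(\<^sup>p\<^sup>-\<^sup>1\<^sup>)\<^sup>L\<close>, and \<open>\<epsilon>\<close> bounds the quotient.\<close>

definition growth_bound :: "real \<Rightarrow> real \<Rightarrow> (real \<Rightarrow> real) \<Rightarrow> real \<Rightarrow> real \<Rightarrow> bool" where
  "growth_bound \<sigma> \<kappa> L c \<epsilon> \<longleftrightarrow> c \<ge> 0 \<and>
     (\<forall>x\<in>{0..1}. \<forall>s. 0 < s \<longrightarrow> s \<le> exp (L x) \<longrightarrow> \<sigma> * f s \<le> \<sigma> * (\<kappa> * s powr (p - 1)) + c) \<and>
     (\<forall>x\<in>{0..1}. c / exp ((p - 1) * L x) \<le> \<epsilon>)"

text \<open>The right-hand sides of the two angle equations differ by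
\<open>w (S f(e\<^sup>L S) / e\<^sup>(\<^sup>p\<^sup>-\<^sup>1\<^sup>)\<^sup>L - \<kappa> |S|\<^sup>p)\<close>, to which the growth bound applies after multiplication by \<open>|S| \<le> 1\<close>.
The constant \<open>k\<close> does not depend on the solution.\<close>

lemma angle_vs_linear_angle:
  fixes \<sigma> \<kappa> :: real
  assumes \<sigma>: "\<sigma> = 1 \<or> \<sigma> = - 1"
  obtains k where "k > 0"
    "\<And>l \<theta> L c \<epsilon>. prufer_solution_from l \<theta> L \<Longrightarrow> growth_bound \<sigma> \<kappa> L c \<epsilon> \<Longrightarrow>
      \<sigma> * \<theta> 1 \<le> \<sigma> * endpoint \<kappa> + k * \<epsilon>"
proof -
  obtain W where W: "W > 0" "\<And>x. x \<in> {0..1} \<Longrightarrow> \<bar>w x\<bar> \<le> W" using continuous_interval_bounded[OF w] by blast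
  obtain K where K: "K \<ge> 0" "\<And>x a b. x \<in> {0..1} \<Longrightarrow> \<bar>G \<kappa> x a - G \<kappa> x b\<bar> \<le> K * \<bar>a - b\<bar>"
    by (rule G_lipschitz[of \<kappa>]) blast
  obtain \<phi> where \<phi>: "linear_angle \<kappa> \<phi>" using linear_angle_exists by blast
  note \<phi>D = linear_angleD[OF \<phi>]
  have "\<sigma> * \<theta> 1 \<le> \<sigma> * endpoint \<kappa> + (W * exp K) * \<epsilon>"
    if sol: "prufer_solution_from l \<theta> L" and gb: "growth_bound \<sigma> \<kappa> L c \<epsilon>" for l \<theta> L c \<epsilon>
  proof -
    have c: "c \<ge> 0"
      and fle: "\<And>x s. x \<in> {0..1} \<Longrightarrow> 0 < s \<Longrightarrow> s \<le> exp (L x) \<Longrightarrow> \<sigma> * f s \<le> \<sigma> * (\<kappa> * s powr (p - 1)) + c"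
      and eps: "\<And>x. x \<in> {0..1} \<Longrightarrow> c / exp ((p - 1) * L x) \<le> \<epsilon>"
      using gb unfolding growth_bound_def by auto
    have \<epsilon>: "\<epsilon> \<ge> 0" using eps[of 0] c by (smt (verit) atLeastAtMost_iff divide_nonneg_pos exp_gt_zero)
    have on: "prufer_on 1 \<theta> L" by (rule prufer_solution_on[OF sol])
    let ?d = "\<lambda>x. \<bar>C (\<theta> x)\<bar> powr p + S (\<theta> x) * react x (S (\<theta> x)) (L x)"
    have cont: "continuous_on {0..1} \<theta>" and der: "\<And>x. x \<in> {0<..<1} \<Longrightarrow> (\<theta> has_real_derivative ?d x) (at x)"
      using on by (auto simp: prufer_on_def)
    have init: "\<theta> 0 = \<alpha>" using sol by (simp add: prufer_solution_from_def)
    have key: "\<sigma> * (?d x - G \<kappa> x (\<theta> x)) \<le> W * \<epsilon>" if x: "x \<in> {0..1}" for x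
    proof -
      let ?s = "S (\<theta> x)" and ?E = "exp ((p - 1) * L x)"
      have diff: "?d x - G \<kappa> x (\<theta> x) = w x * (?s * f (exp (L x) * ?s) / ?E - \<kappa> * \<bar>?s\<bar> powr p)"
        unfolding G_eq react_def mult_spow[symmetric] by (simp add: algebra_simps)
      have "\<sigma> * (?s * f (exp (L x) * ?s) / ?E - \<kappa> * \<bar>?s\<bar> powr p) \<le> \<epsilon>"
      proof (cases "?s = 0")
        case True
        then show ?thesis using \<epsilon> by simp
      next
        case False
        have "exp (L x) * \<bar>?s\<bar> \<le> exp (L x)" using S_abs_le_1 by (intro mult_left_le) auto
        then have "\<sigma> * f (exp (L x) * \<bar>?s\<bar>) \<le> \<sigma> * (\<kappa> * (exp (L x) * \<bar>?s\<bar>) powr (p - 1)) + c"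
          using False by (intro fle[OF x]) auto
        also have "(exp (L x) * \<bar>?s\<bar>) powr (p - 1) = ?E * \<bar>?s\<bar> powr (p - 1)"
          by (simp add: powr_mult powr_def[of "exp (L x)"])
        finally have "\<sigma> * f (exp (L x) * \<bar>?s\<bar>) / ?E \<le> (\<sigma> * (\<kappa> * (?E * \<bar>?s\<bar> powr (p - 1))) + c) / ?E"
          by (intro divide_right_mono) auto
        also have "\<dots> = \<sigma> * \<kappa> * \<bar>?s\<bar> powr (p - 1) + c / ?E" by (simp add: add_divide_distrib)
        finally have "\<sigma> * f (exp (L x) * \<bar>?s\<bar>) / ?E \<le> \<sigma> * \<kappa> * \<bar>?s\<bar> powr (p - 1) + \<epsilon>"
          using eps[OF x] by linarith
        then have "\<bar>?s\<bar> * (\<sigma> * f (exp (L x) * \<bar>?s\<bar>) / ?E) \<le> \<bar>?s\<bar> * (\<sigma> * \<kappa> * \<bar>?s\<bar> powr (p - 1) + \<epsilon>)"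
          by (intro mult_left_mono) auto
        also have "\<bar>?s\<bar> * (\<sigma> * \<kappa> * \<bar>?s\<bar> powr (p - 1) + \<epsilon>) = \<sigma> * \<kappa> * (\<bar>?s\<bar> * \<bar>?s\<bar> powr (p - 1)) + \<bar>?s\<bar> * \<epsilon>"
          by (simp add: algebra_simps)
        also have "\<bar>?s\<bar> * \<bar>?s\<bar> powr (p - 1) = \<bar>?s\<bar> powr p"
          using mult_spow[of "\<bar>?s\<bar>" p] False by (simp add: spow_def)
        finally have "\<sigma> * (\<bar>?s\<bar> * f (exp (L x) * \<bar>?s\<bar>)) / ?E \<le> \<sigma> * \<kappa> * \<bar>?s\<bar> powr p + \<bar>?s\<bar> * \<epsilon>"
          by (simp add: mult_ac)
        moreover have "\<bar>?s\<bar> * \<epsilon> \<le> \<epsilon>" using S_abs_le_1[of "\<theta> x"] \<epsilon> by (intro mult_left_le_one_le) auto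
        moreover have "\<bar>?s\<bar> * f (exp (L x) * \<bar>?s\<bar>) = ?s * f (exp (L x) * ?s)" by (rule f_sym[symmetric]) simp
        ultimately show ?thesis by (simp add: right_diff_distrib)
      qed
      then have "w x * (\<sigma> * (?s * f (exp (L x) * ?s) / ?E - \<kappa> * \<bar>?s\<bar> powr p)) \<le> w x * \<epsilon>"
        using w_pos[OF x] by (intro mult_left_mono) auto
      also have "\<dots> \<le> W * \<epsilon>" using W(2)[OF x] \<epsilon> by (intro mult_right_mono) auto
      finally show ?thesis unfolding diff by (simp add: mult_ac)
    qed
    from \<sigma> show ?thesis
    proof
      assume 1: "\<sigma> = 1"
      have "\<theta> 1 \<le> \<phi> 1 + (W * \<epsilon>) * exp K"
        by (rule angle_comparison[OF K cont \<phi>D(4) der \<phi>D(3)])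
           (use key 1 init \<phi>D(1) W \<epsilon> in \<open>auto intro!: mult_nonneg_nonneg\<close>)
      then show ?thesis using 1 endpoint[OF \<phi>] by (simp add: mult_ac)
    next
      assume m1: "\<sigma> = - 1"
      have "\<phi> 1 \<le> \<theta> 1 + (W * \<epsilon>) * exp K"
      proof (rule angle_comparison[OF K \<phi>D(4) cont \<phi>D(3) der])
        fix x :: real assume "x \<in> {0<..<1}"
        then show "G \<kappa> x (\<phi> x) - G \<kappa> x (\<phi> x) \<le> ?d x - G \<kappa> x (\<theta> x) + W * \<epsilon>"
          using key[of x] m1 by auto
      qed (use init \<phi>D(1) W \<epsilon> in auto)
      then show ?thesis using m1 endpoint[OF \<phi>] by (simp add: mult_ac)
    qed
  qed
  then show thesis using that[of "W * exp K"] W by simp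
qed

text \<open>A solution that starts small only sees \<open>f\<close> near \<open>0\<close>, so no additive error occurs.\<close>

lemma small_amplitude_angle:
  assumes \<sigma>: "\<sigma> = 1 \<or> \<sigma> = - 1" and lt: "\<sigma> * \<kappa> < \<sigma> * \<mu>"
    and \<delta>: "\<delta> > 0" "\<And>s. 0 < s \<Longrightarrow> s < \<delta> \<Longrightarrow> \<sigma> * f s \<le> \<sigma> * (\<kappa> * s powr (p - 1))"
  obtains a where "\<And>l \<theta> L. l \<le> a \<Longrightarrow> prufer_solution_from l \<theta> L \<Longrightarrow> \<sigma> * \<theta> 1 < \<sigma> * endpoint \<mu>"
proof -
  obtain a where a: "amplitude_bound a (ln \<delta>)" by (rule amplitude_stays_small[of "ln \<delta>"]) blast
  obtain k where k: "k > 0"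
    "\<And>l \<theta> L c \<epsilon>. prufer_solution_from l \<theta> L \<Longrightarrow> growth_bound \<sigma> \<kappa> L c \<epsilon> \<Longrightarrow>
      \<sigma> * \<theta> 1 \<le> \<sigma> * endpoint \<kappa> + k * \<epsilon>" by (rule angle_vs_linear_angle[OF \<sigma>, of \<kappa>]) blast
  have "\<sigma> * \<theta> 1 < \<sigma> * endpoint \<mu>" if l: "l \<le> a" and sol: "prufer_solution_from l \<theta> L" for l \<theta> L
  proof -
    have "\<sigma> * \<theta> 1 \<le> \<sigma> * endpoint \<kappa> + k * 0"
    proof (rule k(2)[OF sol], unfold growth_bound_def, intro conjI ballI allI impI)
      fix x s :: real assume x: "x \<in> {0..1}" and s: "0 < s" "s \<le> exp (L x)"
      have "L x < ln \<delta>" using amplitude_boundD[OF a order_refl prufer_solution_on[OF sol], of 0 x] x l sol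
        by (simp add: prufer_solution_from_def)
      then have "exp (L x) < \<delta>" using \<delta>(1) by (metis exp_less_cancel_iff exp_ln)
      then show "\<sigma> * f s \<le> \<sigma> * (\<kappa> * s powr (p - 1)) + 0" using \<delta>(2) s by simp
    qed simp_all
    also have "\<sigma> * endpoint \<kappa> + k * 0 < \<sigma> * endpoint \<mu>"
      using \<sigma> lt endpoint_strict_mono[of \<kappa> \<mu>] endpoint_strict_mono[of \<mu> \<kappa>] by auto
    finally show ?thesis .
  qed
  then show thesis using that by blast
qed

text \<open>The bound on \<open>f\<close> fails on a bounded set only, where it holds up to a constant \<open>c\<close>. A solution that
starts large stays large, so that \<open>c / e\<^sup>(\<^sup>p\<^sup>-\<^sup>1\<^sup>)\<^sup>L\<close> is below half of the gap between the endpoints.\<close>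

lemma large_amplitude_angle:
  assumes \<sigma>: "\<sigma> = 1 \<or> \<sigma> = - 1" and lt: "\<sigma> * \<kappa> < \<sigma> * \<mu>"
    and R: "\<And>s. s > R \<Longrightarrow> \<sigma> * f s \<le> \<sigma> * (\<kappa> * s powr (p - 1))"
  obtains b where "\<And>l \<theta> L. l \<ge> b \<Longrightarrow> prufer_solution_from l \<theta> L \<Longrightarrow> \<sigma> * \<theta> 1 < \<sigma> * endpoint \<mu>"
proof -
  obtain k where k: "k > 0"
    "\<And>l \<theta> L c \<epsilon>. prufer_solution_from l \<theta> L \<Longrightarrow> growth_bound \<sigma> \<kappa> L c \<epsilon> \<Longrightarrow>
      \<sigma> * \<theta> 1 \<le> \<sigma> * endpoint \<kappa> + k * \<epsilon>" by (rule angle_vs_linear_angle[OF \<sigma>, of \<kappa>]) blast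
  have "continuous_on {0..R} (\<lambda>s. \<sigma> * f s - \<sigma> * (\<kappa> * s powr (p - 1)))"
    using p by (intro continuous_intros continuous_on_powr' continuous_on_subset[OF f_cont]) auto
  then obtain c where c: "c > 0" "\<And>s. s \<in> {0..R} \<Longrightarrow> \<bar>\<sigma> * f s - \<sigma> * (\<kappa> * s powr (p - 1))\<bar> \<le> c"
    using continuous_interval_bounded by blast
  have fle: "\<sigma> * f s \<le> \<sigma> * (\<kappa> * s powr (p - 1)) + c" if "s > 0" for s
    using R[of s] c(1) c(2)[of s] that by (cases "s > R") auto
  have gap: "\<sigma> * endpoint \<kappa> < \<sigma> * endpoint \<mu>"
    using \<sigma> lt endpoint_strict_mono[of \<kappa> \<mu>] endpoint_strict_mono[of \<mu> \<kappa>] by auto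
  define \<epsilon> where "\<epsilon> = (\<sigma> * endpoint \<mu> - \<sigma> * endpoint \<kappa>) / (2 * k)"
  have \<epsilon>: "\<epsilon> > 0" using gap k by (simp add: \<epsilon>_def)
  \<comment> \<open>amplitudes above \<open>a\<close> make \<open>c / e\<^sup>(\<^sup>p\<^sup>-\<^sup>1\<^sup>)\<^sup>L\<close> at most \<open>\<epsilon>\<close>\<close>
  define a where "a = ln (c / \<epsilon>) / (p - 1)"
  obtain b where b: "amplitude_bound a b" by (rule amplitude_stays_bounded[of a]) blast
  have "\<sigma> * \<theta> 1 < \<sigma> * endpoint \<mu>" if l: "l \<ge> b" and sol: "prufer_solution_from l \<theta> L" for l \<theta> L
  proof -
    have "\<sigma> * \<theta> 1 \<le> \<sigma> * endpoint \<kappa> + k * \<epsilon>"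
    proof (rule k(2)[OF sol], unfold growth_bound_def, intro conjI ballI allI impI)
      show "c \<ge> 0" using c(1) by simp
      fix x :: real assume x: "x \<in> {0..1}"
      have "\<not> L x \<le> a" using amplitude_boundD[OF b order_refl prufer_solution_on[OF sol], of x 0] x l sol
        by (auto simp: prufer_solution_from_def)
      then have "(p - 1) * a \<le> (p - 1) * L x" using p by simp
      then have "ln (c / \<epsilon>) \<le> (p - 1) * L x" using p by (simp add: a_def)
      then have "c / \<epsilon> \<le> exp ((p - 1) * L x)" using c(1) \<epsilon> by (metis divide_pos_pos exp_le_cancel_iff exp_ln)
      then show "c / exp ((p - 1) * L x) \<le> \<epsilon>" using \<epsilon> by (simp add: field_simps)
    qed (rule fle)
    also have "k * \<epsilon> = (\<sigma> * endpoint \<mu> - \<sigma> * endpoint \<kappa>) / 2" using k by (simp add: \<epsilon>_def)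
    finally show ?thesis using gap by (simp add: field_simps)
  qed
  then show thesis using that by blast
qed

lemma nonlinear_solution_of_angle:
  assumes sol: "prufer_solution_from l \<theta> L" and \<beta>: "\<beta> \<in> {0<..\<pi>}" and final: "\<theta> 1 = \<beta> + real n * \<pi>"
  shows "\<exists>y. nonlinear_solution p q w f \<alpha> \<beta> y \<and> exactly_n_zeros n y"
proof (intro exI conjI)
  have d\<theta>: "\<And>x. x \<in> {0..1} \<Longrightarrow> (\<theta> has_real_derivative
        \<bar>C (\<theta> x)\<bar> powr p + S (\<theta> x) * react x (S (\<theta> x)) (L x)) (at x within {0..1})"
    and dL: "\<And>x. x \<in> {0..1} \<Longrightarrow> (L has_real_derivative
        C (\<theta> x) * (spow p (S (\<theta> x)) - react x (S (\<theta> x)) (L x))) (at x within {0..1})"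
    and init: "\<theta> 0 = \<alpha>"
    using sol by (auto simp: prufer_solution_from_def)
  show "nonlinear_solution p q w f \<alpha> \<beta> (\<lambda>x. exp (L x) * S (\<theta> x))"
    unfolding nonlinear_solution_def
  proof (rule prufer_bvp_solution[where h="\<lambda>x. react x (S (\<theta> x)) (L x)" and k="int n"])
    fix x :: real
    have eR: "exp ((p - 1) * L x) * react x (S (\<theta> x)) (L x) =
        w x * f (exp (L x) * S (\<theta> x)) - q x * (exp ((p - 1) * L x) * spow p (S (\<theta> x)))"
      by (simp add: react_def right_diff_distrib)
    show "- (- (p - 1) * (exp ((p - 1) * L x) * react x (S (\<theta> x)) (L x))) +
        (p - 1) * q x * spow p (exp (L x) * S (\<theta> x)) = (p - 1) * w x * f (exp (L x) * S (\<theta> x))"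
      unfolding eR spow_exp by (simp add: algebra_simps)
  qed (use d\<theta> dL init final in auto)
  have cont: "continuous_on {0..1} \<theta>" using prufer_solution_on[OF sol] by (simp add: prufer_on_def)
  have "finite {x\<in>{0<..<1}. S (\<theta> x) = 0} \<and> card {x\<in>{0<..<1}. S (\<theta> x) = 0} = n"
  proof (rule zeros_of_angle[OF cont])
    fix x :: real assume "x \<in> {0..1}" "S (\<theta> x) = 0"
    then show "(\<theta> has_real_derivative \<bar>C (\<theta> x)\<bar> powr p) (at x within {0..1}) \<and> 0 < \<bar>C (\<theta> x)\<bar> powr p"
      using d\<theta>[of x] S_or_C_nonzero[of "\<theta> x"] by auto
  qed (use init \<alpha> \<beta> final in auto)
  then show "exactly_n_zeros n (\<lambda>x. exp (L x) * S (\<theta> x))" by (simp add: exactly_n_zeros_def)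
qed

end

section \<open>The boundary value problem\<close>

lemma ratio_bound_iff:
  fixes f :: "real \<Rightarrow> real"
  assumes "s > 0"
  shows "f s / s powr r < c \<longleftrightarrow> f s < c * s powr r" "f s / s powr r > c \<longleftrightarrow> f s > c * s powr r"
  using assms by (auto simp: field_simps)

theorem theorem1p2:
  fixes p \<alpha> \<beta> :: real and q w f :: "real \<Rightarrow> real" and f0 finf :: ereal
    and lam :: "nat \<Rightarrow> real" and n :: nat
  assumes "p > 1"
    and "\<alpha> \<in> {0..<pi_p p}" and "\<beta> \<in> {0<..pi_p p}"
    and "C1_01 q" and "C1_01 w" and "\<forall>x\<in>{0..1}. w x > 0"
    and "continuous_on UNIV f" and "\<forall>s>0. f s > 0" and "\<forall>s>0. f (- s) = - f s"
    and "locally_lipschitz_pos f"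
    and "0 \<le> f0" and "0 \<le> finf"
    and "((\<lambda>s. ereal (f s / s powr (p - 1))) \<longlongrightarrow> f0) (at_right 0)"
    and "((\<lambda>s. ereal (f s / s powr (p - 1))) \<longlongrightarrow> finf) at_top"
    and "strict_mono lam" and "range lam = {\<mu>. p_eigenvalue p q w \<alpha> \<beta> \<mu>}"
    and "(f0 < ereal (lam n) \<and> ereal (lam n) < finf) \<or> (finf < ereal (lam n) \<and> ereal (lam n) < f0)"
  shows "\<exists>y. nonlinear_solution p q w f \<alpha> \<beta> y \<and> exactly_n_zeros n y"
proof -
  obtain w' where w': "continuous_on {0..1} w'" "\<And>x. x \<in> {0..1} \<Longrightarrow> (w has_real_derivative w' x) (at x within {0..1})"
    using assms(5) unfolding C1_01_def by blast
  have C1_cont: "continuous_on {0..1} g" if "C1_01 g" for g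
    using that DERIV_continuous unfolding C1_01_def by (metis continuous_on_eq_continuous_within)
  interpret nonlinear_problem p q w \<alpha> f w'
    by unfold_locales (use assms w' C1_cont in auto)
  let ?r = "\<lambda>s. f s / s powr (p - 1)" and ?\<mu> = "lam n"
  have small: "\<exists>l1. \<forall>l \<theta> L. l \<le> l1 \<longrightarrow> prufer_solution_from l \<theta> L \<longrightarrow> \<sigma> * \<theta> 1 < \<sigma> * endpoint ?\<mu>"
    if \<sigma>: "\<sigma> = 1 \<and> f0 < ereal ?\<mu> \<or> \<sigma> = - 1 \<and> ereal ?\<mu> < f0" for \<sigma>
  proof -
    have "\<exists>\<kappa>. \<sigma> * \<kappa> < \<sigma> * ?\<mu> \<and> (\<forall>\<^sub>F s in at_right 0. \<sigma> * f s \<le> \<sigma> * (\<kappa> * s powr (p - 1)))"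
      using \<sigma>
    proof
      assume *: "\<sigma> = 1 \<and> f0 < ereal ?\<mu>"
      then obtain \<kappa> where \<kappa>: "f0 < ereal \<kappa>" "\<kappa> < ?\<mu>" using ereal_dense2 by force
      have "\<forall>\<^sub>F s in at_right 0. ereal (?r s) < ereal \<kappa>" by (rule order_tendstoD(2)[OF assms(13) \<kappa>(1)])
      then have "\<forall>\<^sub>F s in at_right 0. \<sigma> * f s \<le> \<sigma> * (\<kappa> * s powr (p - 1))"
        using eventually_at_right_less[of 0] by eventually_elim (use * in \<open>auto simp: ratio_bound_iff\<close>)
      then show ?thesis using * \<kappa> by auto
    next
      assume *: "\<sigma> = - 1 \<and> ereal ?\<mu> < f0"
      then obtain \<kappa> where \<kappa>: "?\<mu> < \<kappa>" "ereal \<kappa> < f0" using ereal_dense2 by force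
      have "\<forall>\<^sub>F s in at_right 0. ereal \<kappa> < ereal (?r s)" by (rule order_tendstoD(1)[OF assms(13) \<kappa>(2)])
      then have "\<forall>\<^sub>F s in at_right 0. \<sigma> * f s \<le> \<sigma> * (\<kappa> * s powr (p - 1))"
        using eventually_at_right_less[of 0] by eventually_elim (use * in \<open>auto simp: ratio_bound_iff\<close>)
      then show ?thesis using * \<kappa> by auto
    qed
    then obtain \<kappa> where \<kappa>: "\<sigma> * \<kappa> < \<sigma> * ?\<mu>" "\<forall>\<^sub>F s in at_right 0. \<sigma> * f s \<le> \<sigma> * (\<kappa> * s powr (p - 1))" by blast
    then obtain \<delta> where "\<delta> > 0" "\<And>s. 0 < s \<Longrightarrow> s < \<delta> \<Longrightarrow> \<sigma> * f s \<le> \<sigma> * (\<kappa> * s powr (p - 1))"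
      unfolding eventually_at_right_field by blast
    then show ?thesis using small_amplitude_angle[OF _ \<kappa>(1), of \<delta>] \<sigma> by metis
  qed
  have large: "\<exists>l2. \<forall>l \<theta> L. l \<ge> l2 \<longrightarrow> prufer_solution_from l \<theta> L \<longrightarrow> \<sigma> * \<theta> 1 < \<sigma> * endpoint ?\<mu>"
    if \<sigma>: "\<sigma> = 1 \<and> finf < ereal ?\<mu> \<or> \<sigma> = - 1 \<and> ereal ?\<mu> < finf" for \<sigma>
  proof -
    have "\<exists>\<kappa>. \<sigma> * \<kappa> < \<sigma> * ?\<mu> \<and> (\<forall>\<^sub>F s in at_top. \<sigma> * f s \<le> \<sigma> * (\<kappa> * s powr (p - 1)))"
      using \<sigma>
    proof
      assume *: "\<sigma> = 1 \<and> finf < ereal ?\<mu>"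
      then obtain \<kappa> where \<kappa>: "finf < ereal \<kappa>" "\<kappa> < ?\<mu>" using ereal_dense2 by force
      have "\<forall>\<^sub>F s in at_top. ereal (?r s) < ereal \<kappa>" by (rule order_tendstoD(2)[OF assms(14) \<kappa>(1)])
      then have "\<forall>\<^sub>F s in at_top. \<sigma> * f s \<le> \<sigma> * (\<kappa> * s powr (p - 1))"
        using eventually_gt_at_top[of 0] by eventually_elim (use * in \<open>auto simp: ratio_bound_iff\<close>)
      then show ?thesis using * \<kappa> by auto
    next
      assume *: "\<sigma> = - 1 \<and> ereal ?\<mu> < finf"
      then obtain \<kappa> where \<kappa>: "?\<mu> < \<kappa>" "ereal \<kappa> < finf" using ereal_dense2 by force
      have "\<forall>\<^sub>F s in at_top. ereal \<kappa> < ereal (?r s)" by (rule order_tendstoD(1)[OF assms(14) \<kappa>(2)])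
      then have "\<forall>\<^sub>F s in at_top. \<sigma> * f s \<le> \<sigma> * (\<kappa> * s powr (p - 1))"
        using eventually_gt_at_top[of 0] by eventually_elim (use * in \<open>auto simp: ratio_bound_iff\<close>)
      then show ?thesis using * \<kappa> by auto
    qed
    then obtain \<kappa> where \<kappa>: "\<sigma> * \<kappa> < \<sigma> * ?\<mu>" "\<forall>\<^sub>F s in at_top. \<sigma> * f s \<le> \<sigma> * (\<kappa> * s powr (p - 1))" by blast
    then obtain R where "\<And>s. s > R \<Longrightarrow> \<sigma> * f s \<le> \<sigma> * (\<kappa> * s powr (p - 1))"
      unfolding eventually_at_top_dense by blast
    then show ?thesis using large_amplitude_angle[OF _ \<kappa>(1), of R] \<sigma> by metis
  qed
  \<comment> \<open>\<open>\<sigma>\<close> is the side on which the angle of the small solutions falls\<close>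
  obtain \<sigma> :: real where \<sigma>: "\<sigma> = 1 \<and> f0 < ereal ?\<mu> \<and> ereal ?\<mu> < finf \<or> \<sigma> = - 1 \<and> ereal ?\<mu> < f0 \<and> finf < ereal ?\<mu>"
    using assms(17) by blast
  obtain l1 where l1: "\<And>l \<theta> L. l \<le> l1 \<Longrightarrow> prufer_solution_from l \<theta> L \<Longrightarrow> \<sigma> * \<theta> 1 < \<sigma> * endpoint ?\<mu>"
    using small[of \<sigma>] \<sigma> by blast
  obtain l2 where l2: "\<And>l \<theta> L. l \<ge> l2 \<Longrightarrow> prufer_solution_from l \<theta> L \<Longrightarrow> - \<sigma> * \<theta> 1 < - \<sigma> * endpoint ?\<mu>"
  proof -
    have "- \<sigma> = 1 \<and> finf < ereal ?\<mu> \<or> - \<sigma> = - 1 \<and> ereal ?\<mu> < finf" using \<sigma> by auto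
    from large[OF this] that show thesis by blast
  qed
  obtain l \<theta> L where sol: "prufer_solution_from l \<theta> L" "\<theta> 1 = endpoint ?\<mu>"
    by (rule nonlinear_shooting[of \<sigma> l1 "endpoint ?\<mu>" l2]) (use \<sigma> l1 l2 in fastforce)+
  have "endpoint ?\<mu> = \<beta> + real n * pi_p p"
    using endpoint_of_nth_eigenvalue assms by blast
  then show ?thesis using nonlinear_solution_of_angle[OF sol(1) assms(3)] sol(2) by simp
qed

end
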